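(* Let $\rho_1,\rho_2,\rho_3,k,b,m,\delta,\tilde\beta>0$ be constants and let $g:[0,\infty)\to\mathbb{R}$ be a differentiable kernel, not identically zero, such that: $g\ge 0$; there are constants $k_1,k_2>0$ with $-k_1g(s)\le g'(s)\le -k_2g(s)$ for all $s\ge0$; and $a:=b-b_0>0$, where $b_0:=\int_0^\infty g(s)\,ds$. Put $\chi_0=\rho_2-\frac{b\rho_1}{k}$. Then there exist constants $C,\lambda>0$ such that for every $\xi\in\mathbb{R}$, every solution $(\hat v,\hat u,\hat z,\hat y,\hat\theta,\hat\eta)$ of the Fourier-transformed Timoshenko–Fourier system (given in the context) at frequency $\xi$, and every $t\ge0$, $$\hat{\mathcal E}(\xi,t)\le C e^{-\lambda\rho(\xi)t}\hat{\mathcal E}(\xi,0),$$ where $$\hat{\mathcal E}(\xi,t)=\rho_1|\hat u|^2+\rho_2|\hat y|^2+\rho_3|\hat\theta|^2+k|\hat v|^2+a|\hat z|^2+m\xi^2\int_0^\infty g(s)|\hat\eta(s)|^2ds$$ and $$\rho(\xi)=\begin{cases}\dfrac{\xi^4}{(1+\xi^2)^3}&\text{if }\chi_0=0,\\[2mm] \dfrac{\xi^4}{(1+\xi^2)^4}&\text{if }\chi_0\neq0.\end{cases}$$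
   Context: Fourier-transformed Timoshenko–Fourier system with history at frequency $\xi\in\mathbb{R}$: complex-valued unknowns $\hat v,\hat u,\hat z,\hat y,\hat\theta$ depending on $t\ge 0$ and $\hat\eta=\hat\eta(t,s)$ depending on $t\ge0$, $s\ge0$, with $$\begin{aligned} &\hat v_t-i\xi\hat u+\hat y=0,\qquad \rho_1\hat u_t-ik\xi\hat v=0,\qquad \hat z_t-i\xi\hat y=0,\\ &\rho_2\hat y_t-ia\xi\hat z+m\xi^2\int_0^\infty g(s)\hat\eta(s)\,ds-k\hat v+i\delta\xi\hat\theta=0,\\ &\rho_3\hat\theta_t+\tilde\beta\xi^2\hat\theta+i\delta\xi\hat y=0,\\ &\hat\eta_t+\hat\eta_s-\hat y=0,\qquad \hat\eta(t,0)=0. \end{aligned}$$ A solution is understood to be sufficiently regular and of finite energy ($\int_0^\infty g|\hat\eta|^2ds<\infty$). *)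

theory Defs
  imports "HOL-Analysis.Analysis"
begin

(* A solution at frequency \<xi> is a classical one. Derivatives in t are one-sided at t = 0.
   The history variable \<eta> t s is required to be continuous on the closed quadrant and (jointly)
   differentiable in its interior, with partial derivatives Dt and Ds; the transport equation is
   imposed in the interior only, which makes the notion more permissive than requiring one-sided
   derivatives on the boundary. Finite energy at each time also makes g * \<eta> t integrable
   (Cauchy-Schwarz), so the memory integral is a genuine one whenever g itself is integrable.
   No values at negative arguments are ever constrained or used. *)
definition timoshenko_fourier_solution ::
  "real \<Rightarrow> real \<Rightarrow> real \<Rightarrow> real \<Rightarrow> real \<Rightarrow> real \<Rightarrow> real \<Rightarrow> real \<Rightarrow> (real \<Rightarrow> real) \<Rightarrow> real \<Rightarrow>
   (real \<Rightarrow> complex) \<Rightarrow> (real \<Rightarrow> complex) \<Rightarrow> (real \<Rightarrow> complex) \<Rightarrow> (real \<Rightarrow> complex) \<Rightarrow>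
   (real \<Rightarrow> complex) \<Rightarrow> (real \<Rightarrow> real \<Rightarrow> complex) \<Rightarrow> bool"
  where
  "timoshenko_fourier_solution \<rho>1 \<rho>2 \<rho>3 k a m \<delta> \<beta> g \<xi> v u z y \<theta> \<eta> \<longleftrightarrow>
     (\<exists>v' u' z' y' \<theta>'. \<forall>t\<ge>0.
        (v has_vector_derivative v' t) (at t within {0..}) \<and>
        (u has_vector_derivative u' t) (at t within {0..}) \<and>
        (z has_vector_derivative z' t) (at t within {0..}) \<and>
        (y has_vector_derivative y' t) (at t within {0..}) \<and>
        (\<theta> has_vector_derivative \<theta>' t) (at t within {0..}) \<and>
        v' t - \<i> * of_real \<xi> * u t + y t = 0 \<and>
        of_real \<rho>1 * u' t - \<i> * of_real (k * \<xi>) * v t = 0 \<and>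
        z' t - \<i> * of_real \<xi> * y t = 0 \<and>
        of_real \<rho>2 * y' t - \<i> * of_real (a * \<xi>) * z t
          + of_real (m * \<xi>\<^sup>2) * (LINT s:{0..}|lborel. of_real (g s) * \<eta> t s)
          - of_real k * v t + \<i> * of_real (\<delta> * \<xi>) * \<theta> t = 0 \<and>
        of_real \<rho>3 * \<theta>' t + of_real (\<beta> * \<xi>\<^sup>2) * \<theta> t + \<i> * of_real (\<delta> * \<xi>) * y t = 0) \<and>
     continuous_on ({0..} \<times> {0..}) (\<lambda>(t, s). \<eta> t s) \<and>
     (\<forall>t>0. \<forall>s>0. \<exists>Dt Ds.
        ((\<lambda>(t, s). \<eta> t s) has_derivative (\<lambda>(h, r). h *\<^sub>R Dt + r *\<^sub>R Ds)) (at (t, s)) \<and>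
        Dt + Ds - y t = 0) \<and>
     (\<forall>t\<ge>0. \<eta> t 0 = 0) \<and>
     (\<forall>t\<ge>0. set_integrable lborel {0..} (\<lambda>s. g s * (cmod (\<eta> t s))\<^sup>2))"

definition fourier_energy ::
  "real \<Rightarrow> real \<Rightarrow> real \<Rightarrow> real \<Rightarrow> real \<Rightarrow> real \<Rightarrow> (real \<Rightarrow> real) \<Rightarrow> real \<Rightarrow>
   (real \<Rightarrow> complex) \<Rightarrow> (real \<Rightarrow> complex) \<Rightarrow> (real \<Rightarrow> complex) \<Rightarrow> (real \<Rightarrow> complex) \<Rightarrow>
   (real \<Rightarrow> complex) \<Rightarrow> (real \<Rightarrow> real \<Rightarrow> complex) \<Rightarrow> real \<Rightarrow> real"
  where
  "fourier_energy \<rho>1 \<rho>2 \<rho>3 k a m g \<xi> v u z y \<theta> \<eta> t =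
     \<rho>1 * (cmod (u t))\<^sup>2 + \<rho>2 * (cmod (y t))\<^sup>2 + \<rho>3 * (cmod (\<theta> t))\<^sup>2
     + k * (cmod (v t))\<^sup>2 + a * (cmod (z t))\<^sup>2
     + m * \<xi>\<^sup>2 * (LINT s:{0..}|lborel. g s * (cmod (\<eta> t s))\<^sup>2)"

definition decay_rate :: "real \<Rightarrow> real \<Rightarrow> real"
  where
  "decay_rate \<chi>0 \<xi> =
     (if \<chi>0 = 0 then \<xi> ^ 4 / (1 + \<xi>\<^sup>2) ^ 3 else \<xi> ^ 4 / (1 + \<xi>\<^sup>2) ^ 4)"

end

(*
  The energy satisfies E' <= -2 beta xi^2 |theta|^2 - k2 m xi^2 int g |eta|^2, so only theta and the
  history are damped directly. Put sigma = 1 + xi^2, w = k v + i a xi z and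
  Q = int_0^oo exp(-k1 s) eta(s) ds. Since exp(-k1 s) <= g(s) / g(0), the history part of the energy
  controls Q, and Q' = y / k1 - k1 Q without any term in g'. The damping is handed on to the other
  unknowns along the chain history -> y -> w -> z -> u by the correctors
    h1 = (xi^2 / sigma) rho2 Re(y conj Q),        h2 = (xi^2 / sigma^2) rho2 Re(y conj w),
    h3 = (xi^2 / sigma^2) rho1 Re(u conj z),      h4 = -(xi^3 / sigma^3) rho1 Re(u conj(i v)),
  and a suitable combination K E - A1 h1 - A2 h2 - A3 h3 - h4 is equivalent to E and decays at the rate
  xi^4 / (1 + xi^2)^3. This works whatever the value of chi0, so the first branch of the rate holds
  in both cases and the second one is weaker.

  Solutions are only classical in the interior and g' need not be continuous, so int g |eta|^2 is not
  differentiated. Along characteristics it is bounded by the solution P of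
  P' = -k2 P + 2 Re(y conj(int g eta)) with the same initial value, and E is replaced by the
  differentiable energy in which P takes the place of int g |eta|^2.
*)

theory Submission
  imports Defs
begin

text \<open>A cross term created by a corrector can be absorbed when its weight is at most the
  geometric mean of the dissipation weights of its two factors. The available weights are
  \<open>\<xi>\<^sup>2\<close> for \<theta> and for the history,
  \<open>\<xi>\<^sup>2 / \<sigma>\<close> for \<open>y\<close>,
  \<open>\<xi>\<^sup>2 / \<sigma>\<^sup>2\<close> for \<open>w\<close>,
  \<open>\<xi> ^ 4 / \<sigma>\<^sup>2\<close> for \<open>z\<close> and
  \<open>\<xi> ^ 4 / \<sigma> ^ 3\<close> for \<open>u\<close>. The prefactors come from this
  balance: the products of \<open>w\<close> with \<open>Q\<close> in \<open>h1\<close>, of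
  \<open>w\<close> with \<open>z\<close> in \<open>h3\<close> and of \<open>y\<close> with
  \<open>u\<close> in \<open>h2\<close> and \<open>h3\<close> meet it with equality, so they yield
  to Young's inequality and no cancellation between them has to be arranged. The weight of
  \<open>u\<close> is the smallest one and is the decay rate. For the history, time derivatives are
  replaced by estimates over one step from \<open>t\<close> to \<open>t + h\<close> with an error of
  order \<open>h\<^sup>2\<close>. Over a partition into n equal steps the errors sum to order 1/n,
  so integrated inequalities follow without time regularity of the history energy. The comparison
  functions are explicit variation-of-constants formulas, differentiable because \<open>y\<close> is
  continuous and the memory integral is locally Lipschitz.\<close>

section \<open>Lyapunov functional\<close>

lemma young_ineq: "S * (a * b) \<le> a\<^sup>2 / 2 + S\<^sup>2 / 2 * b\<^sup>2" for a b S :: real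
  using sum_squares_bound[of a "S * b"] by (simp add: power_mult_distrib algebra_simps)

text \<open>The constants are chosen in the order \<open>A5\<close>, \<open>A2\<close>, \<open>A1\<close>, \<open>K0\<close>: the bad terms of each \<open>d\<close> are
  absorbed by the good terms of those chosen later.\<close>
lemma coercive_combination:
  fixes C :: real
  assumes "C \<ge> 0"
  obtains A1 A2 A5 K0 :: real where "A1 \<ge> 0" "A2 \<ge> 0" "A5 \<ge> 0" "K0 \<ge> 0"
    "\<And>K d1 d2 d4 d5 e yy ww zz uu tt p. K \<ge> K0 \<Longrightarrow>
       d1 \<ge> yy\<^sup>2 - C * (yy * p + ww * p + tt * p + p\<^sup>2) \<Longrightarrow>
       d2 \<ge> ww\<^sup>2 - C * (p * ww + tt * ww + uu * yy + yy\<^sup>2) \<Longrightarrow>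
       d5 \<ge> zz\<^sup>2 - C * (ww * zz + uu * yy) \<Longrightarrow>
       d4 \<ge> uu\<^sup>2 - C * (ww\<^sup>2 + zz\<^sup>2 + uu * yy) \<Longrightarrow>
       e \<ge> tt\<^sup>2 + p\<^sup>2 \<Longrightarrow>
       K * e + A1 * d1 + A2 * d2 + A5 * d5 + d4
         \<ge> (tt\<^sup>2 + p\<^sup>2 + yy\<^sup>2 + ww\<^sup>2 + zz\<^sup>2 + uu\<^sup>2) / 2"
proof -
  \<comment> \<open>\<open>A5\<close> pays for the \<open>zz\<^sup>2\<close> cost in
    \<open>d4\<close>, and \<open>A2\<close> for the \<open>ww\<^sup>2\<close> costs of
    \<open>d4\<close> and of Young's inequality in \<open>d5\<close>. \<open>S\<close> is the total
    coefficient of \<open>uu * yy\<close>, and \<open>A1\<close> covers its share of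
    \<open>yy\<^sup>2\<close> together with that of \<open>d2\<close>. The additional 1 or 2 makes
    up for the halves spent in Young's inequality.\<close>
  define A5 where "A5 = C + 1"
  define A2 where "A2 = C + (A5 * C)\<^sup>2 / 2 + 2"
  define S where "S = C * (A2 + A5 + 1)"
  define A1 where "A1 = S\<^sup>2 / 2 + A2 * C + 1"
  define K0 where "K0 = (A2 * C)\<^sup>2 + (A1 * C)\<^sup>2 + A1 * C + A1 * C + 1"
  have nn: "A1 \<ge> 0" "A2 \<ge> 0" "A5 \<ge> 0" "K0 \<ge> 0" "A1 * C \<ge> 0"
    using assms by (simp_all add: A1_def A2_def A5_def K0_def)
  have "K * e + A1 * d1 + A2 * d2 + A5 * d5 + d4
         \<ge> (tt\<^sup>2 + p\<^sup>2 + yy\<^sup>2 + ww\<^sup>2 + zz\<^sup>2 + uu\<^sup>2) / 2"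
    if K: "K \<ge> K0" and d1: "d1 \<ge> yy\<^sup>2 - C * (yy * p + ww * p + tt * p + p\<^sup>2)"
      and d2: "d2 \<ge> ww\<^sup>2 - C * (p * ww + tt * ww + uu * yy + yy\<^sup>2)"
      and d5: "d5 \<ge> zz\<^sup>2 - C * (ww * zz + uu * yy)"
      and d4: "d4 \<ge> uu\<^sup>2 - C * (ww\<^sup>2 + zz\<^sup>2 + uu * yy)"
      and e: "e \<ge> tt\<^sup>2 + p\<^sup>2"
    for K d1 d2 d4 d5 e yy ww zz uu tt p :: real
  proof -
    have sq: "0 \<le> tt\<^sup>2" "0 \<le> p\<^sup>2" "0 \<le> ww\<^sup>2" by simp_all
    have "A1 * C * (yy * p) \<le> yy\<^sup>2 / 2 + (A1 * C)\<^sup>2 / 2 * p\<^sup>2"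
      "A1 * C * (ww * p) \<le> ww\<^sup>2 / 2 + (A1 * C)\<^sup>2 / 2 * p\<^sup>2" by (rule young_ineq)+
    moreover have "A1 * C * (tt * p) + A1 * C * (tt * p) \<le> A1 * C * (tt\<^sup>2 + p\<^sup>2)"
      using mult_left_mono[OF sum_squares_bound[of tt p] nn(5)] by (simp add: algebra_simps)
    moreover have "A1 * d1 \<ge> A1 * yy\<^sup>2 - (A1 * C * (yy * p) + A1 * C * (ww * p) + A1 * C * (tt * p) + A1 * C * p\<^sup>2)"
      using mult_left_mono[OF d1 nn(1)] by (simp add: algebra_simps)
    moreover have "A1 * C * (tt\<^sup>2 + p\<^sup>2) = A1 * C * tt\<^sup>2 + A1 * C * p\<^sup>2" by (rule distrib_left)
    ultimately have c1: "A1 * d1 \<ge> A1 * yy\<^sup>2 - yy\<^sup>2 / 2 - ww\<^sup>2 / 2 - (A1 * C)\<^sup>2 * p\<^sup>2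
        - A1 * C * tt\<^sup>2 / 2 - 3 / 2 * (A1 * C * p\<^sup>2)"
      by linarith
    have "A2 * C * (ww * (p + tt)) \<le> ww\<^sup>2 / 2 + (A2 * C)\<^sup>2 / 2 * (p + tt)\<^sup>2" by (rule young_ineq)
    moreover have "(A2 * C)\<^sup>2 / 2 * (p + tt)\<^sup>2 \<le> (A2 * C)\<^sup>2 / 2 * (2 * (p\<^sup>2 + tt\<^sup>2))"
      using sum_squares_bound[of p tt] by (intro mult_left_mono) (auto simp: power2_sum)
    moreover have "A2 * d2 \<ge> A2 * ww\<^sup>2 - (A2 * C * (ww * (p + tt)) + A2 * C * (uu * yy) + A2 * C * yy\<^sup>2)"
      using mult_left_mono[OF d2 nn(2)] by (simp add: algebra_simps)
    ultimately have c2: "A2 * d2 \<ge> A2 * ww\<^sup>2 - ww\<^sup>2 / 2 - (A2 * C)\<^sup>2 * (p\<^sup>2 + tt\<^sup>2)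
        - A2 * C * (uu * yy) - A2 * C * yy\<^sup>2"
      by linarith
    have "A5 * C * (zz * ww) \<le> zz\<^sup>2 / 2 + (A5 * C)\<^sup>2 / 2 * ww\<^sup>2" by (rule young_ineq)
    moreover have "A5 * d5 \<ge> A5 * zz\<^sup>2 - (A5 * C * (zz * ww) + A5 * C * (uu * yy))"
      using mult_left_mono[OF d5 nn(3)] by (simp add: algebra_simps)
    ultimately have c5: "A5 * d5 \<ge> A5 * zz\<^sup>2 - zz\<^sup>2 / 2 - (A5 * C)\<^sup>2 / 2 * ww\<^sup>2 - A5 * C * (uu * yy)"
      by linarith
    have c4: "d4 \<ge> uu\<^sup>2 - (C * ww\<^sup>2 + C * zz\<^sup>2 + C * (uu * yy))"
      using d4 by (simp add: algebra_simps)
    \<comment> \<open>The products \<open>uu * yy\<close> from \<open>d2\<close>, \<open>d5\<close>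
      and \<open>d4\<close> are estimated together: \<open>d4\<close> enters with coefficient 1, so
      only one half of \<open>uu\<^sup>2\<close> can be spent on all of them.\<close>
    have "A2 * C * (uu * yy) + A5 * C * (uu * yy) + C * (uu * yy) = S * (uu * yy)"
      by (simp add: S_def algebra_simps)
    also have "\<dots> \<le> uu\<^sup>2 / 2 + S\<^sup>2 / 2 * yy\<^sup>2" by (rule young_ineq)
    finally have cu: "A2 * C * (uu * yy) + A5 * C * (uu * yy) + C * (uu * yy) \<le> uu\<^sup>2 / 2 + S\<^sup>2 / 2 * yy\<^sup>2" .
    have "K * e \<ge> K0 * (tt\<^sup>2 + p\<^sup>2)"
      using mult_mono[OF K e] K nn by simp
    also have "K0 * (tt\<^sup>2 + p\<^sup>2) = (A2 * C)\<^sup>2 * (p\<^sup>2 + tt\<^sup>2) + (A1 * C)\<^sup>2 * tt\<^sup>2 + (A1 * C)\<^sup>2 * p\<^sup>2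
        + 2 * (A1 * C * tt\<^sup>2) + 2 * (A1 * C * p\<^sup>2) + tt\<^sup>2 + p\<^sup>2"
      by (simp add: K0_def algebra_simps)
    finally have cK: "K * e \<ge> \<dots>" .
    have "A1 * yy\<^sup>2 = S\<^sup>2 / 2 * yy\<^sup>2 + A2 * C * yy\<^sup>2 + yy\<^sup>2"
      "A2 * ww\<^sup>2 = C * ww\<^sup>2 + (A5 * C)\<^sup>2 / 2 * ww\<^sup>2 + 2 * ww\<^sup>2"
      "A5 * zz\<^sup>2 = C * zz\<^sup>2 + zz\<^sup>2"
      by (simp_all only: A1_def A2_def A5_def distrib_right mult_1)
    moreover have "(A1 * C)\<^sup>2 * tt\<^sup>2 \<ge> 0" "A1 * C * tt\<^sup>2 \<ge> 0" "A1 * C * p\<^sup>2 \<ge> 0" using nn by simp_all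
    ultimately show ?thesis using c1 c2 c5 c4 cu cK sq by argo
  qed
  with nn that[of A1 A2 A5 K0] show ?thesis by blast
qed

text \<open>Cauchy-Schwarz with the scalar in front, split into one-sided forms, so that
  monotonicity rules can estimate a derivative term by term.\<close>

lemma scaled_inner_bounds: "a * norm x * norm y \<ge> a * (x \<bullet> y)" "a * (x \<bullet> y) \<ge> - (a * norm x * norm y)"
  if "a \<ge> 0" for x y :: "'a::real_inner"
proof -
  have *: "\<bar>a * (x \<bullet> y)\<bar> \<le> a * (norm x * norm y)"
    using that by (simp add: abs_mult mult_left_mono Cauchy_Schwarz_ineq2)
  show "a * norm x * norm y \<ge> a * (x \<bullet> y)" "a * (x \<bullet> y) \<ge> - (a * norm x * norm y)"
    using * by (simp_all add: abs_le_iff mult.assoc)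
qed

text \<open>Each square alone is at most \<open>e\<close> divided by its weight. With
  \<open>e\<close> the energy, this bounds the products inside the correctors.\<close>

lemma product_le_weighted_squares:
  fixes r q X Y e :: real
  assumes "e \<ge> r * X\<^sup>2 + q * Y\<^sup>2" "r > 0" "q > 0" "e \<ge> 0" "X \<ge> 0" "Y \<ge> 0"
  shows "X * Y \<le> (1 / r + 1 / q) * e"
proof -
  have "0 \<le> q * Y\<^sup>2" "0 \<le> r * X\<^sup>2" using assms by simp_all
  then have "r * X\<^sup>2 \<le> e" "q * Y\<^sup>2 \<le> e" using assms(1) by linarith+
  then have "X\<^sup>2 \<le> e / r" "Y\<^sup>2 \<le> e / q" using assms by (simp_all add: field_simps)
  then have "2 * (X * Y) \<le> e / r + e / q" using sum_squares_bound[of X Y] by (simp add: mult.assoc)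
  moreover have "0 \<le> X * Y" using assms by simp
  ultimately have "X * Y \<le> e / r + e / q" by linarith
  then show ?thesis by (simp add: distrib_right)
qed

section \<open>Calculus on the half-line\<close>

lemma has_real_derivative_inner:
  assumes "(f has_vector_derivative f') (at t within S)" "(g has_vector_derivative g') (at t within S)"
  shows "((\<lambda>t. f t \<bullet> g t) has_real_derivative (f t \<bullet> g' + f' \<bullet> g t)) (at t within S)"
  unfolding has_real_derivative_iff_has_vector_derivative
  by (rule bounded_bilinear.has_vector_derivative[OF bounded_bilinear_inner assms])

text \<open>The sign of the derivative is used only in the open interval, where the one-sided
  derivative is a two-sided one; continuity takes care of the ends.\<close>

lemma nonincreasing_on_halfline:
  fixes f :: "real \<Rightarrow> real"
  assumes "\<And>t. t \<ge> 0 \<Longrightarrow> (f has_real_derivative f' t) (at t within {0..})" "\<And>t. t \<ge> 0 \<Longrightarrow> f' t \<le> 0"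
    and "0 \<le> s" "s \<le> t"
  shows "f t \<le> f s"
proof (rule DERIV_nonpos_imp_decreasing_open[OF assms(4)])
  show "\<exists>y. (f has_real_derivative y) (at r) \<and> y \<le> 0" if "s < r" "r < t" for r
    using assms(1)[of r] assms(2)[of r] assms(3) that at_within_interior[of r "{0..}"] by auto
  have "continuous_on {0..} f"
    using assms(1) by (auto intro!: DERIV_continuous simp: continuous_on_eq_continuous_within)
  then show "continuous_on {s..t} f"
    by (rule continuous_on_subset) (use assms(3) in auto)
qed

lemma gronwall:
  fixes L :: "real \<Rightarrow> real"
  assumes "\<And>t. t \<ge> 0 \<Longrightarrow> (L has_real_derivative L' t) (at t within {0..})"
    and "\<And>t. t \<ge> 0 \<Longrightarrow> L' t \<le> - r * L t" and "t \<ge> 0"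
  shows "L t \<le> exp (- r * t) * L 0"
proof -
  have "exp (r * t) * L t \<le> exp (r * 0) * L 0"
  proof (rule nonincreasing_on_halfline[where f = "\<lambda>t. exp (r * t) * L t"
        and f' = "\<lambda>t. exp (r * t) * (L' t + r * L t)"])
    show "((\<lambda>t. exp (r * t) * L t) has_real_derivative exp (r * t) * (L' t + r * L t)) (at t within {0..})"
      if "t \<ge> 0" for t
      using assms(1)[OF that] by (auto intro!: derivative_eq_intros simp: algebra_simps)
    show "exp (r * t) * (L' t + r * L t) \<le> 0" if "t \<ge> 0" for t
      using assms(2)[OF that] by (intro mult_nonneg_nonpos) auto
  qed (use assms in auto)
  then have "exp (- r * t) * (exp (r * t) * L t) \<le> exp (- r * t) * L 0"
    by (intro mult_left_mono) auto
  then show ?thesis by (simp flip: mult.assoc exp_add)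
qed

text \<open>\<open>N\<close> is the memory integral, \<open>Q\<close> the exponentially weighted history and \<open>P\<close> a majorant of
  the history energy; only the following differential relations and bounds are needed of them.\<close>
locale damped_modes =
  fixes \<rho>1 \<rho>2 \<rho>3 k a m \<delta> \<beta> k1 k2 c \<xi> :: real
    and v u z y \<theta> N Q :: "real \<Rightarrow> complex" and P :: "real \<Rightarrow> real"
    and v' u' z' y' \<theta>' :: "real \<Rightarrow> complex"
  assumes pos: "\<rho>1 > 0" "\<rho>2 > 0" "\<rho>3 > 0" "k > 0" "a > 0" "m > 0" "\<delta> > 0" "\<beta> > 0" "k1 > 0" "k2 > 0" "c > 0"
    and deriv: "\<And>t. t \<ge> 0 \<Longrightarrow> (v has_vector_derivative v' t) (at t within {0..})"
      "\<And>t. t \<ge> 0 \<Longrightarrow> (u has_vector_derivative u' t) (at t within {0..})"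
      "\<And>t. t \<ge> 0 \<Longrightarrow> (z has_vector_derivative z' t) (at t within {0..})"
      "\<And>t. t \<ge> 0 \<Longrightarrow> (y has_vector_derivative y' t) (at t within {0..})"
      "\<And>t. t \<ge> 0 \<Longrightarrow> (\<theta> has_vector_derivative \<theta>' t) (at t within {0..})"
    and deriv_Q: "\<And>t. t \<ge> 0 \<Longrightarrow>
        (Q has_vector_derivative (1 / k1) *\<^sub>R y t - k1 *\<^sub>R Q t) (at t within {0..})"
    and deriv_P: "\<And>t. t \<ge> 0 \<Longrightarrow>
        (P has_real_derivative - k2 * P t + 2 * (y t \<bullet> N t)) (at t within {0..})"
    and eq_v: "\<And>t. t \<ge> 0 \<Longrightarrow> v' t = \<xi> *\<^sub>R (\<i> * u t) - y t"
    and eq_u: "\<And>t. t \<ge> 0 \<Longrightarrow> \<rho>1 *\<^sub>R u' t = (k * \<xi>) *\<^sub>R (\<i> * v t)"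
    and eq_z: "\<And>t. t \<ge> 0 \<Longrightarrow> z' t = \<xi> *\<^sub>R (\<i> * y t)"
    and eq_y: "\<And>t. t \<ge> 0 \<Longrightarrow> \<rho>2 *\<^sub>R y' t = k *\<^sub>R v t + (a * \<xi>) *\<^sub>R (\<i> * z t)
        - (m * \<xi>\<^sup>2) *\<^sub>R N t - (\<delta> * \<xi>) *\<^sub>R (\<i> * \<theta> t)"
    and eq_\<theta>: "\<And>t. t \<ge> 0 \<Longrightarrow> \<rho>3 *\<^sub>R \<theta>' t = - (\<beta> * \<xi>\<^sup>2) *\<^sub>R \<theta> t - (\<delta> * \<xi>) *\<^sub>R (\<i> * y t)"
    and bound_N: "\<And>t. t \<ge> 0 \<Longrightarrow> norm (N t) \<le> c * sqrt (P t)"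
    and bound_Q: "\<And>t. t \<ge> 0 \<Longrightarrow> norm (Q t) \<le> c * sqrt (P t)"
    and P_nonneg: "\<And>t. t \<ge> 0 \<Longrightarrow> P t \<ge> 0"
begin

definition energy :: "real \<Rightarrow> real" where
  "energy t = \<rho>1 * (norm (u t))\<^sup>2 + \<rho>2 * (norm (y t))\<^sup>2 + \<rho>3 * (norm (\<theta> t))\<^sup>2
     + k * (norm (v t))\<^sup>2 + a * (norm (z t))\<^sup>2 + m * \<xi>\<^sup>2 * P t"

text \<open>The restoring force in the \<open>y\<close> equation:
  \<open>\<rho>2 *\<^sub>R y' t\<close> is \<open>w t\<close> up to memory and thermal terms. The
  equations for \<open>v\<close> and \<open>z\<close> express its derivative by \<open>u\<close> and
  \<open>y\<close> alone.\<close>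

definition w :: "real \<Rightarrow> complex" where
  "w t = k *\<^sub>R v t + (a * \<xi>) *\<^sub>R (\<i> * z t)"

abbreviation \<sigma> :: real where "\<sigma> \<equiv> 1 + \<xi>\<^sup>2"

definition h1 :: "real \<Rightarrow> real" where "h1 t = \<xi>\<^sup>2 / \<sigma> * (\<rho>2 * (y t \<bullet> Q t))"
definition h2 :: "real \<Rightarrow> real" where "h2 t = \<xi>\<^sup>2 / \<sigma>\<^sup>2 * (\<rho>2 * (y t \<bullet> w t))"
definition h3 :: "real \<Rightarrow> real" where "h3 t = \<xi>\<^sup>2 / \<sigma>\<^sup>2 * (\<rho>1 * (u t \<bullet> z t))"
definition h4 :: "real \<Rightarrow> real" where "h4 t = - (\<xi> ^ 3 / \<sigma> ^ 3 * (\<rho>1 * (u t \<bullet> (\<i> * v t))))"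

section \<open>Derivatives of the energy and of the correctors\<close>

lemma inner_eqs:
  assumes "t \<ge> 0"
  shows "\<rho>1 * (u' t \<bullet> x) = k * \<xi> * ((\<i> * v t) \<bullet> x)"
    "\<rho>2 * (y' t \<bullet> x) = w t \<bullet> x - m * \<xi>\<^sup>2 * (N t \<bullet> x) - \<delta> * \<xi> * ((\<i> * \<theta> t) \<bullet> x)"
    "\<rho>3 * (\<theta>' t \<bullet> x) = - (\<beta> * \<xi>\<^sup>2) * (\<theta> t \<bullet> x) - \<delta> * \<xi> * ((\<i> * y t) \<bullet> x)"
proof -
  show "\<rho>1 * (u' t \<bullet> x) = k * \<xi> * ((\<i> * v t) \<bullet> x)"
    using arg_cong[OF eq_u[OF assms], of "\<lambda>r. r \<bullet> x"] by simp
  show "\<rho>2 * (y' t \<bullet> x) = w t \<bullet> x - m * \<xi>\<^sup>2 * (N t \<bullet> x) - \<delta> * \<xi> * ((\<i> * \<theta> t) \<bullet> x)"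
    using arg_cong[OF eq_y[OF assms], of "\<lambda>r. r \<bullet> x"]
    by (simp add: w_def inner_diff_left inner_add_left)
  show "\<rho>3 * (\<theta>' t \<bullet> x) = - (\<beta> * \<xi>\<^sup>2) * (\<theta> t \<bullet> x) - \<delta> * \<xi> * ((\<i> * y t) \<bullet> x)"
    using arg_cong[OF eq_\<theta>[OF assms], of "\<lambda>r. r \<bullet> x"] by (simp add: inner_diff_left)
qed

text \<open>The couplings are skew and cancel in pairs in the real inner product. The memory term of
  the \<open>y\<close> equation cancels against \<open>2 * (y t \<bullet> N t)\<close> in the
  derivative of \<open>P\<close>, which is the reason for that source term.\<close>

lemma energy_deriv:
  assumes t: "t \<ge> 0"
  shows "(energy has_real_derivative - (2 * \<beta> * \<xi>\<^sup>2 * (norm (\<theta> t))\<^sup>2 + k2 * m * \<xi>\<^sup>2 * P t)) (at t within {0..})"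
proof -
  note d = deriv[OF t]
  have "((\<lambda>t. \<rho>1 * (u t \<bullet> u t) + \<rho>2 * (y t \<bullet> y t) + \<rho>3 * (\<theta> t \<bullet> \<theta> t)
     + k * (v t \<bullet> v t) + a * (z t \<bullet> z t) + m * \<xi>\<^sup>2 * P t) has_real_derivative
      \<rho>1 * (u t \<bullet> u' t + u' t \<bullet> u t) + \<rho>2 * (y t \<bullet> y' t + y' t \<bullet> y t)
      + \<rho>3 * (\<theta> t \<bullet> \<theta>' t + \<theta>' t \<bullet> \<theta> t) + k * (v t \<bullet> v' t + v' t \<bullet> v t)
      + a * (z t \<bullet> z' t + z' t \<bullet> z t) + m * \<xi>\<^sup>2 * (- k2 * P t + 2 * (y t \<bullet> N t))) (at t within {0..})"
    (is "(_ has_real_derivative ?D) _")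
    by (intro DERIV_add DERIV_cmult has_real_derivative_inner d deriv_P t)
  moreover have "?D = 2 * (\<rho>1 * (u' t \<bullet> u t)) + 2 * (\<rho>2 * (y' t \<bullet> y t)) + 2 * (\<rho>3 * (\<theta>' t \<bullet> \<theta> t))
      + 2 * k * (v' t \<bullet> v t) + 2 * a * (z' t \<bullet> z t) + m * \<xi>\<^sup>2 * (- k2 * P t + 2 * (y t \<bullet> N t))"
    by (simp add: inner_commute)
  also have "\<dots> = - (2 * \<beta> * \<xi>\<^sup>2 * (\<theta> t \<bullet> \<theta> t) + k2 * m * \<xi>\<^sup>2 * P t)"
    unfolding inner_eqs[OF t] eq_v[OF t] eq_z[OF t] w_def
    by (simp add: inner_complex_def algebra_simps)
  finally show ?thesis
    by (simp add: energy_def[abs_def] power2_norm_eq_inner)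
qed

text \<open>The derivative of \<open>Q\<close> contains \<open>y\<close> divided by
  \<open>k1\<close>, so pairing \<open>Q\<close> with \<open>y\<close> produces the square of
  \<open>y\<close>. Every other term keeps a factor \<open>Q\<close>, which is controlled by the
  dissipation.\<close>

lemma h1_deriv:
  assumes t: "t \<ge> 0"
  obtains d where "(h1 has_real_derivative d) (at t within {0..})"
    "d \<ge> \<xi>\<^sup>2 / \<sigma> * (\<rho>2 / k1 * (norm (y t))\<^sup>2 - (\<rho>2 * k1 * norm (y t) * norm (Q t) + 1 * norm (w t) * norm (Q t)
       + m * \<xi>\<^sup>2 * norm (N t) * norm (Q t) + \<delta> * \<bar>\<xi>\<bar> * norm (\<theta> t) * norm (Q t)))"
proof -
  let ?Q' = "(1 / k1) *\<^sub>R y t - k1 *\<^sub>R Q t"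
  have "(h1 has_real_derivative \<xi>\<^sup>2 / \<sigma> * (\<rho>2 * (y t \<bullet> ?Q' + y' t \<bullet> Q t))) (at t within {0..})"
    unfolding h1_def[abs_def] by (intro DERIV_cmult has_real_derivative_inner deriv deriv_Q t)
  moreover have "\<xi>\<^sup>2 / \<sigma> * (\<rho>2 * (y t \<bullet> ?Q' + y' t \<bullet> Q t)) \<ge> \<xi>\<^sup>2 / \<sigma> * (\<rho>2 / k1 * (norm (y t))\<^sup>2
      - (\<rho>2 * k1 * norm (y t) * norm (Q t) + 1 * norm (w t) * norm (Q t)
       + m * \<xi>\<^sup>2 * norm (N t) * norm (Q t) + \<delta> * \<bar>\<xi>\<bar> * norm (\<theta> t) * norm (Q t)))"
  proof (rule mult_left_mono)
    have "\<rho>2 * (y t \<bullet> ?Q' + y' t \<bullet> Q t) = \<rho>2 * (y t \<bullet> ?Q') + \<rho>2 * (y' t \<bullet> Q t)"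
      by (rule distrib_left)
    \<comment> \<open>The factor \<open>1\<close> and the scalar inside the inner product with
      \<theta> give each term the shape that \<open>scaled_inner_bounds\<close> expects.\<close>
    also have "\<dots> = \<rho>2 / k1 * (norm (y t))\<^sup>2 - \<rho>2 * k1 * (y t \<bullet> Q t)
        + (1 * (w t \<bullet> Q t) - m * \<xi>\<^sup>2 * (N t \<bullet> Q t) - \<delta> * ((\<xi> *\<^sub>R (\<i> * \<theta> t)) \<bullet> Q t))"
      unfolding inner_eqs[OF t] by (simp add: inner_diff_right power2_norm_eq_inner algebra_simps)
    also have "\<dots> \<ge> \<rho>2 / k1 * (norm (y t))\<^sup>2 - \<rho>2 * k1 * norm (y t) * norm (Q t)
        + (- (1 * norm (w t) * norm (Q t)) - m * \<xi>\<^sup>2 * norm (N t) * norm (Q t)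
           - \<delta> * norm (\<xi> *\<^sub>R (\<i> * \<theta> t)) * norm (Q t))"
      using pos by (intro add_mono diff_mono order_refl scaled_inner_bounds) auto
    finally show "\<rho>2 * (y t \<bullet> ?Q' + y' t \<bullet> Q t) \<ge> \<rho>2 / k1 * (norm (y t))\<^sup>2
      - (\<rho>2 * k1 * norm (y t) * norm (Q t) + 1 * norm (w t) * norm (Q t)
       + m * \<xi>\<^sup>2 * norm (N t) * norm (Q t) + \<delta> * \<bar>\<xi>\<bar> * norm (\<theta> t) * norm (Q t))"
      by (simp add: norm_mult algebra_simps)
  qed simp
  ultimately show ?thesis by (rule that)
qed

text \<open>\<open>w\<close> is the leading part of \<open>\<rho>2 *\<^sub>R y' t\<close>, so
  pairing with it yields its square. The price is \<open>y\<close> against the derivative of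
  \<open>w\<close>: a square of \<open>y\<close> and a product of \<open>y\<close> with
  \<open>u\<close>.\<close>

lemma h2_deriv:
  assumes t: "t \<ge> 0"
  obtains d where "(h2 has_real_derivative d) (at t within {0..})"
    "d \<ge> \<xi>\<^sup>2 / \<sigma>\<^sup>2 * ((norm (w t))\<^sup>2 - (m * \<xi>\<^sup>2 * norm (N t) * norm (w t) + \<delta> * \<bar>\<xi>\<bar> * norm (\<theta> t) * norm (w t)
       + \<rho>2 * k * \<bar>\<xi>\<bar> * norm (y t) * norm (u t) + \<rho>2 * (k + a * \<xi>\<^sup>2) * (norm (y t))\<^sup>2))"
proof -
  let ?w' = "k *\<^sub>R v' t + (a * \<xi>) *\<^sub>R (\<i> * z' t)"
  have "((\<lambda>t. \<i> * z t) has_vector_derivative \<i> * z' t) (at t within {0..})"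
    by (intro derivative_eq_intros has_vector_derivative_mult_right deriv t)
  then have "(w has_vector_derivative ?w') (at t within {0..})"
    unfolding w_def[abs_def]
    by (intro has_vector_derivative_add bounded_linear.has_vector_derivative[OF bounded_linear_scaleR_right] deriv t)
  then have "(h2 has_real_derivative \<xi>\<^sup>2 / \<sigma>\<^sup>2 * (\<rho>2 * (y t \<bullet> ?w' + y' t \<bullet> w t))) (at t within {0..})"
    unfolding h2_def[abs_def] by (intro DERIV_cmult has_real_derivative_inner deriv t)
  moreover have "\<xi>\<^sup>2 / \<sigma>\<^sup>2 * (\<rho>2 * (y t \<bullet> ?w' + y' t \<bullet> w t)) \<ge>
      \<xi>\<^sup>2 / \<sigma>\<^sup>2 * ((norm (w t))\<^sup>2 - (m * \<xi>\<^sup>2 * norm (N t) * norm (w t) + \<delta> * \<bar>\<xi>\<bar> * norm (\<theta> t) * norm (w t)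
       + \<rho>2 * k * \<bar>\<xi>\<bar> * norm (y t) * norm (u t) + \<rho>2 * (k + a * \<xi>\<^sup>2) * (norm (y t))\<^sup>2))"
  proof (rule mult_left_mono)
    have w': "?w' = (k * \<xi>) *\<^sub>R (\<i> * u t) - (k + a * \<xi>\<^sup>2) *\<^sub>R y t"
      unfolding eq_v[OF t] eq_z[OF t] by (simp add: complex_eq_iff algebra_simps power2_eq_square)
    have "\<rho>2 * (y t \<bullet> ?w' + y' t \<bullet> w t) = \<rho>2 * (y t \<bullet> ?w') + \<rho>2 * (y' t \<bullet> w t)"
      by (rule distrib_left)
    also have "\<dots> = (norm (w t))\<^sup>2 - m * \<xi>\<^sup>2 * (N t \<bullet> w t) - \<delta> * ((\<xi> *\<^sub>R (\<i> * \<theta> t)) \<bullet> w t)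
        + \<rho>2 * k * (y t \<bullet> (\<xi> *\<^sub>R (\<i> * u t))) - \<rho>2 * (k + a * \<xi>\<^sup>2) * (norm (y t))\<^sup>2"
      unfolding inner_eqs[OF t] w' by (simp add: inner_diff_right power2_norm_eq_inner algebra_simps)
    also have "\<dots> \<ge> (norm (w t))\<^sup>2 - m * \<xi>\<^sup>2 * norm (N t) * norm (w t)
        - \<delta> * norm (\<xi> *\<^sub>R (\<i> * \<theta> t)) * norm (w t)
        + - (\<rho>2 * k * norm (y t) * norm (\<xi> *\<^sub>R (\<i> * u t))) - \<rho>2 * (k + a * \<xi>\<^sup>2) * (norm (y t))\<^sup>2"
      using pos by (intro add_mono diff_mono order_refl scaled_inner_bounds) auto
    finally show "\<rho>2 * (y t \<bullet> ?w' + y' t \<bullet> w t) \<ge>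
      (norm (w t))\<^sup>2 - (m * \<xi>\<^sup>2 * norm (N t) * norm (w t) + \<delta> * \<bar>\<xi>\<bar> * norm (\<theta> t) * norm (w t)
       + \<rho>2 * k * \<bar>\<xi>\<bar> * norm (y t) * norm (u t) + \<rho>2 * (k + a * \<xi>\<^sup>2) * (norm (y t))\<^sup>2)"
      by (simp add: norm_mult algebra_simps)
  qed simp
  ultimately show ?thesis by (rule that)
qed

text \<open>The \<open>u\<close> equation brings in \<open>\<i> * v t\<close>; substituting
  \<open>k *\<^sub>R v t = w t - (a * \<xi>) *\<^sub>R (\<i> * z t)\<close> turns it into a positive
  multiple of \<open>\<xi> *\<^sub>R z t\<close> plus a term in \<open>w\<close>, and the former
  gives the square of \<open>z\<close>.\<close>

lemma h3_deriv:
  assumes t: "t \<ge> 0"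
  obtains d where "(h3 has_real_derivative d) (at t within {0..})"
    "d \<ge> \<xi>\<^sup>2 / \<sigma>\<^sup>2 * (a * \<xi>\<^sup>2 * (norm (z t))\<^sup>2 - (\<bar>\<xi>\<bar> * norm (w t) * norm (z t)
       + \<rho>1 * \<bar>\<xi>\<bar> * norm (u t) * norm (y t)))"
proof -
  have "(h3 has_real_derivative \<xi>\<^sup>2 / \<sigma>\<^sup>2 * (\<rho>1 * (u t \<bullet> z' t + u' t \<bullet> z t))) (at t within {0..})"
    unfolding h3_def[abs_def] by (intro DERIV_cmult has_real_derivative_inner deriv t)
  moreover have "\<xi>\<^sup>2 / \<sigma>\<^sup>2 * (\<rho>1 * (u t \<bullet> z' t + u' t \<bullet> z t)) \<ge>
      \<xi>\<^sup>2 / \<sigma>\<^sup>2 * (a * \<xi>\<^sup>2 * (norm (z t))\<^sup>2 - (\<bar>\<xi>\<bar> * norm (w t) * norm (z t)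
       + \<rho>1 * \<bar>\<xi>\<bar> * norm (u t) * norm (y t)))"
  proof (rule mult_left_mono)
    have "\<rho>1 * (u t \<bullet> z' t + u' t \<bullet> z t) = \<rho>1 * (u t \<bullet> z' t) + \<rho>1 * (u' t \<bullet> z t)"
      by (rule distrib_left)
    also have "\<dots> = a * \<xi>\<^sup>2 * (norm (z t))\<^sup>2 + 1 * ((\<xi> *\<^sub>R (\<i> * w t)) \<bullet> z t)
        + \<rho>1 * (u t \<bullet> (\<xi> *\<^sub>R (\<i> * y t)))"
      unfolding inner_eqs[OF t] eq_z[OF t] w_def cmod_power2
      by (simp add: inner_complex_def algebra_simps power2_eq_square)
    also have "\<dots> \<ge> a * \<xi>\<^sup>2 * (norm (z t))\<^sup>2 + - (1 * norm (\<xi> *\<^sub>R (\<i> * w t)) * norm (z t))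
        + - (\<rho>1 * norm (u t) * norm (\<xi> *\<^sub>R (\<i> * y t)))"
      using pos by (intro add_mono diff_mono order_refl scaled_inner_bounds) auto
    finally show "\<rho>1 * (u t \<bullet> z' t + u' t \<bullet> z t) \<ge> a * \<xi>\<^sup>2 * (norm (z t))\<^sup>2
       - (\<bar>\<xi>\<bar> * norm (w t) * norm (z t) + \<rho>1 * \<bar>\<xi>\<bar> * norm (u t) * norm (y t))"
      by (simp add: norm_mult algebra_simps)
  qed simp
  ultimately show ?thesis by (rule that)
qed

text \<open>\<open>v\<close> is not reached by a corrector of its own; it is recovered from
  \<open>w\<close> and \<open>z\<close> through the definition of \<open>w\<close>.\<close>

lemma norm_v_le: "k\<^sup>2 * (norm (v t))\<^sup>2 \<le> 2 * (norm (w t))\<^sup>2 + 2 * a\<^sup>2 * \<xi>\<^sup>2 * (norm (z t))\<^sup>2"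
proof -
  have "k *\<^sub>R v t = w t - (a * \<xi>) *\<^sub>R (\<i> * z t)" by (simp add: w_def)
  then have "norm (k *\<^sub>R v t) \<le> norm (w t) + norm ((a * \<xi>) *\<^sub>R (\<i> * z t))"
    by (simp only: norm_triangle_ineq4)
  then have "(norm (k *\<^sub>R v t))\<^sup>2 \<le> (norm (w t) + norm ((a * \<xi>) *\<^sub>R (\<i> * z t)))\<^sup>2"
    by (intro power_mono) auto
  also have "\<dots> \<le> 2 * (norm (w t))\<^sup>2 + 2 * (norm ((a * \<xi>) *\<^sub>R (\<i> * z t)))\<^sup>2"
    using sum_squares_bound[of "norm (w t)" "norm ((a * \<xi>) *\<^sub>R (\<i> * z t))"] by (simp add: power2_sum)
  finally show ?thesis by (simp add: norm_mult power_mult_distrib mult.assoc)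
qed

text \<open>The derivative of \<open>\<i> * v t\<close> contains
  \<open>- \<xi> *\<^sub>R u t\<close>. The sign in \<open>h4\<close> and the odd power
  \<open>\<xi> ^ 3\<close> turn this into a square of \<open>u\<close> with the nonnegative weight
  \<open>\<xi> ^ 4 / \<sigma> ^ 3\<close>, at the price of a square of \<open>v\<close> with the
  same power of \<xi>.\<close>

lemma h4_deriv:
  assumes t: "t \<ge> 0"
  obtains d where "(h4 has_real_derivative d) (at t within {0..})"
    "d \<ge> \<rho>1 * \<xi> ^ 4 / \<sigma> ^ 3 * (norm (u t))\<^sup>2 - (k * \<xi> ^ 4 / \<sigma> ^ 3 * (norm (v t))\<^sup>2
       + \<rho>1 * \<bar>\<xi>\<bar> ^ 3 / \<sigma> ^ 3 * norm (u t) * norm (y t))"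
proof -
  have "((\<lambda>t. \<i> * v t) has_vector_derivative \<i> * v' t) (at t within {0..})"
    by (intro derivative_eq_intros has_vector_derivative_mult_right deriv t)
  then have "(h4 has_real_derivative - (\<xi> ^ 3 / \<sigma> ^ 3 * (\<rho>1 * (u t \<bullet> (\<i> * v' t) + u' t \<bullet> (\<i> * v t))))) (at t within {0..})"
    unfolding h4_def[abs_def] by (intro DERIV_minus DERIV_cmult has_real_derivative_inner deriv t)
  moreover have "- (\<xi> ^ 3 / \<sigma> ^ 3 * (\<rho>1 * (u t \<bullet> (\<i> * v' t) + u' t \<bullet> (\<i> * v t)))) \<ge>
     \<rho>1 * \<xi> ^ 4 / \<sigma> ^ 3 * (norm (u t))\<^sup>2 - (k * \<xi> ^ 4 / \<sigma> ^ 3 * (norm (v t))\<^sup>2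
       + \<rho>1 * \<bar>\<xi>\<bar> ^ 3 / \<sigma> ^ 3 * norm (u t) * norm (y t))"
  proof -
    have s: "\<sigma> > 0" by (simp add: add_pos_nonneg)
    have "\<rho>1 * (u t \<bullet> (\<i> * v' t) + u' t \<bullet> (\<i> * v t)) = \<rho>1 * (u t \<bullet> (\<i> * v' t)) + \<rho>1 * (u' t \<bullet> (\<i> * v t))"
      by (rule distrib_left)
    also have "\<dots> = k * \<xi> * (norm (v t))\<^sup>2 - \<rho>1 * \<xi> * (norm (u t))\<^sup>2 - \<rho>1 * (u t \<bullet> (\<i> * y t))"
      unfolding inner_eqs[OF t] eq_v[OF t] cmod_power2
      by (simp add: inner_complex_def algebra_simps power2_eq_square)
    finally have eq: "\<rho>1 * (u t \<bullet> (\<i> * v' t) + u' t \<bullet> (\<i> * v t)) = \<dots>" .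
    \<comment> \<open>A generic denominator keeps \<open>\<sigma> ^ 3\<close> from being expanded.
      Since division by zero gives zero, the identity also holds for \<open>S = 0\<close>.\<close>
    have "- (\<xi> ^ 3 / S * (k * \<xi> * V - \<rho>1 * \<xi> * U - \<rho>1 * T)) =
        \<rho>1 * \<xi> ^ 4 / S * U - k * \<xi> ^ 4 / S * V + \<rho>1 / S * (\<xi> ^ 3 * T)" for S U V T
      by (cases "S = 0") (simp_all add: field_simps power_numeral_reduce)
    from this[of "\<sigma> ^ 3" "(norm (v t))\<^sup>2" "(norm (u t))\<^sup>2" "u t \<bullet> (\<i> * y t)", folded eq]
    have "- (\<xi> ^ 3 / \<sigma> ^ 3 * (\<rho>1 * (u t \<bullet> (\<i> * v' t) + u' t \<bullet> (\<i> * v t)))) =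
        \<rho>1 * \<xi> ^ 4 / \<sigma> ^ 3 * (norm (u t))\<^sup>2 - k * \<xi> ^ 4 / \<sigma> ^ 3 * (norm (v t))\<^sup>2
        + \<rho>1 / \<sigma> ^ 3 * (u t \<bullet> (\<xi> ^ 3 *\<^sub>R (\<i> * y t)))"
      by (simp only: inner_scaleR_right)
    also have "\<dots> \<ge> \<rho>1 * \<xi> ^ 4 / \<sigma> ^ 3 * (norm (u t))\<^sup>2 - k * \<xi> ^ 4 / \<sigma> ^ 3 * (norm (v t))\<^sup>2
        + - (\<rho>1 / \<sigma> ^ 3 * norm (u t) * norm (\<xi> ^ 3 *\<^sub>R (\<i> * y t)))"
      using pos s by (intro add_mono diff_mono order_refl scaled_inner_bounds) auto
    finally show ?thesis by (simp add: norm_mult power_abs algebra_simps)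
  qed
  ultimately show ?thesis by (rule that)
qed

text \<open>Scaled moduli, with \<open>s\<^sup>2 = \<sigma>\<close>: the weights make the dissipation of each corrector
  a quadratic form whose coefficients do not depend on \<open>\<xi>\<close>.\<close>
abbreviation (input) x :: real where "x \<equiv> \<bar>\<xi>\<bar>"
definition s :: real where "s = sqrt \<sigma>"
definition yy :: "real \<Rightarrow> real" where "yy t = x * norm (y t) / s"
definition ww :: "real \<Rightarrow> real" where "ww t = x * norm (w t) / s ^ 2"
definition zz :: "real \<Rightarrow> real" where "zz t = x ^ 2 * norm (z t) / s ^ 2"
definition uu :: "real \<Rightarrow> real" where "uu t = x ^ 2 * norm (u t) / s ^ 3"
definition tt :: "real \<Rightarrow> real" where "tt t = x * norm (\<theta> t)"
definition pp :: "real \<Rightarrow> real" where "pp t = x * sqrt (P t)"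

section \<open>Dissipation of the correctors in scaled moduli\<close>

text \<open>After this rewriting all weights are monomials in the two atoms \<open>x\<close> and
  \<open>s\<close>, which \<open>field_simps\<close> can compare.\<close>

lemma abs_powers: "\<xi>\<^sup>2 = x\<^sup>2" "\<xi> ^ 4 = x ^ 4" by simp_all

lemma s_facts: "s \<ge> 1" "s > 0" "s \<noteq> 0" "\<sigma> = s ^ 2" "x \<le> s" "x ^ 2 / s ^ 2 \<le> 1" "1 / s ^ 2 \<le> 1" "x / s ^ 2 \<le> 1"
proof -
  show 1: "s \<ge> 1" by (simp add: s_def)
  then show 2: "s > 0" "s \<noteq> 0" by auto
  show sq: "\<sigma> = s ^ 2" by (simp add: s_def)
  show 3: "x \<le> s" unfolding s_def by (rule real_le_rsqrt) simp
  show "x ^ 2 / s ^ 2 \<le> 1" using 2 power_mono[OF 3, of 2] by simp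
  show "1 / s ^ 2 \<le> 1" using 1 by simp
  have "x * 1 \<le> s * s" using 3 1 by (intro mult_mono) auto
  then show "x / s ^ 2 \<le> 1" using 2 by (simp add: power2_eq_square)
qed

text \<open>Both \<open>x \<le> s\<close> and \<open>1 \<le> s\<close> enter. This is the source of
  uniformity in \<xi> for the corrector bounds and for the final rate.\<close>

lemma power_ratio_le_1: "x ^ n / s ^ j \<le> 1" if "n \<le> j"
proof -
  have "x ^ n \<le> s ^ n" using s_facts by (intro power_mono) auto
  also have "\<dots> \<le> s ^ j" using s_facts that by (intro power_increasing) auto
  finally show ?thesis using s_facts by simp
qed

lemma nonneg: "yy t \<ge> 0" "ww t \<ge> 0" "zz t \<ge> 0" "uu t \<ge> 0" "tt t \<ge> 0" "x \<ge> 0"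
  using s_facts by (simp_all add: yy_def ww_def zz_def uu_def tt_def)

text \<open>The dissipation sees the history only through \<open>pp\<close>, which contains a factor
  \<open>x\<close>; therefore \<open>N\<close> and \<open>Q\<close> must always be accompanied by
  such a factor.\<close>

lemma history_bounds:
  assumes "t \<ge> 0"
  shows "x * norm (N t) \<le> c * pp t" "x * norm (Q t) \<le> c * pp t" "pp t \<ge> 0" "(pp t)\<^sup>2 = \<xi>\<^sup>2 * P t"
  using mult_left_mono[OF bound_N[OF assms], of x] mult_left_mono[OF bound_Q[OF assms], of x]
    P_nonneg[OF assms]
  by (simp_all add: pp_def algebra_simps power_mult_distrib)

text \<open>One factor \<open>x\<close> of the prefactor goes to \<open>Q\<close>, the other to its
  partner. Here and for the other correctors \<open>c0\<close> and \<open>C\<close> are left free,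
  so that one pair of constants can serve all four.\<close>

lemma h1_dissipation:
  assumes t: "t \<ge> 0" and c0: "c0 \<le> \<rho>2 / k1" and C: "c * (\<rho>2 * k1 + 1 + m * c + \<delta>) \<le> C"
  obtains d where "(h1 has_real_derivative d) (at t within {0..})"
    "d \<ge> c0 * (yy t)\<^sup>2 - C * (yy t * pp t + ww t * pp t + tt t * pp t + (pp t)\<^sup>2)"
proof -
  let ?Y = "norm (y t)" and ?W = "norm (w t)" and ?N = "norm (N t)" and ?Q = "norm (Q t)" and ?T = "norm (\<theta> t)"
  obtain d where d: "(h1 has_real_derivative d) (at t within {0..})"
    "d \<ge> \<xi>\<^sup>2 / \<sigma> * (\<rho>2 / k1 * ?Y\<^sup>2 - (\<rho>2 * k1 * ?Y * ?Q + 1 * ?W * ?Q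
       + m * \<xi>\<^sup>2 * ?N * ?Q + \<delta> * x * ?T * ?Q))"
    by (rule h1_deriv[OF t])
  define q n where "q = x * ?Q" and "n = x * ?N"
  have hb: "q \<le> c * pp t" "n \<le> c * pp t" "0 \<le> pp t" "0 \<le> q" "0 \<le> n"
    using history_bounds[OF t] by (simp_all add: q_def n_def)
  \<comment> \<open>The term \<open>ww t * q\<close> appears without a spare power of
    \<open>s\<close>: this is what fixes the weight in \<open>ww\<close>.\<close>
  have "\<xi>\<^sup>2 / \<sigma> * (\<rho>2 / k1 * ?Y\<^sup>2 - (\<rho>2 * k1 * ?Y * ?Q + 1 * ?W * ?Q
       + m * \<xi>\<^sup>2 * ?N * ?Q + \<delta> * x * ?T * ?Q))
     = \<rho>2 / k1 * (yy t)\<^sup>2 - (\<rho>2 * k1 * (yy t * (q / s)) + ww t * q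
       + m * ((x ^ 2 / s ^ 2) * (n * q)) + \<delta> * ((x / s ^ 2) * (tt t * q)))"
    using s_facts(3) pos unfolding s_facts(4) unfolding abs_powers
    by (simp add: yy_def ww_def tt_def q_def n_def field_simps power_numeral_reduce del: power2_abs abs_mult_self_eq)
  also have "\<dots> \<ge> c0 * (yy t)\<^sup>2 - (\<rho>2 * k1 * (yy t * (c * pp t)) + ww t * (c * pp t)
       + m * (1 * ((c * pp t) * (c * pp t))) + \<delta> * (1 * (tt t * (c * pp t))))"
  proof (intro diff_mono add_mono mult_left_mono mult_mono mult_right_mono c0 hb s_facts nonneg)
    have "q / s \<le> q / 1" using s_facts(1,2) hb by (intro divide_left_mono) auto
    then show "q / s \<le> c * pp t" using hb by simp
  qed (use pos hb nonneg in auto)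
  also have "c0 * (yy t)\<^sup>2 - (\<rho>2 * k1 * (yy t * (c * pp t)) + ww t * (c * pp t)
       + m * (1 * ((c * pp t) * (c * pp t))) + \<delta> * (1 * (tt t * (c * pp t))))
     = c0 * (yy t)\<^sup>2 - ((c * \<rho>2 * k1) * (yy t * pp t) + c * (ww t * pp t)
       + (c * m * c) * (pp t)\<^sup>2 + (c * \<delta>) * (tt t * pp t))"
    by (simp add: power2_eq_square)
  finally have "d \<ge> c0 * (yy t)\<^sup>2 - ((c * \<rho>2 * k1) * (yy t * pp t) + c * (ww t * pp t)
       + (c * m * c) * (pp t)\<^sup>2 + (c * \<delta>) * (tt t * pp t))"
    using d(2) by linarith
  moreover have cs: "0 \<le> c * \<rho>2 * k1" "0 \<le> c" "0 \<le> c * m * c" "0 \<le> c * \<delta>" using pos by simp_all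
  have "(c * \<rho>2 * k1) * (yy t * pp t) \<le> C * (yy t * pp t)" "c * (ww t * pp t) \<le> C * (ww t * pp t)"
       "(c * m * c) * (pp t)\<^sup>2 \<le> C * (pp t)\<^sup>2" "(c * \<delta>) * (tt t * pp t) \<le> C * (tt t * pp t)"
    by (intro mult_right_mono; use cs C nonneg hb in \<open>simp add: algebra_simps\<close>)+
  ultimately have "d \<ge> c0 * (yy t)\<^sup>2 - C * (yy t * pp t + ww t * pp t + tt t * pp t + (pp t)\<^sup>2)"
    by (simp add: distrib_left)
  with d(1) show ?thesis by (rule that)
qed

text \<open>The prefactor has one more \<open>\<sigma>\<close> in the denominator than that of
  \<open>h1\<close>, which compensates the growth of \<open>k + a * \<xi>\<^sup>2\<close> in front
  of the square of \<open>y\<close>. The product of \<open>y\<close> and \<open>u\<close> becomes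
  exactly \<open>uu t * yy t\<close>, which fixes the weight in \<open>uu\<close>.\<close>

lemma h2_dissipation:
  assumes t: "t \<ge> 0" and c0: "c0 \<le> 1" and C: "m * c + \<delta> + \<rho>2 * k + \<rho>2 * (k + a) \<le> C"
  obtains d where "(h2 has_real_derivative d) (at t within {0..})"
    "d \<ge> c0 * (ww t)\<^sup>2 - C * (pp t * ww t + tt t * ww t + uu t * yy t + (yy t)\<^sup>2)"
proof -
  let ?Y = "norm (y t)" and ?W = "norm (w t)" and ?N = "norm (N t)" and ?U = "norm (u t)" and ?T = "norm (\<theta> t)"
  obtain d where d: "(h2 has_real_derivative d) (at t within {0..})"
    "d \<ge> \<xi>\<^sup>2 / \<sigma>\<^sup>2 * (?W\<^sup>2 - (m * \<xi>\<^sup>2 * ?N * ?W + \<delta> * x * ?T * ?W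
       + \<rho>2 * k * x * ?Y * ?U + \<rho>2 * (k + a * \<xi>\<^sup>2) * ?Y\<^sup>2))"
    by (rule h2_deriv[OF t])
  note hb = history_bounds[OF t]
  have "\<xi>\<^sup>2 / \<sigma>\<^sup>2 * (?W\<^sup>2 - (m * \<xi>\<^sup>2 * ?N * ?W + \<delta> * x * ?T * ?W
       + \<rho>2 * k * x * ?Y * ?U + \<rho>2 * (k + a * \<xi>\<^sup>2) * ?Y\<^sup>2))
     = 1 * (ww t)\<^sup>2 - (m * ((x ^ 2 / s ^ 2) * (x * ?N) * ww t) + \<delta> * ((x / s ^ 2) * (tt t * ww t))
       + \<rho>2 * k * (uu t * yy t) + \<rho>2 * (k * (1 / s ^ 2) + a * (x ^ 2 / s ^ 2)) * (yy t)\<^sup>2)"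
    using s_facts(3) pos unfolding s_facts(4) unfolding abs_powers
    by (simp add: yy_def ww_def tt_def uu_def field_simps power_numeral_reduce del: power2_abs abs_mult_self_eq)
  also have "\<dots> \<ge> c0 * (ww t)\<^sup>2 - (m * (1 * (c * pp t) * ww t) + \<delta> * (1 * (tt t * ww t))
       + \<rho>2 * k * (uu t * yy t) + \<rho>2 * (k * 1 + a * 1) * (yy t)\<^sup>2)"
    by (intro diff_mono add_mono mult_left_mono mult_mono mult_right_mono c0 hb s_facts nonneg order_refl)
      (use pos hb nonneg in auto)
  also have "c0 * (ww t)\<^sup>2 - (m * (1 * (c * pp t) * ww t) + \<delta> * (1 * (tt t * ww t))
       + \<rho>2 * k * (uu t * yy t) + \<rho>2 * (k * 1 + a * 1) * (yy t)\<^sup>2)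
    = c0 * (ww t)\<^sup>2 - ((m * c) * (pp t * ww t) + \<delta> * (tt t * ww t)
       + (\<rho>2 * k) * (uu t * yy t) + (\<rho>2 * (k + a)) * (yy t)\<^sup>2)"
    by simp
  finally have "d \<ge> c0 * (ww t)\<^sup>2 - ((m * c) * (pp t * ww t) + \<delta> * (tt t * ww t)
       + (\<rho>2 * k) * (uu t * yy t) + (\<rho>2 * (k + a)) * (yy t)\<^sup>2)"
    using d(2) by linarith
  moreover have cs: "0 \<le> m * c" "0 \<le> \<delta>" "0 \<le> \<rho>2 * k" "0 \<le> \<rho>2 * a" using pos by simp_all
  have "(m * c) * (pp t * ww t) \<le> C * (pp t * ww t)" "\<delta> * (tt t * ww t) \<le> C * (tt t * ww t)"
       "(\<rho>2 * k) * (uu t * yy t) \<le> C * (uu t * yy t)" "(\<rho>2 * (k + a)) * (yy t)\<^sup>2 \<le> C * (yy t)\<^sup>2"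
    by (intro mult_right_mono; use cs C nonneg hb in \<open>simp add: algebra_simps\<close>)+
  ultimately have "d \<ge> c0 * (ww t)\<^sup>2 - C * (pp t * ww t + tt t * ww t + uu t * yy t + (yy t)\<^sup>2)"
    by (simp add: distrib_left)
  with d(1) show ?thesis by (rule that)
qed

text \<open>Both cross terms are exact products of scaled moduli, so no power of \<open>x\<close> or
  \<open>s\<close> is given away.\<close>

lemma h3_dissipation:
  assumes t: "t \<ge> 0" and c0: "c0 \<le> a" and C: "1 + \<rho>1 \<le> C"
  obtains d where "(h3 has_real_derivative d) (at t within {0..})"
    "d \<ge> c0 * (zz t)\<^sup>2 - C * (ww t * zz t + uu t * yy t)"
proof -
  let ?Y = "norm (y t)" and ?W = "norm (w t)" and ?Z = "norm (z t)" and ?U = "norm (u t)"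
  obtain d where d: "(h3 has_real_derivative d) (at t within {0..})"
    "d \<ge> \<xi>\<^sup>2 / \<sigma>\<^sup>2 * (a * \<xi>\<^sup>2 * ?Z\<^sup>2 - (x * ?W * ?Z + \<rho>1 * x * ?U * ?Y))"
    by (rule h3_deriv[OF t])
  have "\<xi>\<^sup>2 / \<sigma>\<^sup>2 * (a * \<xi>\<^sup>2 * ?Z\<^sup>2 - (x * ?W * ?Z + \<rho>1 * x * ?U * ?Y))
     = a * (zz t)\<^sup>2 - (1 * (ww t * zz t) + \<rho>1 * (uu t * yy t))"
    using s_facts(3) pos unfolding s_facts(4) unfolding abs_powers
    by (simp add: yy_def ww_def zz_def uu_def field_simps power_numeral_reduce del: power2_abs abs_mult_self_eq)
  also have "\<dots> \<ge> c0 * (zz t)\<^sup>2 - (C * (ww t * zz t) + C * (uu t * yy t))"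
    by (intro diff_mono add_mono mult_right_mono) (use c0 C pos nonneg in auto)
  finally have "d \<ge> c0 * (zz t)\<^sup>2 - C * (ww t * zz t + uu t * yy t)"
    using d(2) by (simp add: distrib_left)
  with d(1) show ?thesis by (rule that)
qed

text \<open>By \<open>norm_v_le\<close> the terms in \<open>w\<close> and \<open>z\<close> each
  carry a spare factor \<open>x ^ 2 / s ^ 2\<close>, which is dropped. The bound is needed twice:
  for the cost of \<open>h4\<close> and for the \<open>v\<close> part of the energy in
  \<open>rate_energy_le\<close>.\<close>

lemma rate_v_le: "\<xi> ^ 4 / \<sigma> ^ 3 * (k * (norm (v t))\<^sup>2) \<le> 2 / k * (1 + a\<^sup>2) * ((ww t)\<^sup>2 + (zz t)\<^sup>2)"
proof -
  have "k * (norm (v t))\<^sup>2 = (k\<^sup>2 * (norm (v t))\<^sup>2) / k" using pos by (simp add: power2_eq_square)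
  also have "\<dots> \<le> (2 * (norm (w t))\<^sup>2 + 2 * a\<^sup>2 * \<xi>\<^sup>2 * (norm (z t))\<^sup>2) / k"
    using norm_v_le pos by (intro divide_right_mono) auto
  finally have "\<xi> ^ 4 / \<sigma> ^ 3 * (k * (norm (v t))\<^sup>2) \<le>
      \<xi> ^ 4 / \<sigma> ^ 3 * ((2 * (norm (w t))\<^sup>2 + 2 * a\<^sup>2 * \<xi>\<^sup>2 * (norm (z t))\<^sup>2) / k)"
    by (intro mult_left_mono) (auto intro!: divide_nonneg_nonneg add_nonneg_nonneg)
  also have "\<dots> = 2 / k * ((x ^ 2 / s ^ 2) * (ww t)\<^sup>2 + a\<^sup>2 * ((x ^ 2 / s ^ 2) * (zz t)\<^sup>2))"
    using s_facts(3) pos unfolding s_facts(4) unfolding abs_powers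
    by (simp add: ww_def zz_def field_simps power_numeral_reduce del: power2_abs abs_mult_self_eq)
  also have "\<dots> \<le> 2 / k * (1 * (ww t)\<^sup>2 + a\<^sup>2 * (1 * (zz t)\<^sup>2))"
    using pos by (intro mult_left_mono add_mono mult_right_mono s_facts) auto
  also have "\<dots> \<le> 2 / k * ((1 + a\<^sup>2) * (ww t)\<^sup>2 + (1 + a\<^sup>2) * (zz t)\<^sup>2)"
    using pos by (intro mult_left_mono add_mono) (auto simp: algebra_simps)
  finally show ?thesis by (simp add: algebra_simps)
qed

lemma h4_dissipation:
  assumes t: "t \<ge> 0" and c0: "c0 \<le> \<rho>1" and C: "2 / k * (1 + a\<^sup>2) + \<rho>1 \<le> C"
  obtains d where "(h4 has_real_derivative d) (at t within {0..})"
    "d \<ge> c0 * (uu t)\<^sup>2 - C * ((ww t)\<^sup>2 + (zz t)\<^sup>2 + uu t * yy t)"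
proof -
  let ?Y = "norm (y t)" and ?V = "norm (v t)" and ?U = "norm (u t)"
  obtain d where d: "(h4 has_real_derivative d) (at t within {0..})"
    "d \<ge> \<rho>1 * \<xi> ^ 4 / \<sigma> ^ 3 * ?U\<^sup>2 - (k * \<xi> ^ 4 / \<sigma> ^ 3 * ?V\<^sup>2 + \<rho>1 * x ^ 3 / \<sigma> ^ 3 * ?U * ?Y)"
    by (rule h4_deriv[OF t])
  have "\<rho>1 * \<xi> ^ 4 / \<sigma> ^ 3 * ?U\<^sup>2 = \<rho>1 * (uu t)\<^sup>2"
    unfolding s_facts(4) by (simp add: uu_def power_divide power_mult_distrib flip: power_mult)
  also have "\<dots> \<ge> c0 * (uu t)\<^sup>2" using c0 by (simp add: mult_right_mono)
  finally have 1: "\<rho>1 * \<xi> ^ 4 / \<sigma> ^ 3 * ?U\<^sup>2 \<ge> c0 * (uu t)\<^sup>2" .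
  have "k * \<xi> ^ 4 / \<sigma> ^ 3 * ?V\<^sup>2 = \<xi> ^ 4 / \<sigma> ^ 3 * (k * ?V\<^sup>2)" by simp
  also have "\<dots> \<le> 2 / k * (1 + a\<^sup>2) * ((ww t)\<^sup>2 + (zz t)\<^sup>2)" by (rule rate_v_le)
  also have "\<dots> \<le> C * ((ww t)\<^sup>2 + (zz t)\<^sup>2)"
    using C pos by (intro mult_right_mono) auto
  finally have 2: "k * \<xi> ^ 4 / \<sigma> ^ 3 * ?V\<^sup>2 \<le> C * ((ww t)\<^sup>2 + (zz t)\<^sup>2)" .
  have "\<rho>1 * x ^ 3 / \<sigma> ^ 3 * ?U * ?Y = \<rho>1 * ((1 / s ^ 2) * (uu t * yy t))"
    using s_facts(3) unfolding s_facts(4)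
    by (simp add: uu_def yy_def field_simps power_numeral_reduce del: power2_abs abs_mult_self_eq)
  also have "\<dots> \<le> \<rho>1 * (1 * (uu t * yy t))"
    using pos nonneg by (intro mult_left_mono mult_right_mono s_facts) auto
  also have "\<dots> \<le> C * (uu t * yy t)"
  proof -
    have "0 \<le> 2 / k * (1 + a\<^sup>2)" using pos by simp
    then have "\<rho>1 \<le> C" using C by linarith
    then show ?thesis using nonneg by (simp add: mult_right_mono)
  qed
  finally have "\<rho>1 * x ^ 3 / \<sigma> ^ 3 * ?U * ?Y \<le> C * (uu t * yy t)" .
  with 1 2 d(2) have "d \<ge> c0 * (uu t)\<^sup>2 - C * ((ww t)\<^sup>2 + (zz t)\<^sup>2 + uu t * yy t)"
    by (simp add: distrib_left)
  with d(1) show ?thesis by (rule that)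
qed


section \<open>Equivalence with the energy and exponential decay\<close>

text \<open>These are the pairs of squares that \<open>product_le_weighted_squares\<close> needs for
  the products occurring in the four correctors.\<close>

lemma energy_ge:
  assumes "t \<ge> 0"
  shows "energy t \<ge> 0" "energy t \<ge> \<rho>1 * (norm (u t))\<^sup>2 + a * (norm (z t))\<^sup>2"
    "energy t \<ge> \<rho>1 * (norm (u t))\<^sup>2 + k * (norm (v t))\<^sup>2"
    "energy t \<ge> \<rho>2 * (norm (y t))\<^sup>2 + k * (norm (v t))\<^sup>2"
    "energy t \<ge> \<rho>2 * (norm (y t))\<^sup>2 + a * (norm (z t))\<^sup>2"
    "energy t \<ge> \<rho>2 * (norm (y t))\<^sup>2 + m * (pp t)\<^sup>2"
proof -
  have "0 \<le> \<rho>1 * (norm (u t))\<^sup>2" "0 \<le> \<rho>2 * (norm (y t))\<^sup>2" "0 \<le> \<rho>3 * (norm (\<theta> t))\<^sup>2"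
    "0 \<le> k * (norm (v t))\<^sup>2" "0 \<le> a * (norm (z t))\<^sup>2" "0 \<le> m * (pp t)\<^sup>2"
    using pos by simp_all
  moreover have "energy t = \<rho>1 * (norm (u t))\<^sup>2 + \<rho>2 * (norm (y t))\<^sup>2 + \<rho>3 * (norm (\<theta> t))\<^sup>2
     + k * (norm (v t))\<^sup>2 + a * (norm (z t))\<^sup>2 + m * (pp t)\<^sup>2"
    using history_bounds[OF assms] by (simp add: energy_def)
  ultimately show "energy t \<ge> 0" "energy t \<ge> \<rho>1 * (norm (u t))\<^sup>2 + a * (norm (z t))\<^sup>2"
    "energy t \<ge> \<rho>1 * (norm (u t))\<^sup>2 + k * (norm (v t))\<^sup>2"
    "energy t \<ge> \<rho>2 * (norm (y t))\<^sup>2 + k * (norm (v t))\<^sup>2"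
    "energy t \<ge> \<rho>2 * (norm (y t))\<^sup>2 + a * (norm (z t))\<^sup>2"
    "energy t \<ge> \<rho>2 * (norm (y t))\<^sup>2 + m * (pp t)\<^sup>2"
    by linarith+
qed

lemma corrector_bounds:
  assumes t: "t \<ge> 0"
  shows "\<bar>h1 t\<bar> \<le> \<rho>2 * c * (1 / \<rho>2 + 1 / m) * energy t"
    "\<bar>h2 t\<bar> \<le> \<rho>2 * (k * (1 / \<rho>2 + 1 / k) + a * (1 / \<rho>2 + 1 / a)) * energy t"
    "\<bar>h3 t\<bar> \<le> \<rho>1 * (1 / \<rho>1 + 1 / a) * energy t"
    "\<bar>h4 t\<bar> \<le> \<rho>1 * (1 / \<rho>1 + 1 / k) * energy t"
proof -
  note E = energy_ge[OF t] and hb = history_bounds[OF t]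
  have x2: "x ^ 2 / s ^ 4 \<le> 1" "x ^ 3 / s ^ 4 \<le> 1" "x ^ 3 / s ^ 6 \<le> 1"
    using power_ratio_le_1[of 2 4] power_ratio_le_1[of 3 4] power_ratio_le_1[of 3 6] by simp_all
  \<comment> \<open>One factor \<open>x\<close> has to stay with \<open>Q\<close>: what the energy
    controls is \<open>pp\<close>, not the unweighted history.\<close>
  have "\<bar>h1 t\<bar> = \<rho>2 * ((x / s ^ 2) * (x * \<bar>y t \<bullet> Q t\<bar>))"
    unfolding s_facts(4) h1_def using pos by (simp add: abs_mult power2_eq_square)
  also have "\<dots> \<le> \<rho>2 * (1 * (x * (norm (y t) * norm (Q t))))"
    using pos by (intro mult_left_mono mult_mono s_facts Cauchy_Schwarz_ineq2) auto
  also have "\<dots> = \<rho>2 * (norm (y t) * (x * norm (Q t)))" by simp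
  also have "\<dots> \<le> \<rho>2 * (norm (y t) * (c * pp t))"
    using pos by (intro mult_left_mono hb) auto
  also have "\<dots> = \<rho>2 * c * (norm (y t) * pp t)" by simp
  also have "\<dots> \<le> \<rho>2 * c * ((1 / \<rho>2 + 1 / m) * energy t)"
    using pos hb by (intro mult_left_mono product_le_weighted_squares E) auto
  finally show "\<bar>h1 t\<bar> \<le> \<rho>2 * c * (1 / \<rho>2 + 1 / m) * energy t" by simp
  have "norm (w t) \<le> norm (k *\<^sub>R v t) + norm ((a * \<xi>) *\<^sub>R (\<i> * z t))"
    unfolding w_def by (rule norm_triangle_ineq)
  also have "\<dots> = k * norm (v t) + a * (x * norm (z t))"
    using pos by (simp add: norm_mult abs_mult)
  finally have W: "norm (w t) \<le> k * norm (v t) + a * (x * norm (z t))" .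
  have "\<bar>h2 t\<bar> = \<rho>2 * ((x ^ 2 / s ^ 4) * \<bar>y t \<bullet> w t\<bar>)"
    unfolding s_facts(4) h2_def using pos by (simp add: abs_mult flip: power_mult)
  also have "\<dots> \<le> \<rho>2 * ((x ^ 2 / s ^ 4) * (norm (y t) * norm (w t)))"
    using pos by (intro mult_left_mono Cauchy_Schwarz_ineq2) auto
  also have "\<dots> \<le> \<rho>2 * ((x ^ 2 / s ^ 4) * (norm (y t) * (k * norm (v t) + a * (x * norm (z t)))))"
    using pos W by (intro mult_left_mono) auto
  \<comment> \<open>The \<open>z\<close> part of \<open>w\<close> brings an additional
    \<open>x\<close>, which the denominator \<open>s ^ 4\<close> still covers.\<close>
  also have "\<dots> = \<rho>2 * (k * ((x ^ 2 / s ^ 4) * (norm (y t) * norm (v t)))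
      + a * ((x ^ 3 / s ^ 4) * (norm (y t) * norm (z t))))"
    using s_facts(3) by (simp add: field_simps power_numeral_reduce del: abs_mult_self_eq)
  also have "\<dots> \<le> \<rho>2 * (k * (1 * (norm (y t) * norm (v t))) + a * (1 * (norm (y t) * norm (z t))))"
    using pos by (intro mult_left_mono mult_right_mono add_mono x2) auto
  also have "\<dots> \<le> \<rho>2 * (k * (1 * ((1 / \<rho>2 + 1 / k) * energy t)) + a * (1 * ((1 / \<rho>2 + 1 / a) * energy t)))"
    using pos by (intro mult_left_mono add_mono product_le_weighted_squares E) auto
  finally show "\<bar>h2 t\<bar> \<le> \<rho>2 * (k * (1 / \<rho>2 + 1 / k) + a * (1 / \<rho>2 + 1 / a)) * energy t"
    by (simp only: mult_1 distrib_right distrib_left mult.assoc)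
  have "\<bar>h3 t\<bar> = \<rho>1 * ((x ^ 2 / s ^ 4) * \<bar>u t \<bullet> z t\<bar>)"
    unfolding s_facts(4) h3_def using pos by (simp add: abs_mult flip: power_mult)
  also have "\<dots> \<le> \<rho>1 * (1 * (norm (u t) * norm (z t)))"
    using pos by (intro mult_left_mono mult_mono x2 Cauchy_Schwarz_ineq2) auto
  also have "\<dots> \<le> \<rho>1 * (1 * ((1 / \<rho>1 + 1 / a) * energy t))"
    using pos by (intro mult_left_mono product_le_weighted_squares E) auto
  finally show "\<bar>h3 t\<bar> \<le> \<rho>1 * (1 / \<rho>1 + 1 / a) * energy t" by simp
  have "\<bar>h4 t\<bar> = \<rho>1 * ((x ^ 3 / s ^ 6) * \<bar>u t \<bullet> (\<i> * v t)\<bar>)"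
    unfolding s_facts(4) h4_def using pos by (simp add: abs_mult power_abs flip: power_mult)
  also have "\<dots> \<le> \<rho>1 * (1 * (norm (u t) * norm (\<i> * v t)))"
    using pos by (intro mult_left_mono mult_mono x2 Cauchy_Schwarz_ineq2) auto
  also have "\<dots> \<le> \<rho>1 * (1 * ((1 / \<rho>1 + 1 / k) * energy t))"
    using pos E by (intro mult_left_mono product_le_weighted_squares) (auto simp: norm_mult)
  finally show "\<bar>h4 t\<bar> \<le> \<rho>1 * (1 / \<rho>1 + 1 / k) * energy t" by simp
qed

text \<open>The bottleneck is \<open>u\<close>, whose scaled modulus reproduces the rate exactly.
  For \<open>y\<close>, \<theta>, \<open>z\<close> and the history a factor of at most 1 is left
  over, and \<open>v\<close> is treated by \<open>rate_v_le\<close>.\<close>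

lemma rate_energy_le:
  assumes t: "t \<ge> 0"
  shows "\<xi> ^ 4 / \<sigma> ^ 3 * energy t \<le> (\<rho>1 + \<rho>2 + \<rho>3 + 2 / k * (1 + a\<^sup>2) + a + m)
     * ((tt t)\<^sup>2 + (pp t)\<^sup>2 + (yy t)\<^sup>2 + (ww t)\<^sup>2 + (zz t)\<^sup>2 + (uu t)\<^sup>2)"
proof -
  define S where "S = (tt t)\<^sup>2 + (pp t)\<^sup>2 + (yy t)\<^sup>2 + (ww t)\<^sup>2 + (zz t)\<^sup>2 + (uu t)\<^sup>2"
  define r where "r = \<xi> ^ 4 / \<sigma> ^ 3"
  have r: "r = x ^ 4 / s ^ 6" unfolding r_def s_facts(4) by (simp flip: power_mult)
  have scale: "(x ^ n / s ^ j) * X\<^sup>2 \<le> X\<^sup>2" if "n \<le> j" for n j X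
    using mult_right_mono[OF power_ratio_le_1[OF that], of "X\<^sup>2"] by simp
  have u: "r * (norm (u t))\<^sup>2 \<le> S"
  proof -
    have "r * (norm (u t))\<^sup>2 = (uu t)\<^sup>2"
      by (simp add: r uu_def power_mult_distrib power_divide flip: power_mult)
    then show ?thesis by (simp add: S_def)
  qed
  have y: "r * (norm (y t))\<^sup>2 \<le> S"
  proof -
    have "r * (norm (y t))\<^sup>2 = (x ^ 2 / s ^ 4) * (yy t)\<^sup>2"
      using s_facts(3) by (simp add: r yy_def field_simps power_numeral_reduce del: power2_abs abs_mult_self_eq)
    also have "\<dots> \<le> (yy t)\<^sup>2" by (rule scale) simp
    finally show ?thesis by (simp add: S_def add_increasing2 add_increasing)
  qed
  have th: "r * (norm (\<theta> t))\<^sup>2 \<le> S"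
  proof -
    have "r * (norm (\<theta> t))\<^sup>2 = (x ^ 2 / s ^ 6) * (tt t)\<^sup>2"
      using s_facts(3) by (simp add: r tt_def field_simps power_numeral_reduce del: power2_abs abs_mult_self_eq)
    also have "\<dots> \<le> (tt t)\<^sup>2" by (rule scale) simp
    finally show ?thesis by (simp add: S_def add_increasing2 add_increasing)
  qed
  have z: "r * (norm (z t))\<^sup>2 \<le> S"
  proof -
    \<comment> \<open>The power \<open>x ^ 0\<close> merely brings the spare factor
      \<open>1 / s ^ 2\<close> into the form required by \<open>scale\<close>.\<close>
    have "r * (norm (z t))\<^sup>2 = (x ^ 0 / s ^ 2) * (zz t)\<^sup>2"
      using s_facts(3) by (simp add: r zz_def field_simps power_numeral_reduce del: power2_abs abs_mult_self_eq)
    also have "\<dots> \<le> (zz t)\<^sup>2" by (rule scale) simp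
    finally show ?thesis by (simp add: S_def add_increasing2 add_increasing)
  qed
  have p: "r * (m * \<xi>\<^sup>2 * P t) \<le> m * S"
  proof -
    have "r * (pp t)\<^sup>2 \<le> (pp t)\<^sup>2" unfolding r by (rule scale) simp
    also have "\<dots> \<le> S" by (simp add: S_def add_increasing2 add_increasing)
    finally have "m * (r * (pp t)\<^sup>2) \<le> m * S" using pos by simp
    then show ?thesis using history_bounds[OF t] by (simp add: algebra_simps)
  qed
  have v: "r * (k * (norm (v t))\<^sup>2) \<le> 2 / k * (1 + a\<^sup>2) * S"
  proof -
    have "r * (k * (norm (v t))\<^sup>2) \<le> 2 / k * (1 + a\<^sup>2) * ((ww t)\<^sup>2 + (zz t)\<^sup>2)"
      unfolding r_def by (rule rate_v_le)
    also have "\<dots> \<le> 2 / k * (1 + a\<^sup>2) * S" using pos by (intro mult_left_mono) (auto simp: S_def)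
    finally show ?thesis .
  qed
  have "r * energy t = \<rho>1 * (r * (norm (u t))\<^sup>2) + \<rho>2 * (r * (norm (y t))\<^sup>2) + \<rho>3 * (r * (norm (\<theta> t))\<^sup>2)
     + r * (k * (norm (v t))\<^sup>2) + a * (r * (norm (z t))\<^sup>2) + r * (m * \<xi>\<^sup>2 * P t)"
    by (simp add: energy_def algebra_simps)
  also have "\<dots> \<le> \<rho>1 * S + \<rho>2 * S + \<rho>3 * S + 2 / k * (1 + a\<^sup>2) * S + a * S + m * S"
    using pos by (intro add_mono mult_left_mono u y th v z p) auto
  finally show ?thesis by (simp add: r_def S_def distrib_right)
qed


text \<open>The locale fixes \<xi> and a solution, so constants obtained inside it could depend on
  them. They enter as parameters with the inequalities they must satisfy, including the absorption
  property \<open>hier\<close>, and are chosen uniformly in the final theorem.\<close>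

lemma energy_decay:
  fixes A1 A2 A3 K0 K c0 C B M R :: real
  assumes A: "A1 \<ge> 0" "A2 \<ge> 0" "A3 \<ge> 0" "K0 \<ge> 0"
    and hier: "\<And>K d1 d2 d4 d3 e yy ww zz uu tt p. K \<ge> K0 \<Longrightarrow>
       d1 \<ge> yy\<^sup>2 - C / c0 * (yy * p + ww * p + tt * p + p\<^sup>2) \<Longrightarrow>
       d2 \<ge> ww\<^sup>2 - C / c0 * (p * ww + tt * ww + uu * yy + yy\<^sup>2) \<Longrightarrow>
       d3 \<ge> zz\<^sup>2 - C / c0 * (ww * zz + uu * yy) \<Longrightarrow>
       d4 \<ge> uu\<^sup>2 - C / c0 * (ww\<^sup>2 + zz\<^sup>2 + uu * yy) \<Longrightarrow>
       e \<ge> tt\<^sup>2 + p\<^sup>2 \<Longrightarrow>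
       K * e + A1 * d1 + A2 * d2 + A3 * d3 + d4
         \<ge> (tt\<^sup>2 + p\<^sup>2 + yy\<^sup>2 + ww\<^sup>2 + zz\<^sup>2 + uu\<^sup>2) / 2"
    and c0: "c0 > 0" "c0 \<le> \<rho>2 / k1" "c0 \<le> 1" "c0 \<le> a" "c0 \<le> \<rho>1" "c0 \<le> 2 * \<beta>" "c0 \<le> k2 * m"
    and C: "c * (\<rho>2 * k1 + 1 + m * c + \<delta>) \<le> C" "m * c + \<delta> + \<rho>2 * k + \<rho>2 * (k + a) \<le> C"
      "1 + \<rho>1 \<le> C" "2 / k * (1 + a\<^sup>2) + \<rho>1 \<le> C"
    and B: "\<rho>2 * c * (1 / \<rho>2 + 1 / m) \<le> B" "\<rho>2 * (k * (1 / \<rho>2 + 1 / k) + a * (1 / \<rho>2 + 1 / a)) \<le> B"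
      "\<rho>1 * (1 / \<rho>1 + 1 / a) \<le> B" "\<rho>1 * (1 / \<rho>1 + 1 / k) \<le> B"
    and M: "M = (A1 + A2 + A3 + 1) * B" and K: "K = K0 + M + 1"
    and R: "R = \<rho>1 + \<rho>2 + \<rho>3 + 2 / k * (1 + a\<^sup>2) + a + m"
    and t: "t \<ge> 0"
  shows "energy t \<le> (K + M) * exp (- (c0 / (2 * R * (K + M))) * (\<xi> ^ 4 / \<sigma> ^ 3) * t) * energy 0"
proof -
  have "\<forall>t. \<exists>d. t \<ge> 0 \<longrightarrow> (h1 has_real_derivative d) (at t within {0..}) \<and>
      d \<ge> c0 * (yy t)\<^sup>2 - C * (yy t * pp t + ww t * pp t + tt t * pp t + (pp t)\<^sup>2)"
    using h1_dissipation[OF _ c0(2) C(1)] by metis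
  then obtain d1 where d1: "\<And>t. t \<ge> 0 \<Longrightarrow> (h1 has_real_derivative d1 t) (at t within {0..})"
    "\<And>t. t \<ge> 0 \<Longrightarrow> d1 t \<ge> c0 * (yy t)\<^sup>2 - C * (yy t * pp t + ww t * pp t + tt t * pp t + (pp t)\<^sup>2)"
    by metis
  have "\<forall>t. \<exists>d. t \<ge> 0 \<longrightarrow> (h2 has_real_derivative d) (at t within {0..}) \<and>
      d \<ge> c0 * (ww t)\<^sup>2 - C * (pp t * ww t + tt t * ww t + uu t * yy t + (yy t)\<^sup>2)"
    using h2_dissipation[OF _ c0(3) C(2)] by metis
  then obtain d2 where d2: "\<And>t. t \<ge> 0 \<Longrightarrow> (h2 has_real_derivative d2 t) (at t within {0..})"
    "\<And>t. t \<ge> 0 \<Longrightarrow> d2 t \<ge> c0 * (ww t)\<^sup>2 - C * (pp t * ww t + tt t * ww t + uu t * yy t + (yy t)\<^sup>2)"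
    by metis
  have "\<forall>t. \<exists>d. t \<ge> 0 \<longrightarrow> (h3 has_real_derivative d) (at t within {0..}) \<and>
      d \<ge> c0 * (zz t)\<^sup>2 - C * (ww t * zz t + uu t * yy t)"
    using h3_dissipation[OF _ c0(4) C(3)] by metis
  then obtain d3 where d3: "\<And>t. t \<ge> 0 \<Longrightarrow> (h3 has_real_derivative d3 t) (at t within {0..})"
    "\<And>t. t \<ge> 0 \<Longrightarrow> d3 t \<ge> c0 * (zz t)\<^sup>2 - C * (ww t * zz t + uu t * yy t)"
    by metis
  have "\<forall>t. \<exists>d. t \<ge> 0 \<longrightarrow> (h4 has_real_derivative d) (at t within {0..}) \<and>
      d \<ge> c0 * (uu t)\<^sup>2 - C * ((ww t)\<^sup>2 + (zz t)\<^sup>2 + uu t * yy t)"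
    using h4_dissipation[OF _ c0(5) C(4)] by metis
  then obtain d4 where d4: "\<And>t. t \<ge> 0 \<Longrightarrow> (h4 has_real_derivative d4 t) (at t within {0..})"
    "\<And>t. t \<ge> 0 \<Longrightarrow> d4 t \<ge> c0 * (uu t)\<^sup>2 - C * ((ww t)\<^sup>2 + (zz t)\<^sup>2 + uu t * yy t)"
    by metis
  define e where "e t = 2 * \<beta> * \<xi>\<^sup>2 * (norm (\<theta> t))\<^sup>2 + k2 * m * \<xi>\<^sup>2 * P t" for t
  define H where "H t = A1 * h1 t + A2 * h2 t + A3 * h3 t + h4 t" for t
  \<comment> \<open>\<open>K - M \<ge> 1\<close> makes \<open>L\<close> dominate the energy, while
    \<open>K \<ge> K0\<close> makes its dissipation coercive through \<open>hier\<close>.\<close>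
  define L where "L t = K * energy t - H t" for t
  define L' where "L' t = K * (- e t) - (A1 * d1 t + A2 * d2 t + A3 * d3 t + d4 t)" for t
  define S where "S t = (tt t)\<^sup>2 + (pp t)\<^sup>2 + (yy t)\<^sup>2 + (ww t)\<^sup>2 + (zz t)\<^sup>2 + (uu t)\<^sup>2" for t
  have "0 \<le> \<rho>1 * (1 / \<rho>1 + 1 / a)" using pos by simp
  with B have "B \<ge> 0" by linarith
  with A have M0: "M \<ge> 0" by (simp add: M)
  have K0: "K \<ge> K0" "K \<ge> M + 1" "K + M > 0" using A M0 by (simp_all add: K)
  have "0 \<le> 2 / k * (1 + a\<^sup>2)" using pos by simp
  with pos have R0: "R > 0" unfolding R by linarith
  have deriv_L: "(L has_real_derivative L' t) (at t within {0..})" if "t \<ge> 0" for t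
    unfolding L_def[abs_def] H_def L'_def e_def
    by (intro DERIV_diff DERIV_add DERIV_cmult energy_deriv d1 d2 d3 d4 that)
  have diss: "L' t \<le> - (c0 / 2) * S t" if t: "t \<ge> 0" for t
  proof -
    \<comment> \<open>Division by \<open>c0\<close> normalises the leading coefficients to 1; this
      is why \<open>hier\<close> is used with \<open>C / c0\<close>.\<close>
    have div: "d / c0 \<ge> X - C / c0 * Y" if "d \<ge> c0 * X - C * Y" for d X Y
      using divide_right_mono[OF that, of c0] c0(1) by (simp add: diff_divide_distrib)
    have "e t = (2 * \<beta>) * (tt t)\<^sup>2 + (k2 * m) * (pp t)\<^sup>2"
      using history_bounds[OF t] by (simp add: e_def tt_def power_mult_distrib)
    also have "\<dots> \<ge> c0 * (tt t)\<^sup>2 + c0 * (pp t)\<^sup>2"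
      by (intro add_mono mult_right_mono c0) auto
    finally have "e t / c0 \<ge> (tt t)\<^sup>2 + (pp t)\<^sup>2" using c0(1) by (simp add: field_simps)
    then have "K * (e t / c0) + A1 * (d1 t / c0) + A2 * (d2 t / c0) + A3 * (d3 t / c0) + d4 t / c0 \<ge> S t / 2"
      unfolding S_def by (intro hier K0(1) div d1 d2 d3 d4 t)
    then have "(K * e t + A1 * d1 t + A2 * d2 t + A3 * d3 t + d4 t) / c0 \<ge> S t / 2"
      by (simp add: add_divide_distrib)
    then have "K * e t + A1 * d1 t + A2 * d2 t + A3 * d3 t + d4 t \<ge> c0 / 2 * S t"
      using c0(1) by (simp add: field_simps)
    then show ?thesis by (simp add: L'_def)
  qed
  have H: "\<bar>H t\<bar> \<le> M * energy t" if t: "t \<ge> 0" for t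
  proof -
    note E = energy_ge(1)[OF t] and cb = corrector_bounds[OF t]
    have h: "\<bar>h1 t\<bar> \<le> B * energy t" "\<bar>h2 t\<bar> \<le> B * energy t" "\<bar>h3 t\<bar> \<le> B * energy t" "\<bar>h4 t\<bar> \<le> B * energy t"
      using cb mult_right_mono[OF B(1) E] mult_right_mono[OF B(2) E] mult_right_mono[OF B(3) E]
        mult_right_mono[OF B(4) E] by linarith+
    have "\<bar>H t\<bar> \<le> \<bar>A1 * h1 t\<bar> + \<bar>A2 * h2 t\<bar> + \<bar>A3 * h3 t\<bar> + \<bar>h4 t\<bar>"
      unfolding H_def by linarith
    also have "\<dots> = A1 * \<bar>h1 t\<bar> + A2 * \<bar>h2 t\<bar> + A3 * \<bar>h3 t\<bar> + \<bar>h4 t\<bar>"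
      using A by (simp add: abs_mult)
    also have "\<dots> \<le> A1 * (B * energy t) + A2 * (B * energy t) + A3 * (B * energy t) + B * energy t"
      by (intro add_mono mult_left_mono h A)
    also have "\<dots> = M * energy t" by (simp add: M algebra_simps)
    finally show ?thesis .
  qed
  have L: "energy t \<le> L t" "L t \<le> (K + M) * energy t" if t: "t \<ge> 0" for t
  proof -
    have "1 * energy t \<le> (K - M) * energy t"
      using K0 energy_ge(1)[OF t] by (intro mult_right_mono) auto
    with H[OF t] show "energy t \<le> L t" "L t \<le> (K + M) * energy t"
      unfolding L_def abs_le_iff by (simp_all add: algebra_simps)
  qed
  define r where "r = \<xi> ^ 4 / \<sigma> ^ 3"
  have r0: "r \<ge> 0" by (simp add: r_def)
  have "L' t \<le> - (c0 / (2 * R * (K + M)) * r) * L t" if t: "t \<ge> 0" for t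
  proof -
    have "r * L t \<le> r * ((K + M) * energy t)" using L(2)[OF t] r0 by (rule mult_left_mono)
    also have "\<dots> = (K + M) * (r * energy t)" by simp
    also have "\<dots> \<le> (K + M) * (R * S t)"
      using rate_energy_le[OF t] K0(3) by (intro mult_left_mono) (simp_all add: r_def R S_def)
    finally have "r * L t / ((K + M) * R) \<le> S t"
      using K0(3) R0 by (subst pos_divide_le_eq) (simp_all add: mult_ac)
    then have "c0 / 2 * (r * L t / ((K + M) * R)) \<le> c0 / 2 * S t"
      using c0(1) by (intro mult_left_mono) auto
    moreover have "c0 / 2 * (r * l / (V * R)) = c0 / (2 * R * V) * r * l" for V l :: real
      by (simp add: ac_simps)
    note this[of "L t" "K + M"]
    ultimately show ?thesis using diss[OF t] unfolding mult_minus_left by linarith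
  qed
  then have "L t \<le> exp (- (c0 / (2 * R * (K + M)) * r) * t) * L 0"
    by (intro gronwall[OF deriv_L] t) auto
  also have "\<dots> \<le> exp (- (c0 / (2 * R * (K + M)) * r) * t) * ((K + M) * energy 0)"
    by (intro mult_left_mono L) auto
  finally show ?thesis using L(1)[OF t] by (simp add: r_def mult_ac)
qed

end

section \<open>The history variable\<close>

text \<open>Over n + 1 equal steps the errors add up to \<open>C * T\<^sup>2 / real (Suc n)\<close>,
  which tends to zero. This replaces the derivative test for a function that is known to be neither
  differentiable nor continuous.\<close>

lemma telescoping_nonincreasing:
  fixes f :: "real \<Rightarrow> real"
  assumes step: "\<And>t h. 0 \<le> t \<Longrightarrow> 0 \<le> h \<Longrightarrow> t + h \<le> T \<Longrightarrow> f (t + h) - f t \<le> C * h\<^sup>2" and "T \<ge> 0"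
  shows "f T \<le> f 0"
proof -
  have bound: "f T - f 0 \<le> (C * T\<^sup>2) / real (Suc n)" for n
  proof -
    define h where "h = T / real (Suc n)"
    have h: "h \<ge> 0" "real (Suc n) * h = T" using assms by (simp_all add: h_def)
    have "f T - f 0 = (\<Sum>i<Suc n. f (real (Suc i) * h) - f (real i * h))"
      by (subst sum_lessThan_telescope) (simp add: h(2) del: of_nat_Suc)
    also have "\<dots> \<le> (\<Sum>i<Suc n. C * h\<^sup>2)"
    proof (rule sum_mono)
      fix i assume "i \<in> {..<Suc n}"
      then have "real (Suc i) * h \<le> real (Suc n) * h" using h by (intro mult_right_mono) auto
      then have "real i * h + h \<le> T" using h by (simp add: algebra_simps)
      from step[OF _ h(1) this] h(1)
      show "f (real (Suc i) * h) - f (real i * h) \<le> C * h\<^sup>2" by (simp add: algebra_simps)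
    qed
    also have "\<dots> = (C * T\<^sup>2) / real (Suc n)"
      by (simp add: h_def power_divide power2_eq_square)
    finally show ?thesis .
  qed
  have "(\<lambda>n. (C * T\<^sup>2) * inverse (real (Suc n))) \<longlonglongrightarrow> (C * T\<^sup>2) * 0"
    by (intro tendsto_mult tendsto_const LIMSEQ_inverse_real_of_nat)
  then have "f T - f 0 \<le> (C * T\<^sup>2) * 0"
    by (rule LIMSEQ_le_const) (use bound in \<open>auto simp: divide_inverse\<close>)
  then show ?thesis by simp
qed

text \<open>The scalar version is applied to the component of \<open>f\<close> in the direction
  \<open>f T - f 0\<close>; it forces the squared length of this vector to be nonpositive.\<close>

lemma telescoping_constant:
  fixes f :: "real \<Rightarrow> 'a::real_inner"
  assumes step: "\<And>t h. 0 \<le> t \<Longrightarrow> 0 \<le> h \<Longrightarrow> t + h \<le> T \<Longrightarrow> norm (f (t + h) - f t) \<le> C * h\<^sup>2" and "T \<ge> 0"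
  shows "f T = f 0"
proof -
  define d where "d = f T - f 0"
  have "f T \<bullet> d \<le> f 0 \<bullet> d"
  proof (rule telescoping_nonincreasing[where f = "\<lambda>t. f t \<bullet> d" and C = "C * norm d"])
    fix t h assume th: "0 \<le> t" "0 \<le> h" "t + h \<le> T"
    have "f (t + h) \<bullet> d - f t \<bullet> d \<le> norm (f (t + h) - f t) * norm d"
      using norm_cauchy_schwarz[of "f (t + h) - f t" d] by (simp add: inner_diff_left)
    also have "\<dots> \<le> C * h\<^sup>2 * norm d" using step[OF th] by (rule mult_right_mono) simp
    finally show "f (t + h) \<bullet> d - f t \<bullet> d \<le> C * norm d * h\<^sup>2" by (simp add: mult_ac)
  qed fact
  then have "d \<bullet> d \<le> 0" by (simp add: d_def inner_diff_left)
  then have "d \<bullet> d = 0" by (intro antisym) auto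
  then show ?thesis by (simp add: d_def)
qed

text \<open>The factor \<open>\<phi>\<close> moves by at most \<open>C * h\<close> during the step,
  and the length of the interval contributes another \<open>h\<close>. \<open>prod\<close> stays
  abstract to cover the inner product in \<open>M_le_P\<close> and scalar multiplication in
  \<open>Q_eq\<close>.\<close>

lemma riemann_step:
  fixes prod :: "'a::banach \<Rightarrow> 'b::banach \<Rightarrow> 'c::banach"
  assumes bil: "bounded_bilinear prod" and le: "\<And>a b. norm (prod a b) \<le> norm a * norm b"
    and cont: "continuous_on {t..t + h} \<phi>" "continuous_on {t..t + h} y"
    and lip: "\<And>r. r \<in> {t..t + h} \<Longrightarrow> norm (\<phi> r - \<phi> t) \<le> C * h"
    and y: "\<And>r. r \<in> {t..t + h} \<Longrightarrow> norm (y r) \<le> K" and h: "h \<ge> 0"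
  shows "norm (integral {t..t + h} (\<lambda>r. prod (\<phi> r) (y r)) - prod (\<phi> t) (integral {t..t + h} y)) \<le> C * K * h\<^sup>2"
proof -
  interpret bounded_bilinear prod by fact
  have "norm (\<phi> t - \<phi> t) \<le> C * h" by (rule lip) (use h in auto)
  then have Ch: "0 \<le> C * h" by simp
  have "prod (\<phi> t) (integral {t..t + h} y) = integral {t..t + h} (\<lambda>r. prod (\<phi> t) (y r))"
    using integral_linear[OF integrable_continuous_interval[OF cont(2)] bounded_linear_right[of "\<phi> t"]]
    by (simp add: o_def)
  moreover have "integral {t..t + h} (\<lambda>r. prod (\<phi> r) (y r)) - integral {t..t + h} (\<lambda>r. prod (\<phi> t) (y r))
      = integral {t..t + h} (\<lambda>r. prod (\<phi> r - \<phi> t) (y r))"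
    by (subst integral_diff[symmetric])
      (auto intro!: integrable_continuous_interval continuous_on cont continuous_intros simp: diff_left)
  moreover have "norm (integral {t..t + h} (\<lambda>r. prod (\<phi> r - \<phi> t) (y r))) \<le> (C * h * K) * (t + h - t)"
  proof (rule integral_bound)
    show "continuous_on {t..t + h} (\<lambda>r. prod (\<phi> r - \<phi> t) (y r))"
      by (intro continuous_on cont continuous_intros)
    show "norm (prod (\<phi> r - \<phi> t) (y r)) \<le> C * h * K" if "r \<in> {t..t + h}" for r
      using le[of "\<phi> r - \<phi> t" "y r"] mult_mono[OF lip[OF that] y[OF that] Ch norm_ge_zero] by linarith
  qed (use h in simp)
  ultimately show ?thesis by (simp add: power2_eq_square mult_ac)
qed

section \<open>Weighted integrals over the half-line\<close>

lemma set_integral_shift: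
  fixes f :: "real \<Rightarrow> 'a::{banach, second_countable_topology}"
  shows "set_integrable lborel {h..} f \<longleftrightarrow> set_integrable lborel {0..} (\<lambda>s. f (s + h))"
    and "(LINT s:{h..}|lborel. f s) = (LINT s:{0..}|lborel. f (s + h))"
proof -
  have *: "indicator {h..} (h + 1 * s) *\<^sub>R f (h + 1 * s) = indicator {0..} s *\<^sub>R f (s + h)" for s :: real
    by (simp add: indicator_def add.commute)
  show "set_integrable lborel {h..} f \<longleftrightarrow> set_integrable lborel {0..} (\<lambda>s. f (s + h))"
    using lborel_integrable_real_affine_iff[of 1 "\<lambda>s. indicator {h..} s *\<^sub>R f s" h]
    unfolding set_integrable_def * by simp
  show "(LINT s:{h..}|lborel. f s) = (LINT s:{0..}|lborel. f (s + h))"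
    using lborel_integral_real_affine[of 1 "\<lambda>s. indicator {h..} s *\<^sub>R f s" h]
    unfolding set_lebesgue_integral_def * by simp
qed

text \<open>For an integrand at time \<open>t + h\<close>, the ages in \<open>{0..<h}\<close> belong
  to the history created during the step; the rest is old history whose age has grown by
  \<open>h\<close>.\<close>

lemma set_integral_split_shift:
  fixes f :: "real \<Rightarrow> 'a::{banach, second_countable_topology}"
  assumes f: "set_integrable lborel {0..} f" and h: "h \<ge> 0"
  shows "(LINT s:{0..}|lborel. f s) = (LINT s:{0..<h}|lborel. f s) + (LINT s:{0..}|lborel. f (s + h))"
    and "set_integrable lborel {0..} (\<lambda>s. f (s + h))" "set_integrable lborel {0..<h} f"
proof -
  have sub: "set_integrable lborel {0..<h} f" "set_integrable lborel {h..} f"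
    using h by (auto intro!: set_integrable_subset[OF f])
  have "{0..} = {0..<h} \<union> {h..}" using h by auto
  then have "(LINT s:{0..}|lborel. f s) = (LINT s:{0..<h} \<union> {h..}|lborel. f s)" by simp
  also have "\<dots> = (LINT s:{0..<h}|lborel. f s) + (LINT s:{h..}|lborel. f s)"
    by (rule set_integral_Un) (use sub in auto)
  finally show "(LINT s:{0..}|lborel. f s) = (LINT s:{0..<h}|lborel. f s) + (LINT s:{0..}|lborel. f (s + h))"
    by (simp only: set_integral_shift(2)[of h f])
  show "set_integrable lborel {0..} (\<lambda>s. f (s + h))" "set_integrable lborel {0..<h} f"
    using sub by (simp_all only: set_integral_shift(1)[of h f])
qed

lemma set_integral_initial_bound:
  fixes f :: "real \<Rightarrow> 'a::{banach, second_countable_topology}"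
  assumes f: "set_integrable lborel {0..<h} f" and le: "\<And>s. s \<in> {0..<h} \<Longrightarrow> norm (f s) \<le> c" and h: "h \<ge> 0"
  shows "norm (LINT s:{0..<h}|lborel. f s) \<le> c * h"
proof -
  have "norm (LINT s:{0..<h}|lborel. f s) \<le> (LINT s:{0..<h}|lborel. norm (f s))"
    by (rule set_integral_norm_bound[OF f])
  also have "\<dots> \<le> (LINT s:{0..<h}|lborel. c)"
  proof (rule set_integral_mono)
    have "set_integrable lborel {0..h} (\<lambda>_. c)"
      by (rule borel_integrable_atLeastAtMost') (rule continuous_on_const)
    then show "set_integrable lborel {0..<h} (\<lambda>_. c)"
      by (rule set_integrable_subset) auto
    show "set_integrable lborel {0..<h} (\<lambda>s. norm (f s))"
      by (rule set_integrable_norm[OF f])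
  qed (rule le)
  also have "\<dots> = c * h" using h by (simp add: set_integral_const)
  finally show ?thesis .
qed

text \<open>A step in time adds one constant vector \<open>d\<close> to the whole old history, so
  its energy becomes a quadratic polynomial in \<open>d\<close>. The linear coefficient exists
  because \<open>2 * norm (f x) \<le> 1 + (norm (f x))\<^sup>2\<close> and \<open>q\<close> has
  finite mass.\<close>

lemma weighted_square_shift:
  fixes q :: "'a \<Rightarrow> real" and f :: "'a \<Rightarrow> complex"
  assumes A: "A \<in> sets M" and q: "set_integrable M A q" "\<And>x. x \<in> A \<Longrightarrow> q x \<ge> 0"
    and f: "set_borel_measurable M A f" and qf2: "set_integrable M A (\<lambda>x. q x * (norm (f x))\<^sup>2)"
  shows "set_integrable M A (\<lambda>x. q x *\<^sub>R f x)"
    and "set_integrable M A (\<lambda>x. q x * norm (f x))"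
    and "2 * (LINT x:A|M. q x * norm (f x)) \<le> (LINT x:A|M. q x) + (LINT x:A|M. q x * (norm (f x))\<^sup>2)"
    and "set_integrable M A (\<lambda>x. q x * (norm (f x + d))\<^sup>2)"
    and "(LINT x:A|M. q x * (norm (f x + d))\<^sup>2) =
      (LINT x:A|M. q x * (norm (f x))\<^sup>2) + 2 * (d \<bullet> (LINT x:A|M. q x *\<^sub>R f x)) + (norm d)\<^sup>2 * (LINT x:A|M. q x)"
proof -
  have sum_int: "set_integrable M A (\<lambda>x. q x + q x * (norm (f x))\<^sup>2)"
    using q(1) qf2 by (rule set_integral_add)
  have le: "q x * norm (f x) \<le> (q x + q x * (norm (f x))\<^sup>2) / 2" if "x \<in> A" for x
  proof -
    have "q x * (2 * norm (f x)) \<le> q x * (1 + (norm (f x))\<^sup>2)"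
      using q(2)[OF that] sum_squares_bound[of 1 "norm (f x)"] by (intro mult_left_mono) auto
    then show ?thesis by (simp add: algebra_simps)
  qed
  \<comment> \<open>Only the restrictions to \<open>A\<close> are known to be measurable, hence the
    indicator in both factors.\<close>
  have "set_borel_measurable M A (\<lambda>x. q x *\<^sub>R f x)"
  proof -
    have "(\<lambda>x. indicat_real A x *\<^sub>R q x) \<in> borel_measurable M"
      using q(1) by (simp add: set_integrable_def)
    moreover have "(\<lambda>x. indicat_real A x *\<^sub>R f x) \<in> borel_measurable M"
      using f by (simp add: set_borel_measurable_def)
    ultimately have "(\<lambda>x. (indicat_real A x *\<^sub>R q x) *\<^sub>R (indicat_real A x *\<^sub>R f x)) \<in> borel_measurable M"
      by (rule borel_measurable_scaleR)
    also have "(\<lambda>x. (indicat_real A x *\<^sub>R q x) *\<^sub>R (indicat_real A x *\<^sub>R f x)) = (\<lambda>x. indicat_real A x *\<^sub>R (q x *\<^sub>R f x))"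
      by (auto simp: indicator_def fun_eq_iff)
    finally show ?thesis by (simp add: set_borel_measurable_def)
  qed
  moreover have "norm (q x *\<^sub>R f x) \<le> norm (q x + q x * (norm (f x))\<^sup>2)" if "x \<in> A" for x
    using le[OF that] q(2)[OF that] by (simp add: abs_mult) (smt (verit) mult_nonneg_nonneg norm_ge_zero zero_le_power2)
  ultimately show qf: "set_integrable M A (\<lambda>x. q x *\<^sub>R f x)"
    by (intro set_integrable_bound[OF sum_int]) auto
  have "set_integrable M A (\<lambda>x. norm (q x *\<^sub>R f x))" by (rule set_integrable_norm[OF qf])
  also have "?this \<longleftrightarrow> set_integrable M A (\<lambda>x. q x * norm (f x))"
    using q(2) by (intro set_integrable_cong) auto
  finally show qn: "set_integrable M A (\<lambda>x. q x * norm (f x))" .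
  have "(LINT x:A|M. q x * norm (f x)) \<le> (LINT x:A|M. (q x + q x * (norm (f x))\<^sup>2) / 2)"
    using qn sum_int le by (intro set_integral_mono) auto
  also have "\<dots> = ((LINT x:A|M. q x) + (LINT x:A|M. q x * (norm (f x))\<^sup>2)) / 2"
    using q(1) qf2 by simp
  finally show "2 * (LINT x:A|M. q x * norm (f x)) \<le> (LINT x:A|M. q x) + (LINT x:A|M. q x * (norm (f x))\<^sup>2)"
    by simp
  have expand: "q x * (norm (f x + d))\<^sup>2 = q x * (norm (f x))\<^sup>2 + 2 * (d \<bullet> (q x *\<^sub>R f x)) + (norm d)\<^sup>2 * q x" for x
    by (simp add: power2_norm_eq_inner inner_add_left inner_add_right inner_commute algebra_simps)
  have inner_int: "set_integrable M A (\<lambda>x. d \<bullet> (q x *\<^sub>R f x))"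
    "(LINT x:A|M. d \<bullet> (q x *\<^sub>R f x)) = d \<bullet> (LINT x:A|M. q x *\<^sub>R f x)"
  proof -
    have *: "indicat_real A x *\<^sub>R (d \<bullet> (q x *\<^sub>R f x)) = d \<bullet> (indicat_real A x *\<^sub>R (q x *\<^sub>R f x))" for x
      by simp
    show "set_integrable M A (\<lambda>x. d \<bullet> (q x *\<^sub>R f x))"
      "(LINT x:A|M. d \<bullet> (q x *\<^sub>R f x)) = d \<bullet> (LINT x:A|M. q x *\<^sub>R f x)"
      using qf unfolding set_integrable_def set_lebesgue_integral_def *
      by (simp_all only: integrable_inner_right integral_inner_right)
  qed
  have i1: "set_integrable M A (\<lambda>x. 2 * (d \<bullet> (q x *\<^sub>R f x)))"
    by (rule set_integrable_mult_right) (rule inner_int(1))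
  have i2: "set_integrable M A (\<lambda>x. (norm d)\<^sup>2 * q x)"
    by (rule set_integrable_mult_right) (rule q(1))
  note i3 = set_integral_add[OF qf2 i1]
  note i4 = set_integral_add[OF i3(1) i2]
  show "set_integrable M A (\<lambda>x. q x * (norm (f x + d))\<^sup>2)"
    unfolding expand by (rule i4(1))
  show "(LINT x:A|M. q x * (norm (f x + d))\<^sup>2) =
      (LINT x:A|M. q x * (norm (f x))\<^sup>2) + 2 * (d \<bullet> (LINT x:A|M. q x *\<^sub>R f x)) + (norm d)\<^sup>2 * (LINT x:A|M. q x)"
    unfolding expand i4(2) i3(2) by (simp only: set_integral_mult_right inner_int(2))
qed

text \<open>The vector \<open>- (1 / b) *\<^sub>R I\<close> minimises the quadratic polynomial of
  \<open>weighted_square_shift\<close>; its value there is nonnegative, which is the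
  inequality.\<close>

lemma weighted_Cauchy_Schwarz:
  fixes q :: "'a \<Rightarrow> real" and f :: "'a \<Rightarrow> complex"
  assumes A: "A \<in> sets M" and q: "set_integrable M A q" "\<And>x. x \<in> A \<Longrightarrow> q x \<ge> 0"
    and f: "set_borel_measurable M A f" and qf2: "set_integrable M A (\<lambda>x. q x * (norm (f x))\<^sup>2)"
    and pos: "(LINT x:A|M. q x) > 0"
  shows "(norm (LINT x:A|M. q x *\<^sub>R f x))\<^sup>2 \<le> (LINT x:A|M. q x) * (LINT x:A|M. q x * (norm (f x))\<^sup>2)"
proof -
  define I where "I = (LINT x:A|M. q x *\<^sub>R f x)"
  define b where "b = (LINT x:A|M. q x)"
  have b: "b > 0" using pos by (simp add: b_def)
  have "0 \<le> (LINT x:A|M. q x * (norm (f x + - (1 / b) *\<^sub>R I))\<^sup>2)"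
    unfolding set_lebesgue_integral_def using q(2) by (intro integral_nonneg_AE) (auto simp: indicator_def)
  also have "\<dots> = (LINT x:A|M. q x * (norm (f x))\<^sup>2) + 2 * ((- (1 / b) *\<^sub>R I) \<bullet> I) + (norm (- (1 / b) *\<^sub>R I))\<^sup>2 * b"
    unfolding I_def b_def by (rule weighted_square_shift(5)[OF A q f qf2])
  also have "\<dots> = (LINT x:A|M. q x * (norm (f x))\<^sup>2) - (norm I)\<^sup>2 / b"
  proof -
    have "(- (1 / b) *\<^sub>R I) \<bullet> I = - ((norm I)\<^sup>2 / b)"
      by (simp add: dot_square_norm)
    moreover have "(norm (- (1 / b) *\<^sub>R I))\<^sup>2 * b = (norm I)\<^sup>2 / b"
      using b by (simp add: power_divide power2_eq_square[of b])
    ultimately show ?thesis by linarith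
  qed
  finally have "(norm I)\<^sup>2 / b \<le> (LINT x:A|M. q x * (norm (f x))\<^sup>2)" by simp
  then show ?thesis
    unfolding I_def[symmetric] b_def[symmetric] using b by (simp add: pos_divide_le_eq mult.commute)
qed

lemma exp_integral:
  fixes \<kappa> :: real
  assumes "\<kappa> > 0"
  shows "set_integrable lborel {0..} (\<lambda>s. exp (- \<kappa> * s))" "(LINT s:{0..}|lborel. exp (- \<kappa> * s)) = 1 / \<kappa>"
proof -
  have "((\<lambda>s. exp (- \<kappa> * s)) has_integral 1 / \<kappa>) {0..}"
    using has_integral_exp_minus_to_infinity[OF assms, of 0] by simp
  then have "((\<lambda>s. indicator {0..} s * exp (- \<kappa> * s)) has_integral 1 / \<kappa>) UNIV"
    by (subst (asm) has_integral_restrict_UNIV[symmetric])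
      (auto elim!: has_integral_eq[rotated] simp: indicator_def)
  then have "has_bochner_integral lborel (\<lambda>s. indicator {0..} s * exp (- \<kappa> * s)) (1 / \<kappa>)"
    by (intro has_bochner_integral_nn_integral nn_integral_has_integral_lborel) (use assms in auto)
  then show "set_integrable lborel {0..} (\<lambda>s. exp (- \<kappa> * s))" "(LINT s:{0..}|lborel. exp (- \<kappa> * s)) = 1 / \<kappa>"
    by (simp_all add: set_integrable_def set_lebesgue_integral_def has_bochner_integral_iff)
qed

lemma measurable_halfline:
  fixes f :: "real \<Rightarrow> 'a::real_normed_vector"
  shows "continuous_on {0..} f \<Longrightarrow> set_borel_measurable lborel {0..} f"
  using set_measurable_continuous_on[of "{0..}" f] by (simp add: set_borel_measurable_def)

section \<open>The memory kernel\<close>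

locale memory_kernel =
  fixes g g' :: "real \<Rightarrow> real" and k1 k2 :: real
  assumes g_deriv: "\<And>s. s \<ge> 0 \<Longrightarrow> (g has_real_derivative g' s) (at s within {0..})"
    and g_nonzero: "\<exists>s\<ge>0. g s \<noteq> 0"
    and g_nonneg: "\<And>s. s \<ge> 0 \<Longrightarrow> g s \<ge> 0"
    and k_pos: "k1 > 0" "k2 > 0"
    and g'_bounds: "\<And>s. s \<ge> 0 \<Longrightarrow> - k1 * g s \<le> g' s \<and> g' s \<le> - k2 * g s"
begin

lemma g_cont: "continuous_on {0..} g"
  using g_deriv by (auto intro!: DERIV_continuous simp: continuous_on_eq_continuous_within)

text \<open>The upper bound on \<open>g'\<close> makes \<open>exp (k2 * s) * g s\<close>
  nonincreasing.\<close>

lemma g_upper: "g (s + h) \<le> exp (- k2 * h) * g s" if "s \<ge> 0" "h \<ge> 0"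
proof -
  have "exp (k2 * (s + h)) * g (s + h) \<le> exp (k2 * s) * g s"
  proof (rule nonincreasing_on_halfline[where f = "\<lambda>s. exp (k2 * s) * g s" and f' = "\<lambda>s. exp (k2 * s) * (g' s + k2 * g s)"])
    show "((\<lambda>s. exp (k2 * s) * g s) has_real_derivative exp (k2 * s) * (g' s + k2 * g s)) (at s within {0..})"
      if "s \<ge> 0" for s
      using g_deriv[OF that] by (auto intro!: derivative_eq_intros simp: algebra_simps)
    show "exp (k2 * s) * (g' s + k2 * g s) \<le> 0" if "s \<ge> 0" for s
      using g'_bounds[OF that] by (intro mult_nonneg_nonpos) auto
  qed (use that in auto)
  then have "exp (- k2 * (s + h)) * (exp (k2 * (s + h)) * g (s + h)) \<le> exp (- k2 * (s + h)) * (exp (k2 * s) * g s)"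
    by (intro mult_left_mono) auto
  moreover have "exp (- k2 * (s + h)) * exp (k2 * (s + h)) = 1" "exp (- k2 * (s + h)) * exp (k2 * s) = exp (- k2 * h)"
    by (simp_all add: algebra_simps flip: exp_add)
  ultimately show ?thesis by (simp only: mult.assoc[symmetric] mult_1)
qed

text \<open>The lower bound on \<open>g'\<close> makes \<open>exp (k1 * s) * g s\<close>
  nondecreasing.\<close>

lemma g_lower: "exp (- k1 * h) * g s \<le> g (s + h)" if "s \<ge> 0" "h \<ge> 0"
proof -
  have "- (exp (k1 * (s + h)) * g (s + h)) \<le> - (exp (k1 * s) * g s)"
  proof (rule nonincreasing_on_halfline[where f = "\<lambda>s. - (exp (k1 * s) * g s)" and f' = "\<lambda>s. - (exp (k1 * s) * (g' s + k1 * g s))"])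
    show "((\<lambda>s. - (exp (k1 * s) * g s)) has_real_derivative - (exp (k1 * s) * (g' s + k1 * g s))) (at s within {0..})"
      if "s \<ge> 0" for s
      using g_deriv[OF that] by (auto intro!: derivative_eq_intros simp: algebra_simps)
    show "- (exp (k1 * s) * (g' s + k1 * g s)) \<le> 0" if "s \<ge> 0" for s
      using g'_bounds[OF that] by simp
  qed (use that in auto)
  then have "exp (- k1 * (s + h)) * (exp (k1 * s) * g s) \<le> exp (- k1 * (s + h)) * (exp (k1 * (s + h)) * g (s + h))"
    by (intro mult_left_mono) auto
  moreover have "exp (- k1 * (s + h)) * exp (k1 * (s + h)) = 1" "exp (- k1 * (s + h)) * exp (k1 * s) = exp (- k1 * h)"
    by (simp_all add: algebra_simps flip: exp_add)
  ultimately show ?thesis by (simp only: mult.assoc[symmetric] mult_1)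
qed

lemma g0_pos: "g 0 > 0"
proof -
  obtain s where s: "s \<ge> 0" "g s \<noteq> 0" using g_nonzero by blast
  then have "0 < g s" using g_nonneg[of s] by simp
  also have "\<dots> \<le> exp (- k2 * s) * g 0" using g_upper[of 0 s] s by simp
  finally show ?thesis by (simp add: zero_less_mult_iff)
qed

lemma g_antimono: "g (s + h) \<le> g s" if "s \<ge> 0" "h \<ge> 0"
proof -
  have "exp (- k2 * h) * g s \<le> 1 * g s"
    using that k_pos g_nonneg[of s] by (intro mult_right_mono) auto
  with g_upper[OF that] show ?thesis by simp
qed

text \<open>Combines \<open>g_lower\<close> with \<open>1 - k1 * h \<le> exp (- k1 * h)\<close>. The
  error is relative to \<open>g s\<close>, so it remains integrable against the history.\<close>

lemma g_lipschitz: "\<bar>g (s + h) - g s\<bar> \<le> k1 * h * g s" if "s \<ge> 0" "h \<ge> 0"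
proof -
  have "(1 - k1 * h) * g s \<le> exp (- k1 * h) * g s"
    using exp_ge_add_one_self[of "- k1 * h"] g_nonneg[OF that(1)] by (intro mult_right_mono) auto
  with g_lower[OF that] g_antimono[OF that] show ?thesis by (simp add: algebra_simps)
qed

lemma g_integrable: "set_integrable lborel {0..} g"
proof (rule set_integrable_bound)
  show "set_integrable lborel {0..} (\<lambda>s. g 0 * exp (- k2 * s))"
    using exp_integral(1)[OF k_pos(2)] by simp
  show "AE s in lborel. s \<in> {0..} \<longrightarrow> norm (g s) \<le> norm (g 0 * exp (- k2 * s))"
    using g_upper[of 0] g_nonneg by (auto simp: mult.commute abs_mult)
qed (rule measurable_halfline[OF g_cont])

lemma exp_le_g: "exp (- k1 * s) \<le> g s / g 0" if "s \<ge> 0"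
  using g_lower[of 0 s] that g0_pos by (simp add: field_simps)

lemma g_integral_pos: "(LINT s:{0..}|lborel. g s) > 0"
proof -
  have "(LINT s:{0..}|lborel. exp (- k1 * s)) \<le> (LINT s:{0..}|lborel. g s / g 0)"
    using exp_integral(1)[OF k_pos(1)] g_integrable exp_le_g by (intro set_integral_mono) auto
  then have "1 / k1 \<le> (LINT s:{0..}|lborel. g s) / g 0"
    using exp_integral(2)[OF k_pos(1)] by simp
  moreover have "1 / k1 > 0" using k_pos by simp
  ultimately have "0 < (LINT s:{0..}|lborel. g s) / g 0" by linarith
  then show ?thesis using g0_pos by (simp add: zero_less_divide_iff)
qed

end

section \<open>The transport equation along characteristics\<close>

locale memory_history = memory_kernel +
  fixes \<eta> :: "real \<Rightarrow> real \<Rightarrow> complex" and y :: "real \<Rightarrow> complex"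
  assumes y_cont: "continuous_on {0..} y"
    and \<eta>_cont: "continuous_on ({0..} \<times> {0..}) (\<lambda>(t, s). \<eta> t s)"
    and transport: "\<And>t s. t > 0 \<Longrightarrow> s > 0 \<Longrightarrow> \<exists>Dt Ds.
        ((\<lambda>(t, s). \<eta> t s) has_derivative (\<lambda>(h, r). h *\<^sub>R Dt + r *\<^sub>R Ds)) (at (t, s)) \<and> Dt + Ds - y t = 0"
    and \<eta>_0: "\<And>t. t \<ge> 0 \<Longrightarrow> \<eta> t 0 = 0"
    and finite_energy: "\<And>t. t \<ge> 0 \<Longrightarrow> set_integrable lborel {0..} (\<lambda>s. g s * (norm (\<eta> t s))\<^sup>2)"
begin

definition Y :: "real \<Rightarrow> complex" where "Y t = integral {0..t} y"

lemma Y_deriv: "(Y has_vector_derivative y t) (at t within {0..T})" if "t \<in> {0..T}"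
  unfolding Y_def[abs_def] using that
  by (intro integral_has_vector_derivative continuous_on_subset[OF y_cont]) auto

lemma Y_diff: "Y (t + h) - Y t = integral {t..t + h} y" if "t \<ge> 0" "h \<ge> 0"
proof -
  have "y integrable_on {0..t + h}"
    by (intro integrable_continuous_interval continuous_on_subset[OF y_cont]) auto
  with Henstock_Kurzweil_Integration.integral_combine[of 0 t "t + h" y] that show ?thesis
    by (simp add: Y_def algebra_simps)
qed

lemma \<eta>_slice: "continuous_on {0..} (\<eta> t)" if "t \<ge> 0"
proof -
  have "continuous_on {0..} (\<lambda>s. (\<lambda>(t, s). \<eta> t s) (t, s))"
    by (rule continuous_on_compose2[OF \<eta>_cont continuous_on_Pair[OF continuous_on_const continuous_on_id]])
      (use that in auto)
  then show ?thesis by simp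
qed

text \<open>Along the line of points \<open>(t + r, s + r)\<close> the transport equation says that
  \<eta> minus \<open>Y\<close> has derivative zero. It is available only for \<open>0 < r\<close>,
  inside the quadrant; continuity up to the boundary lets the line start at \<open>t = 0\<close> or
  \<open>s = 0\<close>.\<close>

lemma \<eta>_characteristic: "\<eta> (t + h) (s + h) = \<eta> t s + (Y (t + h) - Y t)" if "t \<ge> 0" "s \<ge> 0" "h \<ge> 0"
proof (cases "h = 0")
  case False
  define f where "f r = \<eta> (t + r) (s + r) - Y (t + r)" for r
  have "continuous_on {0..t + h} Y"
    unfolding continuous_on_eq_continuous_within
    using has_vector_derivative_continuous[OF Y_deriv] by blast
  then have contY: "continuous_on {0..h} (\<lambda>r. Y (t + r))"
    by (rule continuous_on_compose2) (use that in \<open>auto intro!: continuous_intros\<close>)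
  have "continuous_on {0..h} (\<lambda>r. (\<lambda>(t, s). \<eta> t s) (t + r, s + r))"
    by (rule continuous_on_compose2[OF \<eta>_cont]) (use that in \<open>auto intro!: continuous_intros\<close>)
  then have "continuous_on {0..h} f"
    unfolding f_def using contY by (intro continuous_on_diff) auto
  moreover have "(f has_derivative (\<lambda>_. 0)) (at r)" if r: "0 < r" "r < h" for r
  proof -
    obtain Dt Ds where D: "((\<lambda>(t, s). \<eta> t s) has_derivative (\<lambda>(h, r). h *\<^sub>R Dt + r *\<^sub>R Ds)) (at (t + r, s + r))"
      "Dt + Ds - y (t + r) = 0"
      using transport[of "t + r" "s + r"] r \<open>t \<ge> 0\<close> \<open>s \<ge> 0\<close> by auto
    have "((\<lambda>r. (t + r, s + r)) has_derivative (\<lambda>d. (d, d))) (at r)"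
      by (auto intro!: derivative_eq_intros)
    from diff_chain_at[OF this D(1)]
    have 1: "((\<lambda>r. \<eta> (t + r) (s + r)) has_derivative (\<lambda>d. d *\<^sub>R Dt + d *\<^sub>R Ds)) (at r)"
      by (simp add: o_def)
    have "(Y has_vector_derivative y (t + r)) (at (t + r) within {0..t + h})"
      using r \<open>t \<ge> 0\<close> by (intro Y_deriv) auto
    then have "(Y has_vector_derivative y (t + r)) (at (t + r))"
      using r \<open>t \<ge> 0\<close> at_within_interior[of "t + r" "{0..t + h}"] by simp
    then have "(Y has_derivative (\<lambda>d. d *\<^sub>R y (t + r))) (at (t + r))"
      by (simp add: has_vector_derivative_def)
    moreover have "((\<lambda>r. t + r) has_derivative (\<lambda>d. d)) (at r)"
      by (auto intro!: derivative_eq_intros)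
    ultimately have "((\<lambda>r. Y (t + r)) has_derivative (\<lambda>d. d *\<^sub>R y (t + r))) (at r)"
      using diff_chain_at[of "\<lambda>r. t + r" "\<lambda>d. d" r Y] by (simp add: o_def)
    from has_derivative_diff[OF 1 this] D(2) show ?thesis
      by (simp add: f_def[abs_def] algebra_simps flip: scaleR_right_distrib scaleR_right_diff_distrib)
  qed
  ultimately obtain r where "norm (f h - f 0) \<le> norm (0 :: complex)"
    using mvt_general[of 0 h f "\<lambda>_ _. 0"] False \<open>h \<ge> 0\<close> by auto
  then show ?thesis by (simp add: f_def algebra_simps)
qed simp

end

lemma exp_diff_le: "exp (\<kappa> * r) - exp (\<kappa> * t) \<le> exp (\<kappa> * r) * (\<kappa> * (r - t))" for \<kappa> r t :: real
proof -
  have "exp (\<kappa> * r) * (1 + \<kappa> * (t - r)) \<le> exp (\<kappa> * r) * exp (\<kappa> * (t - r))"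
    by (intro mult_left_mono exp_ge_add_one_self) auto
  also have "\<dots> = exp (\<kappa> * t)" by (simp add: algebra_simps flip: exp_add)
  finally show ?thesis by (simp add: algebra_simps)
qed

lemma integral_deriv_halfline:
  fixes f :: "real \<Rightarrow> 'a::banach"
  assumes "continuous_on {0..} f" "t \<ge> 0"
  shows "((\<lambda>t. integral {0..t} f) has_vector_derivative f t) (at t within {0..})"
proof -
  have "((\<lambda>t. integral {0..t} f) has_vector_derivative f t) (at t within {0..t + 1})"
    using assms by (intro integral_has_vector_derivative continuous_on_subset[OF assms(1)]) auto
  also have "at t within {0..t + 1} = at t within {0..}"
    by (rule at_within_nhd[of t "{..<t + 1}"]) auto
  finally show ?thesis .
qed

lemma integral_add_interval:
  fixes f :: "real \<Rightarrow> 'a::banach"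
  assumes "continuous_on {0..} f" "t \<ge> 0" "h \<ge> 0"
  shows "integral {0..t + h} f - integral {0..t} f = integral {t..t + h} f"
proof -
  have "f integrable_on {0..t + h}"
    by (intro integrable_continuous_interval continuous_on_subset[OF assms(1)]) auto
  with Henstock_Kurzweil_Integration.integral_combine[of 0 t "t + h" f] assms show ?thesis
    by (simp add: algebra_simps)
qed

section \<open>One-step estimates for the history energy, the memory integral and
  \<open>Q\<close>\<close>

context memory_history begin

abbreviation b0 :: real where "b0 \<equiv> LINT s:{0..}|lborel. g s"

definition M :: "real \<Rightarrow> real" where "M t = (LINT s:{0..}|lborel. g s * (norm (\<eta> t s))\<^sup>2)"
definition N :: "real \<Rightarrow> complex" where "N t = (LINT s:{0..}|lborel. g s *\<^sub>R \<eta> t s)"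
definition Q :: "real \<Rightarrow> complex" where "Q t = (LINT s:{0..}|lborel. exp (- k1 * s) *\<^sub>R \<eta> t s)"

text \<open>The hypotheses of the weighted lemmas, bundled in their order for use with
  \<open>OF\<close>; \<open>exp_weight\<close> does the same for the exponential weight.\<close>

lemma g_weight:
  assumes "t \<ge> 0"
  shows "{0::real..} \<in> sets lborel" "set_integrable lborel {0..} g" "\<And>s. s \<in> {0..} \<Longrightarrow> g s \<ge> 0"
    "set_borel_measurable lborel {0..} (\<eta> t)" "set_integrable lborel {0..} (\<lambda>s. g s * (norm (\<eta> t s))\<^sup>2)"
  using g_integrable g_nonneg measurable_halfline[OF \<eta>_slice[OF assms]] finite_energy[OF assms] by auto

lemma exp_weight:
  assumes "t \<ge> 0"
  shows "{0::real..} \<in> sets lborel" "set_integrable lborel {0..} (\<lambda>s. exp (- k1 * s))"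
    "\<And>s. s \<in> {0..} \<Longrightarrow> exp (- k1 * s) \<ge> 0"
    "set_borel_measurable lborel {0..} (\<eta> t)" "set_integrable lborel {0..} (\<lambda>s. exp (- k1 * s) * (norm (\<eta> t s))\<^sup>2)"
proof -
  show "set_integrable lborel {0..} (\<lambda>s. exp (- k1 * s))" by (rule exp_integral(1)[OF k_pos(1)])
  show "set_borel_measurable lborel {0..} (\<eta> t)" by (rule measurable_halfline[OF \<eta>_slice[OF assms]])
  show "set_integrable lborel {0..} (\<lambda>s. exp (- k1 * s) * (norm (\<eta> t s))\<^sup>2)"
  proof (rule set_integrable_bound)
    show "set_integrable lborel {0..} (\<lambda>s. (1 / g 0) * (g s * (norm (\<eta> t s))\<^sup>2))"
      by (rule set_integrable_mult_right) (rule finite_energy[OF assms])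
    show "set_borel_measurable lborel {0..} (\<lambda>s. exp (- k1 * s) * (norm (\<eta> t s))\<^sup>2)"
      by (intro measurable_halfline continuous_intros \<eta>_slice assms)
    have "norm (exp (- k1 * s) * (norm (\<eta> t s))\<^sup>2) \<le> norm ((1 / g 0) * (g s * (norm (\<eta> t s))\<^sup>2))" if "s \<ge> 0" for s
      using mult_right_mono[OF exp_le_g[OF that], of "(norm (\<eta> t s))\<^sup>2"] g0_pos g_nonneg[OF that]
      by (simp add: abs_mult)
    then show "AE s in lborel. s \<in> {0..} \<longrightarrow>
        norm (exp (- k1 * s) * (norm (\<eta> t s))\<^sup>2) \<le> norm ((1 / g 0) * (g s * (norm (\<eta> t s))\<^sup>2))"
      by simp
  qed
qed auto

lemma M_nonneg: "M t \<ge> 0"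
  unfolding M_def set_lebesgue_integral_def
  by (intro integral_nonneg_AE) (auto simp: indicator_def g_nonneg)

lemma N_le: "(norm (N t))\<^sup>2 \<le> b0 * M t" if "t \<ge> 0"
  unfolding N_def M_def by (rule weighted_Cauchy_Schwarz[OF g_weight[OF that] g_integral_pos])

lemma Q_le: "(norm (Q t))\<^sup>2 \<le> 1 / (k1 * g 0) * M t" if "t \<ge> 0"
proof -
  have "(norm (Q t))\<^sup>2 \<le> (LINT s:{0..}|lborel. exp (- k1 * s)) * (LINT s:{0..}|lborel. exp (- k1 * s) * (norm (\<eta> t s))\<^sup>2)"
    unfolding Q_def
  proof (rule weighted_Cauchy_Schwarz[OF exp_weight[OF that]])
    show "0 < (LINT s:{0..}|lborel. exp (- k1 * s))"
      unfolding exp_integral(2)[OF k_pos(1)] using k_pos by simp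
  qed
  also have "\<dots> = 1 / k1 * (LINT s:{0..}|lborel. exp (- k1 * s) * (norm (\<eta> t s))\<^sup>2)"
    using exp_integral(2)[OF k_pos(1)] by simp
  also have "(LINT s:{0..}|lborel. exp (- k1 * s) * (norm (\<eta> t s))\<^sup>2) \<le> (LINT s:{0..}|lborel. (1 / g 0) * (g s * (norm (\<eta> t s))\<^sup>2))"
  proof (rule set_integral_mono)
    show "exp (- k1 * s) * (norm (\<eta> t s))\<^sup>2 \<le> (1 / g 0) * (g s * (norm (\<eta> t s))\<^sup>2)" if "s \<in> {0..}" for s
      using mult_right_mono[OF exp_le_g, of s "(norm (\<eta> t s))\<^sup>2"] that by simp
    show "set_integrable lborel {0..} (\<lambda>s. (1 / g 0) * (g s * (norm (\<eta> t s))\<^sup>2))"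
      by (rule set_integrable_mult_right) (rule finite_energy[OF that])
  qed (rule exp_weight[OF that])
  also have "(LINT s:{0..}|lborel. (1 / g 0) * (g s * (norm (\<eta> t s))\<^sup>2)) = 1 / g 0 * M t"
    unfolding M_def by (rule set_integral_mult_right)
  finally show ?thesis using k_pos by (simp add: divide_right_mono)
qed

lemma y_bounded:
  obtains K where "K \<ge> 0" "\<forall>r\<in>{0..T}. norm (y r) \<le> K"
proof -
  have "compact (y ` {0..T})"
    by (intro compact_continuous_image continuous_on_subset[OF y_cont]) auto
  then obtain K where "\<forall>x\<in>y ` {0..T}. norm x \<le> K"
    using compact_imp_bounded bounded_iff by metis
  then show ?thesis using that[of "max K 0"] by (simp add: le_max_iff_disj)
qed

context
  fixes T K :: real
  assumes K: "K \<ge> 0" and y_le: "\<forall>r\<in>{0..T}. norm (y r) \<le> K"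
begin

lemma Y_step: "norm (Y (t + h) - Y t) \<le> K * h" if "t \<ge> 0" "h \<ge> 0" "t + h \<le> T"
proof -
  have "norm (integral {t..t + h} y) \<le> K * (t + h - t)"
    using that by (intro integral_bound continuous_on_subset[OF y_cont]) (use y_le in auto)
  then show ?thesis using that by (simp add: Y_diff)
qed

text \<open>For \<open>s \<le> t\<close> the characteristic through \<open>(t, s)\<close> leaves the
  boundary at time \<open>t - s\<close>, where \<eta> vanishes. So only the values of
  \<open>y\<close> on the last \<open>s\<close> units of time matter.\<close>

lemma \<eta>_initial: "norm (\<eta> t s) \<le> K * s" if "0 \<le> s" "s \<le> t" "t \<le> T"
  using \<eta>_characteristic[of "t - s" 0 s] Y_step[of "t - s" s] \<eta>_0[of "t - s"] that by simp

lemma \<eta>_initial': "norm (\<eta> (t + h) s) \<le> K * h" if "0 \<le> t" "s \<in> {0..<h}" "t + h \<le> T"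
proof -
  have "norm (\<eta> (t + h) s) \<le> K * s" using that by (intro \<eta>_initial) auto
  also have "\<dots> \<le> K * h" using that K by (intro mult_left_mono) auto
  finally show ?thesis .
qed

text \<open>Split at age \<open>h\<close>. The new history has size at most \<open>K * h\<close> on
  an interval of length \<open>h\<close>, hence the term of order \<open>h ^ 3\<close>. The old
  history is shifted by \<open>\<Delta>\<close>, while \<open>g_upper\<close> supplies the factor
  \<open>exp (- k2 * h)\<close>.\<close>

lemma M_step:
  assumes th: "t \<ge> 0" "h \<ge> 0" "t + h \<le> T"
  defines "\<Delta> \<equiv> Y (t + h) - Y t"
  shows "M (t + h) \<le> g 0 * K\<^sup>2 * h ^ 3 + exp (- k2 * h) * (M t + 2 * (\<Delta> \<bullet> N t) + (norm \<Delta>)\<^sup>2 * b0)"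
    and "M t + 2 * (\<Delta> \<bullet> N t) + (norm \<Delta>)\<^sup>2 * b0 \<ge> 0"
proof -
  note sq = weighted_square_shift(4,5)[OF g_weight[OF th(1)], where d = \<Delta>]
  have expand: "(LINT s:{0..}|lborel. g s * (norm (\<eta> t s + \<Delta>))\<^sup>2) = M t + 2 * (\<Delta> \<bullet> N t) + (norm \<Delta>)\<^sup>2 * b0"
    unfolding M_def N_def by (rule sq(2))
  let ?f = "\<lambda>s. g s * (norm (\<eta> (t + h) s))\<^sup>2"
  note f = finite_energy[of "t + h"] and sp = set_integral_split_shift[of ?f h]
  have "M (t + h) = (LINT s:{0..<h}|lborel. ?f s) + (LINT s:{0..}|lborel. ?f (s + h))"
    unfolding M_def using sp(1) f th by simp
  also have "(LINT s:{0..<h}|lborel. ?f s) \<le> g 0 * (K * h)\<^sup>2 * h"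
  proof -
    have "norm (LINT s:{0..<h}|lborel. ?f s) \<le> g 0 * (K * h)\<^sup>2 * h"
    proof (rule set_integral_initial_bound)
      fix s assume s: "s \<in> {0..<h}"
      then have "g s * (norm (\<eta> (t + h) s))\<^sup>2 \<le> g 0 * (K * h)\<^sup>2"
        using g_antimono[of 0 s] g_nonneg[of 0] \<eta>_initial'[OF th(1) s th(3)]
        by (intro mult_mono power_mono) auto
      then show "norm (?f s) \<le> g 0 * (K * h)\<^sup>2" using g_nonneg[of s] s by (simp add: abs_mult)
    qed (use sp(3) f th in auto)
    then show ?thesis by simp
  qed
  also have "(LINT s:{0..}|lborel. ?f (s + h)) \<le> (LINT s:{0..}|lborel. exp (- k2 * h) * (g s * (norm (\<eta> t s + \<Delta>))\<^sup>2))"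
  proof (rule set_integral_mono)
    show "set_integrable lborel {0..} (\<lambda>s. ?f (s + h))" using sp(2) f th by simp
    show "set_integrable lborel {0..} (\<lambda>s. exp (- k2 * h) * (g s * (norm (\<eta> t s + \<Delta>))\<^sup>2))"
      by (rule set_integrable_mult_right) (rule sq(1))
    show "?f (s + h) \<le> exp (- k2 * h) * (g s * (norm (\<eta> t s + \<Delta>))\<^sup>2)" if "s \<in> {0..}" for s
      using mult_right_mono[OF g_upper[of s h], of "(norm (\<eta> t s + \<Delta>))\<^sup>2"] that th
        \<eta>_characteristic[of t s h] by (simp add: \<Delta>_def mult.assoc)
  qed
  also have "\<dots> = exp (- k2 * h) * (M t + 2 * (\<Delta> \<bullet> N t) + (norm \<Delta>)\<^sup>2 * b0)"
    unfolding expand[symmetric] by (rule set_integral_mult_right)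
  finally show "M (t + h) \<le> g 0 * K\<^sup>2 * h ^ 3 + exp (- k2 * h) * (M t + 2 * (\<Delta> \<bullet> N t) + (norm \<Delta>)\<^sup>2 * b0)"
    by (simp add: power_mult_distrib power_numeral_reduce mult_ac)
  show "M t + 2 * (\<Delta> \<bullet> N t) + (norm \<Delta>)\<^sup>2 * b0 \<ge> 0"
    unfolding expand[symmetric] unfolding set_lebesgue_integral_def
    by (intro integral_nonneg_AE) (auto simp: indicator_def g_nonneg)
qed

text \<open>The three summands come from the new history, from the change of the kernel between
  \<open>s\<close> and \<open>s + h\<close>, estimated by \<open>g_lipschitz\<close>, and from the
  shift of the old history by \<open>Y (t + h) - Y t\<close>.\<close>

lemma N_step:
  assumes th: "t \<ge> 0" "h \<ge> 0" "t + h \<le> T"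
  shows "norm (N (t + h) - N t) \<le> g 0 * K * h * h + k1 * h * ((b0 + M t) / 2) + K * h * b0"
    and "norm (N t) \<le> (b0 + M t) / 2"
proof -
  define \<Delta> where "\<Delta> = Y (t + h) - Y t"
  let ?f = "\<lambda>s. g s *\<^sub>R \<eta> (t + h) s"
  note w = weighted_square_shift[OF g_weight[OF th(1)]]
  have f: "set_integrable lborel {0..} ?f"
    using th by (intro weighted_square_shift(1)[OF g_weight]) auto
  note sp = set_integral_split_shift[OF f th(2)]
  have abs_le: "(LINT s:{0..}|lborel. g s * norm (\<eta> t s)) \<le> (b0 + M t) / 2"
    using w(3) by (simp add: M_def)
  have "norm (N t) \<le> (LINT s:{0..}|lborel. norm (g s *\<^sub>R \<eta> t s))"
    unfolding N_def by (rule set_integral_norm_bound[OF w(1)])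
  also have "\<dots> = (LINT s:{0..}|lborel. g s * norm (\<eta> t s))"
    using g_nonneg by (intro set_lebesgue_integral_cong) auto
  finally show "norm (N t) \<le> (b0 + M t) / 2" using abs_le by simp
  have g_shift: "set_integrable lborel {0..} (\<lambda>s. g (s + h))"
    by (rule set_integral_split_shift(2)[OF g_integrable th(2)])
  have int_diff: "set_integrable lborel {0..} (\<lambda>s. ?f (s + h) - g s *\<^sub>R \<eta> t s)"
    by (rule set_integral_diff(1)[OF sp(2) w(1)])
  have "N (t + h) - N t = (LINT s:{0..<h}|lborel. ?f s) + (LINT s:{0..}|lborel. ?f (s + h) - g s *\<^sub>R \<eta> t s)"
  proof -
    have "N (t + h) = (LINT s:{0..<h}|lborel. ?f s) + (LINT s:{0..}|lborel. ?f (s + h))"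
      unfolding N_def by (rule sp(1))
    moreover have "(LINT s:{0..}|lborel. ?f (s + h)) - N t = (LINT s:{0..}|lborel. ?f (s + h) - g s *\<^sub>R \<eta> t s)"
      unfolding N_def by (rule set_integral_diff(2)[OF sp(2) w(1), symmetric])
    ultimately show ?thesis by (simp only: add_diff_eq[symmetric])
  qed
  moreover have "norm (LINT s:{0..<h}|lborel. ?f s) \<le> g 0 * (K * h) * h"
  proof (rule set_integral_initial_bound[OF sp(3)])
    fix s assume s: "s \<in> {0..<h}"
    then have "g s * norm (\<eta> (t + h) s) \<le> g 0 * (K * h)"
      using g_antimono[of 0 s] g_nonneg[of 0] \<eta>_initial'[OF th(1) s th(3)]
      by (intro mult_mono) auto
    then show "norm (?f s) \<le> g 0 * (K * h)" using g_nonneg[of s] s by (simp add: abs_mult)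
  qed fact
  moreover have "norm (LINT s:{0..}|lborel. ?f (s + h) - g s *\<^sub>R \<eta> t s)
      \<le> k1 * h * ((b0 + M t) / 2) + K * h * b0"
  proof -
    have i1: "set_integrable lborel {0..} (\<lambda>s. k1 * h * (g s * norm (\<eta> t s)))"
      by (rule set_integrable_mult_right) (rule w(2))
    have i2: "set_integrable lborel {0..} (\<lambda>s. norm \<Delta> * g (s + h))"
      by (rule set_integrable_mult_right) (rule g_shift)
    have "norm (LINT s:{0..}|lborel. ?f (s + h) - g s *\<^sub>R \<eta> t s)
        \<le> (LINT s:{0..}|lborel. norm (?f (s + h) - g s *\<^sub>R \<eta> t s))"
      by (rule set_integral_norm_bound[OF int_diff])
    also have "\<dots> \<le> (LINT s:{0..}|lborel. k1 * h * (g s * norm (\<eta> t s)) + norm \<Delta> * g (s + h))"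
    proof (rule set_integral_mono)
      show "set_integrable lborel {0..} (\<lambda>s. norm (?f (s + h) - g s *\<^sub>R \<eta> t s))"
        by (rule set_integrable_norm[OF int_diff])
      show "set_integrable lborel {0..} (\<lambda>s. k1 * h * (g s * norm (\<eta> t s)) + norm \<Delta> * g (s + h))"
        by (rule set_integral_add(1)[OF i1 i2])
      fix s :: real assume s: "s \<in> {0..}"
      have "?f (s + h) - g s *\<^sub>R \<eta> t s = (g (s + h) - g s) *\<^sub>R \<eta> t s + g (s + h) *\<^sub>R \<Delta>"
      proof -
        have "\<eta> (t + h) (s + h) = \<eta> t s + \<Delta>"
          using \<eta>_characteristic[of t s h] s th by (simp add: \<Delta>_def)
        then show ?thesis by (simp only: scaleR_add_right scaleR_diff_left) simp
      qed
      also have "norm \<dots> \<le> \<bar>g (s + h) - g s\<bar> * norm (\<eta> t s) + g (s + h) * norm \<Delta>"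
        using g_nonneg[of "s + h"] s th by (intro order_trans[OF norm_triangle_ineq]) simp
      also have "\<bar>g (s + h) - g s\<bar> * norm (\<eta> t s) \<le> (k1 * h * g s) * norm (\<eta> t s)"
        using s th by (intro mult_right_mono g_lipschitz) auto
      finally show "norm (?f (s + h) - g s *\<^sub>R \<eta> t s) \<le> k1 * h * (g s * norm (\<eta> t s)) + norm \<Delta> * g (s + h)"
        by (simp add: mult_ac)
    qed
    also have "\<dots> = k1 * h * (LINT s:{0..}|lborel. g s * norm (\<eta> t s)) + norm \<Delta> * (LINT s:{0..}|lborel. g (s + h))"
      unfolding set_integral_add(2)[OF i1 i2] by (simp only: set_integral_mult_right)
    also have "\<dots> \<le> k1 * h * ((b0 + M t) / 2) + K * h * b0"
    proof (intro add_mono mult_left_mono mult_mono abs_le)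
      show "norm \<Delta> \<le> K * h" unfolding \<Delta>_def by (rule Y_step[OF th])
      show "(LINT s:{0..}|lborel. g (s + h)) \<le> b0"
        using g_antimono th by (intro set_integral_mono g_shift g_integrable) auto
      show "0 \<le> (LINT s:{0..}|lborel. g (s + h))"
        unfolding set_lebesgue_integral_def using g_nonneg th
        by (intro integral_nonneg_AE) (auto simp: indicator_def)
    qed (use K th k_pos in auto)
    finally show ?thesis .
  qed
  ultimately show "norm (N (t + h) - N t) \<le> g 0 * K * h * h + k1 * h * ((b0 + M t) / 2) + K * h * b0"
    using norm_triangle_ineq[of "LINT s:{0..<h}|lborel. ?f s" "LINT s:{0..}|lborel. ?f (s + h) - g s *\<^sub>R \<eta> t s"]
    by (simp add: mult.assoc)
qed

text \<open>For an exponential weight the shift in age is exactly multiplication by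
  \<open>exp (- k1 * h)\<close>, so the new history is the only error.\<close>

lemma Q_step:
  assumes th: "t \<ge> 0" "h \<ge> 0" "t + h \<le> T"
  shows "norm (Q (t + h) - exp (- k1 * h) *\<^sub>R (Q t + (1 / k1) *\<^sub>R (Y (t + h) - Y t))) \<le> K * h\<^sup>2"
proof -
  define \<Delta> where "\<Delta> = Y (t + h) - Y t"
  let ?f = "\<lambda>s. exp (- k1 * s) *\<^sub>R \<eta> (t + h) s"
  have f: "set_integrable lborel {0..} ?f"
    using th by (intro weighted_square_shift(1)[OF exp_weight]) auto
  note w = weighted_square_shift(1)[OF exp_weight[OF th(1)]]
  note sp = set_integral_split_shift[OF f th(2)]
  have e: "set_integrable lborel {0..} (\<lambda>s. exp (- k1 * s) *\<^sub>R \<Delta>)"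
    by (rule set_integrable_scaleR_left) (rule exp_integral(1)[OF k_pos(1)])
  have "(LINT s:{0..}|lborel. ?f (s + h)) =
      (LINT s:{0..}|lborel. exp (- k1 * h) *\<^sub>R (exp (- k1 * s) *\<^sub>R \<eta> t s + exp (- k1 * s) *\<^sub>R \<Delta>))"
  proof (rule set_lebesgue_integral_cong)
    show "\<forall>s. s \<in> {0..} \<longrightarrow> ?f (s + h) = exp (- k1 * h) *\<^sub>R (exp (- k1 * s) *\<^sub>R \<eta> t s + exp (- k1 * s) *\<^sub>R \<Delta>)"
    proof (intro allI impI)
      fix s :: real assume "s \<in> {0..}"
      then have "\<eta> (t + h) (s + h) = \<eta> t s + \<Delta>"
        using \<eta>_characteristic[of t s h] th by (simp add: \<Delta>_def)
      moreover have "exp (- k1 * (s + h)) = exp (- k1 * h) * exp (- k1 * s)"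
        by (simp add: algebra_simps flip: exp_add)
      ultimately show "?f (s + h) = exp (- k1 * h) *\<^sub>R (exp (- k1 * s) *\<^sub>R \<eta> t s + exp (- k1 * s) *\<^sub>R \<Delta>)"
        by (simp only: scaleR_add_right scaleR_scaleR)
    qed
  qed simp
  also have "\<dots> = exp (- k1 * h) *\<^sub>R (LINT s:{0..}|lborel. exp (- k1 * s) *\<^sub>R \<eta> t s + exp (- k1 * s) *\<^sub>R \<Delta>)"
    by (rule set_integral_scaleR_right)
  also have "\<dots> = exp (- k1 * h) *\<^sub>R (Q t + (LINT s:{0..}|lborel. exp (- k1 * s) *\<^sub>R \<Delta>))"
  proof -
    have "(LINT s:{0..}|lborel. exp (- k1 * s) *\<^sub>R \<eta> t s + exp (- k1 * s) *\<^sub>R \<Delta>)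
        = Q t + (LINT s:{0..}|lborel. exp (- k1 * s) *\<^sub>R \<Delta>)"
      unfolding Q_def by (rule set_integral_add(2)[OF w e])
    then show ?thesis by (simp only:)
  qed
  also have "(LINT s:{0..}|lborel. exp (- k1 * s) *\<^sub>R \<Delta>) = (1 / k1) *\<^sub>R \<Delta>"
  proof -
    have "(LINT s:{0..}|lborel. exp (- k1 * s) *\<^sub>R \<Delta>) = (LINT s:{0..}|lborel. exp (- k1 * s)) *\<^sub>R \<Delta>"
      using integral_scaleR_left[of \<Delta> lborel "\<lambda>s. indicator {0..} s *\<^sub>R exp (- k1 * s)"]
        exp_integral(1)[OF k_pos(1)]
      by (simp add: set_lebesgue_integral_def set_integrable_def)
    then show ?thesis unfolding exp_integral(2)[OF k_pos(1)] .
  qed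
  finally have "Q (t + h) - exp (- k1 * h) *\<^sub>R (Q t + (1 / k1) *\<^sub>R \<Delta>) = (LINT s:{0..<h}|lborel. ?f s)"
    by (subst Q_def) (simp only: sp(1) add_diff_cancel_right')
  moreover have "norm (LINT s:{0..<h}|lborel. ?f s) \<le> (K * h) * h"
  proof (rule set_integral_initial_bound[OF sp(3)])
    fix s assume s: "s \<in> {0..<h}"
    then have "exp (- k1 * s) * norm (\<eta> (t + h) s) \<le> 1 * (K * h)"
      using \<eta>_initial'[OF th(1) s th(3)] k_pos by (intro mult_mono) auto
    then show "norm (?f s) \<le> K * h" by simp
  qed fact
  ultimately show ?thesis by (simp add: \<Delta>_def power2_eq_square mult.assoc)
qed

text \<open>\<open>M_step\<close> holds for steps of any length, so a single step from 0 to
  \<open>t\<close> is enough.\<close>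

lemma M_bounded:
  obtains B where "B \<ge> 0" "\<forall>t\<in>{0..T}. M t \<le> B"
proof
  define B where "B = g 0 * K\<^sup>2 * T ^ 3 + (M 0 + 2 * (K * T * norm (N 0)) + (K * T)\<^sup>2 * b0)"
  have b0: "b0 > 0" by (rule g_integral_pos)
  \<comment> \<open>The maximum guards against negative \<open>T\<close>: the interval is then
    empty, but \<open>B\<close> itself could be negative.\<close>
  show "\<forall>t\<in>{0..T}. M t \<le> max B 0"
  proof
    fix t assume t: "t \<in> {0..T}"
    define \<Delta> where "\<Delta> = Y t - Y 0"
    have step: "M t \<le> g 0 * K\<^sup>2 * t ^ 3 + exp (- k2 * t) * (M 0 + 2 * (\<Delta> \<bullet> N 0) + (norm \<Delta>)\<^sup>2 * b0)"
      "M 0 + 2 * (\<Delta> \<bullet> N 0) + (norm \<Delta>)\<^sup>2 * b0 \<ge> 0"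
      using M_step[of 0 t] t by (simp_all add: \<Delta>_def)
    have "norm \<Delta> \<le> K * t" using Y_step[of 0 t] t by (simp add: \<Delta>_def)
    also have "\<dots> \<le> K * T" using t K by (intro mult_left_mono) auto
    finally have \<Delta>: "norm \<Delta> \<le> K * T" .
    have "\<Delta> \<bullet> N 0 \<le> norm \<Delta> * norm (N 0)" by (rule norm_cauchy_schwarz)
    also have "\<dots> \<le> K * T * norm (N 0)" using \<Delta> by (intro mult_right_mono) auto
    finally have \<Delta>N: "\<Delta> \<bullet> N 0 \<le> K * T * norm (N 0)" .
    have "exp (- k2 * t) * (M 0 + 2 * (\<Delta> \<bullet> N 0) + (norm \<Delta>)\<^sup>2 * b0) \<le> 1 * (M 0 + 2 * (\<Delta> \<bullet> N 0) + (norm \<Delta>)\<^sup>2 * b0)"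
      using step(2) t k_pos by (intro mult_right_mono) auto
    also have "\<dots> \<le> M 0 + 2 * (K * T * norm (N 0)) + (K * T)\<^sup>2 * b0"
      using \<Delta> \<Delta>N b0 by (simp add: add_mono power_mono)
    finally have "M t \<le> g 0 * K\<^sup>2 * t ^ 3 + (M 0 + 2 * (K * T * norm (N 0)) + (K * T)\<^sup>2 * b0)"
      using step(1) by linarith
    also have "g 0 * K\<^sup>2 * t ^ 3 \<le> g 0 * K\<^sup>2 * T ^ 3"
      using t g0_pos by (intro mult_left_mono power_mono) auto
    finally show "M t \<le> max B 0" by (simp add: B_def)
  qed
qed simp

text \<open>A bound on \<open>M\<close> over the whole interval makes the estimates of
  \<open>N_step\<close> uniform. The result gives continuity of \<open>N\<close> and, in
  \<open>M_le_P\<close>, the error of the Riemann sum.\<close>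

lemma N_lipschitz:
  assumes "T \<ge> 0"
  obtains C D where "C \<ge> 0" "D \<ge> 0"
    "\<forall>t h. 0 \<le> t \<and> 0 \<le> h \<and> t + h \<le> T \<longrightarrow> norm (N (t + h) - N t) \<le> C * h"
    "\<forall>t\<in>{0..T}. norm (N t) \<le> D"
proof -
  obtain B where B: "B \<ge> 0" "\<forall>t\<in>{0..T}. M t \<le> B" by (rule M_bounded)
  have b0: "b0 > 0" by (rule g_integral_pos)
  define D where "D = (b0 + B) / 2"
  define C where "C = g 0 * K * T + k1 * D + K * b0"
  have nn: "C \<ge> 0" "D \<ge> 0" using B b0 K k_pos g0_pos assms by (simp_all add: C_def D_def)
  moreover have "norm (N (t + h) - N t) \<le> C * h" if th: "0 \<le> t" "0 \<le> h" "t + h \<le> T" for t h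
  proof -
    have "g 0 * K * h * h \<le> g 0 * K * T * h"
      using th K g0_pos by (intro mult_right_mono mult_left_mono) auto
    moreover have "k1 * h * ((b0 + M t) / 2) \<le> k1 * h * D"
      using th B(2)[rule_format, of t] k_pos by (intro mult_left_mono) (auto simp: D_def)
    ultimately have "norm (N (t + h) - N t) \<le> g 0 * K * T * h + k1 * h * D + K * h * b0"
      using N_step(1)[OF th] by linarith
    also have "\<dots> = C * h" by (simp add: C_def algebra_simps)
    finally show ?thesis .
  qed
  moreover have "norm (N t) \<le> D" if "t \<in> {0..T}" for t
    using N_step(2)[of t 0] B(2)[rule_format, OF that] that by (simp add: D_def)
  ultimately show ?thesis by (intro that[of C D]) auto
qed

end

lemma N_cont: "continuous_on {0..} N"
  unfolding continuous_on_iff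
proof (intro ballI allI impI)
  fix t e :: real assume t: "t \<in> {0..}" and e: "e > 0"
  obtain K where K: "K \<ge> 0" "\<forall>r\<in>{0..t + 1}. norm (y r) \<le> K" by (rule y_bounded)
  have "t + 1 \<ge> 0" using t by simp
  then obtain C D where C: "C \<ge> 0" "D \<ge> 0"
    "\<forall>s h. 0 \<le> s \<and> 0 \<le> h \<and> s + h \<le> t + 1 \<longrightarrow> norm (N (s + h) - N s) \<le> C * h"
    "\<forall>s\<in>{0..t + 1}. norm (N s) \<le> D"
    by (rule N_lipschitz[OF K])
  show "\<exists>d>0. \<forall>s\<in>{0..}. dist s t < d \<longrightarrow> dist (N s) (N t) < e"
  proof (intro exI[of _ "min 1 (e / (C + 1))"] conjI ballI impI)
    show "0 < min 1 (e / (C + 1))" using e C(1) by simp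
    fix s assume s: "s \<in> {0..}" and "dist s t < min 1 (e / (C + 1))"
    then have close: "\<bar>s - t\<bar> < 1" "\<bar>s - t\<bar> < e / (C + 1)" by (simp_all add: dist_real_def)
    have "norm (N s - N t) \<le> C * \<bar>s - t\<bar>"
    proof (cases "s \<le> t")
      case True
      then show ?thesis using C(3)[rule_format, of s "t - s"] s t by (simp add: norm_minus_commute)
    next
      case False
      then show ?thesis using C(3)[rule_format, of t "s - t"] t s close by simp
    qed
    also have "\<dots> \<le> (C + 1) * \<bar>s - t\<bar>" by (intro mult_right_mono) auto
    also have "\<dots> < e" using close(2) C(1) by (simp add: pos_less_divide_eq mult.commute)
    finally show "dist (N s) (N t) < e" by (simp add: dist_norm)
  qed
qed

section \<open>The majorant \<open>P\<close> and the differential equation for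
  \<open>Q\<close>\<close>

text \<open>The scalar is attached to \<open>N\<close> so that the integrand is literally
  \<open>\<phi> r \<bullet> y r\<close>, as \<open>riemann_step\<close> requires.\<close>

definition W :: "real \<Rightarrow> real" where "W r = ((2 * exp (k2 * r)) *\<^sub>R N r) \<bullet> y r"
text \<open>The variation-of-constants formula for the comparison equation; differentiability is
  built in since \<open>W\<close> is continuous.\<close>

definition P :: "real \<Rightarrow> real" where "P t = exp (- k2 * t) * (M 0 + integral {0..t} W)"

lemma W_cont: "continuous_on {0..} W"
  unfolding W_def by (intro continuous_intros N_cont y_cont)

lemma P_deriv: "(P has_real_derivative - k2 * P t + 2 * (y t \<bullet> N t)) (at t within {0..})" if "t \<ge> 0"
proof -
  have "((\<lambda>t. integral {0..t} W) has_real_derivative W t) (at t within {0..})"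
    using integral_deriv_halfline[OF W_cont that] by (simp add: has_real_derivative_iff_has_vector_derivative)
  from DERIV_add[OF DERIV_const[of "M 0"] this]
  have "((\<lambda>t. M 0 + integral {0..t} W) has_real_derivative 0 + W t) (at t within {0..})" .
  moreover have "((\<lambda>t. exp (- k2 * t)) has_real_derivative - k2 * exp (- k2 * t)) (at t within {0..})"
    by (auto intro!: derivative_eq_intros)
  ultimately have "(P has_real_derivative
      (- k2 * exp (- k2 * t)) * (M 0 + integral {0..t} W) + (0 + W t) * exp (- k2 * t)) (at t within {0..})"
    unfolding P_def[abs_def] by (intro DERIV_mult)
  moreover have "(- k2 * exp (- k2 * t)) * (M 0 + integral {0..t} W) + (0 + W t) * exp (- k2 * t)
      = - k2 * P t + 2 * (y t \<bullet> N t)"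
  proof -
    have "W t * exp (- k2 * t) = 2 * (exp (k2 * t) * exp (- k2 * t)) * (y t \<bullet> N t)"
      by (simp only: W_def inner_scaleR_left inner_scaleR_right inner_commute mult_ac)
    also have "exp (k2 * t) * exp (- k2 * t) = 1" by (simp flip: exp_add)
    finally show ?thesis by (simp add: P_def)
  qed
  ultimately show ?thesis by simp
qed

lemma P_0: "P 0 = M 0"
  by (simp add: P_def)

text \<open>After multiplication by \<open>exp (k2 * t)\<close>, one step raises the history energy
  by at most \<open>\<phi> t \<bullet> \<Delta>\<close>, and the integral of \<open>W\<close> by the
  same amount, both up to order \<open>h\<^sup>2\<close>. Telescoping shows that their difference
  \<open>f\<close> does not increase.\<close>

lemma M_le_P:
  assumes T: "T \<ge> 0"
  shows "M T \<le> P T"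
proof -
  obtain K where K: "K \<ge> 0" "\<forall>r\<in>{0..T}. norm (y r) \<le> K" by (rule y_bounded)
  obtain C D where CD: "C \<ge> 0" "D \<ge> 0"
    "\<forall>t h. 0 \<le> t \<and> 0 \<le> h \<and> t + h \<le> T \<longrightarrow> norm (N (t + h) - N t) \<le> C * h"
    "\<forall>t\<in>{0..T}. norm (N t) \<le> D"
    by (rule N_lipschitz[OF K T])
  have b0: "b0 > 0" by (rule g_integral_pos)
  define E where "E = exp (k2 * T)"
  have exp_le: "exp (k2 * r) \<le> E" if "r \<le> T" for r
    using that k_pos by (simp add: E_def)
  define \<phi> where "\<phi> r = (2 * exp (k2 * r)) *\<^sub>R N r" for r
  define L where "L = 2 * E * C + 2 * (E * k2) * D"
  define f where "f t = exp (k2 * t) * M t - integral {0..t} W" for t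
  have \<phi>_lip: "norm (\<phi> r - \<phi> t) \<le> L * h" if "0 \<le> t" "0 \<le> h" "t + h \<le> T" "r \<in> {t..t + h}" for r t h
  proof -
    have "\<phi> r - \<phi> t = (2 * exp (k2 * r)) *\<^sub>R (N r - N t) + (2 * (exp (k2 * r) - exp (k2 * t))) *\<^sub>R N t"
      by (simp add: \<phi>_def algebra_simps)
    also have "norm \<dots> \<le> (2 * exp (k2 * r)) * norm (N r - N t) + (2 * (exp (k2 * r) - exp (k2 * t))) * norm (N t)"
    proof (rule order_trans[OF norm_triangle_ineq])
      have "exp (k2 * t) \<le> exp (k2 * r)" using that k_pos by simp
      then show "norm ((2 * exp (k2 * r)) *\<^sub>R (N r - N t)) + norm ((2 * (exp (k2 * r) - exp (k2 * t))) *\<^sub>R N t)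
        \<le> (2 * exp (k2 * r)) * norm (N r - N t) + (2 * (exp (k2 * r) - exp (k2 * t))) * norm (N t)"
        by simp
    qed
    also have "(2 * exp (k2 * r)) * norm (N r - N t) \<le> (2 * E) * (C * h)"
    proof (rule mult_mono)
      have "norm (N (t + (r - t)) - N t) \<le> C * (r - t)" using that by (intro CD(3)[rule_format]) auto
      also have "\<dots> \<le> C * h" using that CD by (intro mult_left_mono) auto
      finally show "norm (N r - N t) \<le> C * h" by simp
    qed (use exp_le that in \<open>auto simp: E_def\<close>)
    also have "(2 * (exp (k2 * r) - exp (k2 * t))) * norm (N t) \<le> (2 * (E * (k2 * h))) * D"
    proof (intro mult_mono mult_left_mono)
      have "exp (k2 * r) - exp (k2 * t) \<le> exp (k2 * r) * (k2 * (r - t))" by (rule exp_diff_le)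
      also have "\<dots> \<le> E * (k2 * h)"
        using that k_pos exp_le by (intro mult_mono) (auto simp: E_def)
      finally show "exp (k2 * r) - exp (k2 * t) \<le> E * (k2 * h)" .
    qed (use CD that k_pos in \<open>auto simp: E_def\<close>)
    finally show ?thesis by (simp add: L_def algebra_simps)
  qed
  have "f T \<le> f 0"
  proof (rule telescoping_nonincreasing[OF _ T])
    fix t h assume th: "0 \<le> t" "0 \<le> h" "t + h \<le> T"
    define \<Delta> where "\<Delta> = Y (t + h) - Y t"
    have "exp (k2 * (t + h)) * M (t + h) \<le> exp (k2 * (t + h)) *
        (g 0 * K\<^sup>2 * h ^ 3 + exp (- k2 * h) * (M t + 2 * (\<Delta> \<bullet> N t) + (norm \<Delta>)\<^sup>2 * b0))"
      unfolding \<Delta>_def by (intro mult_left_mono M_step[OF K th]) auto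
    also have "\<dots> = exp (k2 * (t + h)) * (g 0 * K\<^sup>2 * h ^ 3)
        + (exp (k2 * (t + h)) * exp (- k2 * h)) * (M t + 2 * (\<Delta> \<bullet> N t) + (norm \<Delta>)\<^sup>2 * b0)"
      by (simp only: distrib_left mult.assoc)
    also have "exp (k2 * (t + h)) * exp (- k2 * h) = exp (k2 * t)"
      by (simp add: algebra_simps flip: exp_add)
    also have "exp (k2 * t) * (M t + 2 * (\<Delta> \<bullet> N t) + (norm \<Delta>)\<^sup>2 * b0)
        = exp (k2 * t) * M t + \<phi> t \<bullet> \<Delta> + exp (k2 * t) * ((norm \<Delta>)\<^sup>2 * b0)"
      by (simp add: \<phi>_def inner_commute algebra_simps)
    \<comment> \<open>\<open>h ^ 3 \<le> T * h\<^sup>2\<close> moves the contribution of the new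
      history into the quadratic error.\<close>
    also have "exp (k2 * (t + h)) * (g 0 * K\<^sup>2 * h ^ 3) \<le> E * (g 0 * K\<^sup>2 * (T * h\<^sup>2))"
    proof (intro mult_mono exp_le th mult_left_mono)
      have "h * h\<^sup>2 \<le> T * h\<^sup>2" using th by (intro mult_right_mono) auto
      then show "h ^ 3 \<le> T * h\<^sup>2" by (simp add: power_numeral_reduce)
    qed (use th g0_pos in \<open>auto simp: E_def\<close>)
    also have "exp (k2 * t) * ((norm \<Delta>)\<^sup>2 * b0) \<le> E * ((K * h)\<^sup>2 * b0)"
      using Y_step[OF K th] exp_le[of t] th b0
      by (intro mult_mono mult_right_mono power_mono) (auto simp: E_def \<Delta>_def)
    finally have 1: "exp (k2 * (t + h)) * M (t + h) \<le>
        E * (g 0 * K\<^sup>2 * (T * h\<^sup>2)) + (exp (k2 * t) * M t + \<phi> t \<bullet> \<Delta> + E * ((K * h)\<^sup>2 * b0))"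
      by simp
    have "norm (integral {t..t + h} (\<lambda>r. \<phi> r \<bullet> y r) - \<phi> t \<bullet> integral {t..t + h} y) \<le> L * K * h\<^sup>2"
    proof (rule riemann_step[OF bounded_bilinear_inner])
      show "norm (x \<bullet> z) \<le> norm x * norm z" for x z :: complex
        using Cauchy_Schwarz_ineq2 by simp
      show "continuous_on {t..t + h} \<phi>"
        unfolding \<phi>_def using th by (intro continuous_intros continuous_on_subset[OF N_cont]) auto
      show "continuous_on {t..t + h} y"
        using th by (intro continuous_on_subset[OF y_cont]) auto
      show "norm (\<phi> r - \<phi> t) \<le> L * h" if "r \<in> {t..t + h}" for r
        using \<phi>_lip[OF th that] .
    qed (use K th in auto)
    then have 2: "\<phi> t \<bullet> \<Delta> \<le> integral {t..t + h} W + L * K * h\<^sup>2"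
      using th by (simp add: Y_diff \<Delta>_def W_def[abs_def] \<phi>_def abs_le_iff)
    have "f (t + h) - f t = exp (k2 * (t + h)) * M (t + h) - exp (k2 * t) * M t - integral {t..t + h} W"
      using integral_add_interval[OF W_cont th(1,2)] by (simp add: f_def)
    also have "\<dots> \<le> E * (g 0 * K\<^sup>2 * (T * h\<^sup>2)) + L * K * h\<^sup>2 + E * ((K * h)\<^sup>2 * b0)"
      using 1 2 by linarith
    also have "\<dots> = (E * (g 0 * K\<^sup>2 * T) + L * K + E * (K\<^sup>2 * b0)) * h\<^sup>2"
      by (simp add: algebra_simps power_mult_distrib)
    finally show "f (t + h) - f t \<le> (E * (g 0 * K\<^sup>2 * T) + L * K + E * (K\<^sup>2 * b0)) * h\<^sup>2" .
  qed
  then have "exp (k2 * T) * M T \<le> M 0 + integral {0..T} W" by (simp add: f_def)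
  then have "exp (- k2 * T) * (exp (k2 * T) * M T) \<le> exp (- k2 * T) * (M 0 + integral {0..T} W)"
    by (intro mult_left_mono) auto
  then show ?thesis by (simp add: P_def flip: mult.assoc exp_add)
qed

definition V :: "real \<Rightarrow> complex" where "V r = (exp (k1 * r) / k1) *\<^sub>R y r"

lemma V_cont: "continuous_on {0..} V"
  unfolding V_def using k_pos by (intro continuous_intros y_cont) auto

text \<open>The increments of \<open>exp (k1 * t) *\<^sub>R Q t\<close> and of the integral of
  \<open>V\<close> agree up to order \<open>h\<^sup>2\<close> in norm, so telescoping gives an
  equality here.\<close>

lemma Q_eq:
  assumes T: "T \<ge> 0"
  shows "Q T = exp (- k1 * T) *\<^sub>R (Q 0 + integral {0..T} V)"
proof -
  obtain K where K: "K \<ge> 0" "\<forall>r\<in>{0..T}. norm (y r) \<le> K" by (rule y_bounded)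
  define E where "E = exp (k1 * T)"
  have exp_le: "exp (k1 * r) \<le> E" if "r \<le> T" for r
    using that k_pos by (simp add: E_def)
  define f where "f t = exp (k1 * t) *\<^sub>R Q t - integral {0..t} V" for t
  have "f T = f 0"
  proof (rule telescoping_constant[OF _ T])
    fix t h assume th: "0 \<le> t" "0 \<le> h" "t + h \<le> T"
    define \<Delta> where "\<Delta> = Y (t + h) - Y t"
    define R where "R = Q (t + h) - exp (- k1 * h) *\<^sub>R (Q t + (1 / k1) *\<^sub>R \<Delta>)"
    have "exp (k1 * (t + h)) *\<^sub>R Q (t + h) = exp (k1 * (t + h)) *\<^sub>R R
        + (exp (k1 * (t + h)) * exp (- k1 * h)) *\<^sub>R (Q t + (1 / k1) *\<^sub>R \<Delta>)"
      by (simp only: R_def scaleR_diff_right scaleR_scaleR diff_add_cancel)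
    also have "exp (k1 * (t + h)) * exp (- k1 * h) = exp (k1 * t)"
      by (simp add: algebra_simps flip: exp_add)
    finally have Q: "exp (k1 * (t + h)) *\<^sub>R Q (t + h) - exp (k1 * t) *\<^sub>R Q t
        = exp (k1 * (t + h)) *\<^sub>R R + (exp (k1 * t) / k1) *\<^sub>R \<Delta>"
      by (simp add: scaleR_add_right)
    have "f (t + h) - f t = (exp (k1 * (t + h)) *\<^sub>R Q (t + h) - exp (k1 * t) *\<^sub>R Q t) - integral {t..t + h} V"
      unfolding f_def integral_add_interval[OF V_cont th(1,2), symmetric] by simp
    also have "\<dots> = exp (k1 * (t + h)) *\<^sub>R R - (integral {t..t + h} V - (exp (k1 * t) / k1) *\<^sub>R integral {t..t + h} y)"
      unfolding Q using th by (simp add: \<Delta>_def Y_diff)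
    also have "norm \<dots> \<le> E * (K * h\<^sup>2) + E * K * h\<^sup>2"
    proof (rule order_trans[OF norm_triangle_ineq4 add_mono])
      have "norm R \<le> K * h\<^sup>2" unfolding R_def \<Delta>_def by (rule Q_step[OF K th])
      then show "norm (exp (k1 * (t + h)) *\<^sub>R R) \<le> E * (K * h\<^sup>2)"
        using exp_le[OF th(3)] by (simp add: mult_mono E_def)
      show "norm (integral {t..t + h} V - (exp (k1 * t) / k1) *\<^sub>R integral {t..t + h} y) \<le> E * K * h\<^sup>2"
        unfolding V_def
      proof (rule riemann_step[OF bounded_bilinear_scaleR, where \<phi> = "\<lambda>r. exp (k1 * r) / k1"])
        show "continuous_on {t..t + h} y"
          using th by (intro continuous_on_subset[OF y_cont]) auto
        show "norm (exp (k1 * r) / k1 - exp (k1 * t) / k1) \<le> E * h" if r: "r \<in> {t..t + h}" for r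
        proof -
          have "exp (k1 * r) - exp (k1 * t) \<le> exp (k1 * r) * (k1 * (r - t))" by (rule exp_diff_le)
          also have "\<dots> \<le> E * (k1 * h)"
            using r th k_pos exp_le by (intro mult_mono) (auto simp: E_def)
          finally have "(exp (k1 * r) - exp (k1 * t)) / k1 \<le> E * h"
            using k_pos by (simp add: field_simps)
          moreover have "exp (k1 * t) \<le> exp (k1 * r)" using r k_pos by simp
          ultimately show ?thesis using k_pos by (simp add: divide_right_mono flip: diff_divide_distrib)
        qed
      qed (use K th k_pos in \<open>auto intro!: continuous_intros\<close>)
    qed
    finally show "norm (f (t + h) - f t) \<le> (2 * E * K) * h\<^sup>2" by simp
  qed
  then have "exp (k1 * T) *\<^sub>R Q T = Q 0 + integral {0..T} V" by (simp add: f_def algebra_simps)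
  then have "exp (- k1 * T) *\<^sub>R (exp (k1 * T) *\<^sub>R Q T) = exp (- k1 * T) *\<^sub>R (Q 0 + integral {0..T} V)"
    by simp
  then show ?thesis by (simp flip: exp_add)
qed

text \<open>Instead of differentiating under the integral that defines \<open>Q\<close>, one
  differentiates the right-hand side of \<open>Q_eq\<close>.\<close>

lemma Q_deriv: "(Q has_vector_derivative (1 / k1) *\<^sub>R y t - k1 *\<^sub>R Q t) (at t within {0..})" if "t \<ge> 0"
proof -
  let ?F = "\<lambda>t. exp (- k1 * t) *\<^sub>R (Q 0 + integral {0..t} V)"
  have "((\<lambda>t. exp (- k1 * t)) has_real_derivative - k1 * exp (- k1 * t)) (at t within {0..})"
    by (auto intro!: derivative_eq_intros)
  moreover have "((\<lambda>t. Q 0 + integral {0..t} V) has_vector_derivative 0 + V t) (at t within {0..})"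
    by (intro has_vector_derivative_add has_vector_derivative_const integral_deriv_halfline[OF V_cont that])
  ultimately have "(?F has_vector_derivative exp (- k1 * t) *\<^sub>R (0 + V t)
      + (- k1 * exp (- k1 * t)) *\<^sub>R (Q 0 + integral {0..t} V)) (at t within {0..})"
    by (rule has_vector_derivative_scaleR)
  also have "exp (- k1 * t) *\<^sub>R (0 + V t) + (- k1 * exp (- k1 * t)) *\<^sub>R (Q 0 + integral {0..t} V)
      = (1 / k1) *\<^sub>R y t - k1 *\<^sub>R Q t"
  proof -
    have "exp (- k1 * t) *\<^sub>R (0 + V t) = (1 / k1) *\<^sub>R y t"
      by (simp add: V_def flip: exp_add)
    moreover have "(- k1 * exp (- k1 * t)) *\<^sub>R (Q 0 + integral {0..t} V) = - (k1 *\<^sub>R Q t)"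
      by (subst Q_eq[OF that]) simp
    ultimately show ?thesis by simp
  qed
  finally show ?thesis
    by (rule has_vector_derivative_transform[rotated 2]) (use that in \<open>simp, simp only: atLeast_iff, intro Q_eq\<close>)
qed

end

section \<open>Decay of solutions\<close>

theorem theorem3p8:
  fixes \<rho>1 \<rho>2 \<rho>3 k b m \<delta> \<beta> k1 k2 b0 a \<chi>0 :: real
    and g g' :: "real \<Rightarrow> real"
  assumes "\<rho>1 > 0" "\<rho>2 > 0" "\<rho>3 > 0" "k > 0" "b > 0" "m > 0" "\<delta> > 0" "\<beta> > 0"
    and "\<forall>s\<ge>0. (g has_real_derivative g' s) (at s within {0..})"
    and "\<exists>s\<ge>0. g s \<noteq> 0"
    and "\<forall>s\<ge>0. g s \<ge> 0"
    and "k1 > 0" "k2 > 0"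
    and "\<forall>s\<ge>0. - k1 * g s \<le> g' s \<and> g' s \<le> - k2 * g s"
    and "b0 = (LINT s:{0..}|lborel. g s)"
    and "a = b - b0" and "a > 0"
    and "\<chi>0 = \<rho>2 - b * \<rho>1 / k"
  shows "\<exists>C>0. \<exists>lam>0. \<forall>\<xi> v u z y \<theta> \<eta>.
    timoshenko_fourier_solution \<rho>1 \<rho>2 \<rho>3 k a m \<delta> \<beta> g \<xi> v u z y \<theta> \<eta> \<longrightarrow>
    (\<forall>t\<ge>0. fourier_energy \<rho>1 \<rho>2 \<rho>3 k a m g \<xi> v u z y \<theta> \<eta> t
       \<le> C * exp (- lam * decay_rate \<chi>0 \<xi> * t)
           * fourier_energy \<rho>1 \<rho>2 \<rho>3 k a m g \<xi> v u z y \<theta> \<eta> 0)"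
proof -
  interpret memory_kernel g g' k1 k2
    using assms by unfold_locales auto
  have g_int: "b0 = (LINT s:{0..}|lborel. g s)" by fact
  \<comment> \<open>\<open>b0\<close> comes from the bound on \<open>N\<close> and
    \<open>1 / (k1 * g 0)\<close> from the bound on \<open>Q\<close>; their sum serves both.\<close>
  define c where "c = sqrt (b0 + 1 / (k1 * g 0))"
  have c: "c > 0" "c\<^sup>2 = b0 + 1 / (k1 * g 0)"
    using g_integral_pos g0_pos assms(12) by (simp_all add: c_def g_int add_pos_pos)
  \<comment> \<open>All constants are fixed before \<xi> and the solution. \<open>c0\<close> is the
    least leading coefficient of the dissipation, \<open>C\<close> the largest cross-term bound and
    \<open>B\<close> the largest bound on a corrector.\<close>
  define c0 where "c0 = Min {\<rho>2 / k1, 1, a, \<rho>1, 2 * \<beta>, k2 * m}"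
  have c0: "c0 > 0" "c0 \<le> \<rho>2 / k1" "c0 \<le> 1" "c0 \<le> a" "c0 \<le> \<rho>1" "c0 \<le> 2 * \<beta>" "c0 \<le> k2 * m"
    using assms by (simp_all add: c0_def)
  define C where "C = Max {c * (\<rho>2 * k1 + 1 + m * c + \<delta>), m * c + \<delta> + \<rho>2 * k + \<rho>2 * (k + a),
      1 + \<rho>1, 2 / k * (1 + a\<^sup>2) + \<rho>1}"
  have C: "c * (\<rho>2 * k1 + 1 + m * c + \<delta>) \<le> C" "m * c + \<delta> + \<rho>2 * k + \<rho>2 * (k + a) \<le> C"
    "1 + \<rho>1 \<le> C" "2 / k * (1 + a\<^sup>2) + \<rho>1 \<le> C"
    unfolding C_def by (intro Max_ge; simp)+
  define B where "B = Max {\<rho>2 * c * (1 / \<rho>2 + 1 / m), \<rho>2 * (k * (1 / \<rho>2 + 1 / k) + a * (1 / \<rho>2 + 1 / a)),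
      \<rho>1 * (1 / \<rho>1 + 1 / a), \<rho>1 * (1 / \<rho>1 + 1 / k)}"
  have B: "\<rho>2 * c * (1 / \<rho>2 + 1 / m) \<le> B" "\<rho>2 * (k * (1 / \<rho>2 + 1 / k) + a * (1 / \<rho>2 + 1 / a)) \<le> B"
    "\<rho>1 * (1 / \<rho>1 + 1 / a) \<le> B" "\<rho>1 * (1 / \<rho>1 + 1 / k) \<le> B"
    unfolding B_def by (intro Max_ge; simp)+
  have "C \<ge> 0" using C(3) assms(1) by linarith
  then have "C / c0 \<ge> 0" using c0(1) by simp
  from coercive_combination[OF this] obtain A1 A2 A3 K0 where A: "A1 \<ge> 0" "A2 \<ge> 0" "A3 \<ge> 0" "K0 \<ge> 0"
    and hier: "\<And>K d1 d2 d4 d3 e yy ww zz uu tt p. K \<ge> K0 \<Longrightarrow>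
       d1 \<ge> yy\<^sup>2 - C / c0 * (yy * p + ww * p + tt * p + p\<^sup>2) \<Longrightarrow>
       d2 \<ge> ww\<^sup>2 - C / c0 * (p * ww + tt * ww + uu * yy + yy\<^sup>2) \<Longrightarrow>
       d3 \<ge> zz\<^sup>2 - C / c0 * (ww * zz + uu * yy) \<Longrightarrow>
       d4 \<ge> uu\<^sup>2 - C / c0 * (ww\<^sup>2 + zz\<^sup>2 + uu * yy) \<Longrightarrow>
       e \<ge> tt\<^sup>2 + p\<^sup>2 \<Longrightarrow>
       K * e + A1 * d1 + A2 * d2 + A3 * d3 + d4
         \<ge> (tt\<^sup>2 + p\<^sup>2 + yy\<^sup>2 + ww\<^sup>2 + zz\<^sup>2 + uu\<^sup>2) / 2"
    by metis
  define M where "M = (A1 + A2 + A3 + 1) * B"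
  define K where "K = K0 + M + 1"
  define R where "R = \<rho>1 + \<rho>2 + \<rho>3 + 2 / k * (1 + a\<^sup>2) + a + m"
  define lam where "lam = c0 / (2 * R * (K + M))"
  have "0 \<le> \<rho>1 * (1 / \<rho>1 + 1 / a)" using assms by simp
  then have "B \<ge> 0" using B(3) by linarith
  then have "M \<ge> 0" using A by (simp add: M_def)
  then have KM: "K + M > 0" using A by (simp add: K_def)
  have "0 \<le> 2 / k * (1 + a\<^sup>2)" using assms by simp
  then have "R > 0" unfolding R_def using assms by linarith
  then have lam: "lam > 0" using KM c0 by (simp add: lam_def)
  have "fourier_energy \<rho>1 \<rho>2 \<rho>3 k a m g \<xi> v u z y \<theta> \<eta> t
       \<le> (K + M) * exp (- lam * decay_rate \<chi>0 \<xi> * t) * fourier_energy \<rho>1 \<rho>2 \<rho>3 k a m g \<xi> v u z y \<theta> \<eta> 0"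
    if sol: "timoshenko_fourier_solution \<rho>1 \<rho>2 \<rho>3 k a m \<delta> \<beta> g \<xi> v u z y \<theta> \<eta>" and t: "t \<ge> 0"
    for \<xi> v u z y \<theta> \<eta> t
  proof -
    note sol' = sol[unfolded timoshenko_fourier_solution_def]
    obtain v' u' z' y' \<theta>' where "\<forall>t\<ge>0.
        (v has_vector_derivative v' t) (at t within {0..}) \<and>
        (u has_vector_derivative u' t) (at t within {0..}) \<and>
        (z has_vector_derivative z' t) (at t within {0..}) \<and>
        (y has_vector_derivative y' t) (at t within {0..}) \<and>
        (\<theta> has_vector_derivative \<theta>' t) (at t within {0..}) \<and>
        v' t - \<i> * of_real \<xi> * u t + y t = 0 \<and>
        of_real \<rho>1 * u' t - \<i> * of_real (k * \<xi>) * v t = 0 \<and>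
        z' t - \<i> * of_real \<xi> * y t = 0 \<and>
        of_real \<rho>2 * y' t - \<i> * of_real (a * \<xi>) * z t
          + of_real (m * \<xi>\<^sup>2) * (LINT s:{0..}|lborel. of_real (g s) * \<eta> t s)
          - of_real k * v t + \<i> * of_real (\<delta> * \<xi>) * \<theta> t = 0 \<and>
        of_real \<rho>3 * \<theta>' t + of_real (\<beta> * \<xi>\<^sup>2) * \<theta> t + \<i> * of_real (\<delta> * \<xi>) * y t = 0"
      using conjunct1[OF sol'] by (elim exE) (rule that)
    note eqs = this[rule_format]
    note \<eta> = conjunct2[OF sol']
    interpret H: memory_history g g' k1 k2 \<eta> y
    proof unfold_locales
      show "continuous_on {0..} y"
        unfolding continuous_on_eq_continuous_within
        using eqs[THEN conjunct2, THEN conjunct2, THEN conjunct2, THEN conjunct1, THEN has_vector_derivative_continuous]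
        by simp
      show "continuous_on ({0..} \<times> {0..}) (\<lambda>(t, s). \<eta> t s)" using \<eta> by (elim conjE)
      show "\<exists>Dt Ds. ((\<lambda>(t, s). \<eta> t s) has_derivative (\<lambda>(h, r). h *\<^sub>R Dt + r *\<^sub>R Ds)) (at (t, s)) \<and> Dt + Ds - y t = 0"
        if "t > 0" "s > 0" for t s
        using \<eta> that by (elim conjE) simp
      show "\<eta> t 0 = 0" if "t \<ge> 0" for t using \<eta> that by simp
      show "set_integrable lborel {0..} (\<lambda>s. g s * (norm (\<eta> t s))\<^sup>2)" if "t \<ge> 0" for t
        using \<eta> that by simp
    qed
    have bound: "norm X \<le> c * sqrt (H.P t)" if "(norm X)\<^sup>2 \<le> r * H.M t" "r \<le> c\<^sup>2" "t \<ge> 0" for X :: complex and r t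
    proof -
      have "r * H.M t \<le> c\<^sup>2 * H.P t"
        using that(2) H.M_le_P[OF that(3)] H.M_nonneg[of t] by (intro mult_mono) auto
      with that(1) have "norm X \<le> sqrt (c\<^sup>2 * H.P t)" by (intro real_le_rsqrt) linarith
      then show ?thesis using c(1) by (simp add: real_sqrt_mult)
    qed
    interpret D: damped_modes \<rho>1 \<rho>2 \<rho>3 k a m \<delta> \<beta> k1 k2 c \<xi> v u z y \<theta> H.N H.Q H.P v' u' z' y' \<theta>'
    proof unfold_locales
      fix t :: real assume t: "t \<ge> 0"
      note e = eqs[OF t]
      have "v' t - (\<xi> *\<^sub>R (\<i> * u t) - y t) = v' t - \<i> * of_real \<xi> * u t + y t"
        by (simp add: scaleR_conv_of_real)
      then show "v' t = \<xi> *\<^sub>R (\<i> * u t) - y t" using e by simp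
      have "z' t - \<xi> *\<^sub>R (\<i> * y t) = z' t - \<i> * of_real \<xi> * y t"
        by (simp add: scaleR_conv_of_real)
      then show "z' t = \<xi> *\<^sub>R (\<i> * y t)" using e by simp
      have "\<rho>1 *\<^sub>R u' t - (k * \<xi>) *\<^sub>R (\<i> * v t) = of_real \<rho>1 * u' t - \<i> * of_real (k * \<xi>) * v t"
        by (simp add: scaleR_conv_of_real)
      then show "\<rho>1 *\<^sub>R u' t = (k * \<xi>) *\<^sub>R (\<i> * v t)" using e by simp
      have "\<rho>3 *\<^sub>R \<theta>' t - (- (\<beta> * \<xi>\<^sup>2) *\<^sub>R \<theta> t - (\<delta> * \<xi>) *\<^sub>R (\<i> * y t))
          = of_real \<rho>3 * \<theta>' t + of_real (\<beta> * \<xi>\<^sup>2) * \<theta> t + \<i> * of_real (\<delta> * \<xi>) * y t"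
        by (simp add: scaleR_conv_of_real)
      also have "\<dots> = 0" using e by (elim conjE)
      finally show "\<rho>3 *\<^sub>R \<theta>' t = - (\<beta> * \<xi>\<^sup>2) *\<^sub>R \<theta> t - (\<delta> * \<xi>) *\<^sub>R (\<i> * y t)"
        by (rule eq_iff_diff_eq_0[THEN iffD2])
      have "(LINT s:{0..}|lborel. of_real (g s) * \<eta> t s) = H.N t"
        by (simp add: H.N_def scaleR_conv_of_real)
      then have "\<rho>2 *\<^sub>R y' t - (k *\<^sub>R v t + (a * \<xi>) *\<^sub>R (\<i> * z t) - (m * \<xi>\<^sup>2) *\<^sub>R H.N t - (\<delta> * \<xi>) *\<^sub>R (\<i> * \<theta> t))
          = of_real \<rho>2 * y' t - \<i> * of_real (a * \<xi>) * z t
          + of_real (m * \<xi>\<^sup>2) * (LINT s:{0..}|lborel. of_real (g s) * \<eta> t s)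
          - of_real k * v t + \<i> * of_real (\<delta> * \<xi>) * \<theta> t"
        by (simp add: scaleR_conv_of_real)
      also have "\<dots> = 0" using e by (elim conjE)
      finally show "\<rho>2 *\<^sub>R y' t = k *\<^sub>R v t + (a * \<xi>) *\<^sub>R (\<i> * z t)
        - (m * \<xi>\<^sup>2) *\<^sub>R H.N t - (\<delta> * \<xi>) *\<^sub>R (\<i> * \<theta> t)"
        by (rule eq_iff_diff_eq_0[THEN iffD2])
      show "norm (H.N t) \<le> c * sqrt (H.P t)"
        by (rule bound[OF H.N_le[OF t] _ t]) (use c(2) g0_pos k_pos in \<open>simp add: g_int\<close>)
      show "norm (H.Q t) \<le> c * sqrt (H.P t)"
        by (rule bound[OF H.Q_le[OF t] _ t]) (use c(2) g_integral_pos in \<open>simp add: g_int\<close>)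
      show "H.P t \<ge> 0"
        using H.M_le_P[OF t] H.M_nonneg[of t] by linarith
      show "(v has_vector_derivative v' t) (at t within {0..})"
        "(u has_vector_derivative u' t) (at t within {0..})"
        "(z has_vector_derivative z' t) (at t within {0..})"
        "(y has_vector_derivative y' t) (at t within {0..})"
        "(\<theta> has_vector_derivative \<theta>' t) (at t within {0..})"
        by (rule e[THEN conjunct1] e[THEN conjunct2, THEN conjunct1]
            e[THEN conjunct2, THEN conjunct2, THEN conjunct1]
            e[THEN conjunct2, THEN conjunct2, THEN conjunct2, THEN conjunct1]
            e[THEN conjunct2, THEN conjunct2, THEN conjunct2, THEN conjunct2, THEN conjunct1])+
    qed (rule assms c H.Q_deriv H.P_deriv; assumption?)+
    \<comment> \<open>\<open>H.P\<close> dominates the true history energy at later times and equals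
      it at time 0, so the estimate for \<open>D.energy\<close> transfers back at both ends.\<close>
    have energy: "fourier_energy \<rho>1 \<rho>2 \<rho>3 k a m g \<xi> v u z y \<theta> \<eta> s
        = D.energy s - m * \<xi>\<^sup>2 * (H.P s - H.M s)" for s
      by (simp add: fourier_energy_def D.energy_def H.M_def algebra_simps)
    have rate: "decay_rate \<chi>0 \<xi> \<le> \<xi> ^ 4 / (1 + \<xi>\<^sup>2) ^ 3"
    proof -
      have "(1 + \<xi>\<^sup>2) ^ 3 \<le> (1 + \<xi>\<^sup>2) ^ 4" by (intro power_increasing) auto
      then have "\<xi> ^ 4 / (1 + \<xi>\<^sup>2) ^ 4 \<le> \<xi> ^ 4 / (1 + \<xi>\<^sup>2) ^ 3"
        by (intro divide_left_mono mult_pos_pos zero_less_power) (auto simp: add_pos_nonneg)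
      then show ?thesis by (simp add: decay_rate_def)
    qed
    have "fourier_energy \<rho>1 \<rho>2 \<rho>3 k a m g \<xi> v u z y \<theta> \<eta> t \<le> D.energy t"
      using H.M_le_P[OF t] assms(6) by (simp add: energy)
    also have "\<dots> \<le> (K + M) * exp (- (c0 / (2 * R * (K + M))) * (\<xi> ^ 4 / (1 + \<xi>\<^sup>2) ^ 3) * t) * D.energy 0"
      by (rule D.energy_decay[OF A hier c0 C B M_def K_def R_def t])
    also have "\<dots> \<le> (K + M) * exp (- lam * decay_rate \<chi>0 \<xi> * t) * D.energy 0"
    proof (intro mult_right_mono mult_left_mono D.energy_ge)
      have "lam * decay_rate \<chi>0 \<xi> * t \<le> lam * (\<xi> ^ 4 / (1 + \<xi>\<^sup>2) ^ 3) * t"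
        using lam t rate by (intro mult_right_mono mult_left_mono) auto
      then show "exp (- (c0 / (2 * R * (K + M))) * (\<xi> ^ 4 / (1 + \<xi>\<^sup>2) ^ 3) * t) \<le> exp (- lam * decay_rate \<chi>0 \<xi> * t)"
        unfolding lam_def by simp
    qed (use KM in auto)
    also have "D.energy 0 = fourier_energy \<rho>1 \<rho>2 \<rho>3 k a m g \<xi> v u z y \<theta> \<eta> 0"
      by (simp add: energy H.P_0)
    finally show ?thesis .
  qed
  with KM lam show ?thesis by blast
qed

end
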